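(* Let $T>0$ and $f(z)=\Lambda z$. Assume that the support of $\Theta$ is not bounded, that $\Lambda>0$, and that $cT-M(T)>0$. Then the optimal solution $\phi^*\in\mathcal C$ of the insurer program $\sup_{\phi\in\mathcal C}\mathcal U(\phi)$ (for a suitable $\Theta$-a.e. representative) satisfies the following. 1. The set $\mathcal A_0:=\{z: G(\phi^* )(z)<0\}$ is non-empty, and $\phi^*\equiv0$ on $\mathcal A_0$. 2. The set $\mathcal A_1:=\{z: G(\phi^* )(z)=0\}$ is non-empty, and on $\mathcal A_1$ the contract $\phi^*$ is affine with slope larger than $1$ and satisfies the implicit system $$\phi^*(z)=\left(1-\Lambda\,\frac{B(T)}{2M(T)}\,H[\phi^*-\mathcal I]\right)z-C^*,$$ $$C^*:=\frac{cT-M(T)+2\gamma A(T)\,H[\phi^*-\mathcal I]+\gamma B(T)\,H\bigl[\Lambda\mathcal I\cdot(\phi^*-\mathcal I)\bigr]}{2\gamma M(T)} .$$ 3. The set $\mathcal A_2:=\{z: G(\phi^* )(z)>0\}$ is non-empty, and $\phi^*(z)=z$ on $\mathcal A_2$.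
   Context: Let $(\Omega,\mathcal F,(\mathcal F_t)_{t\ge0},\mathbb Q)$ be a filtered probability space satisfying the usual conditions; $\mathbb E$ and $\mathbb V$ denote expectation and variance, and $\mathbb R^+=[0,\infty)$. Let $\Theta$ be a measure on $(\mathbb R^+,\mathcal B(\mathbb R^+))$ with finite moments up to order two: $\int_0^\infty(1+z+z^2)\,\Theta(dz)<\infty$. For a $\Theta$-integrable function $g$, $H[g]:=\int_0^\infty g(z)\,\Theta(dz)$; $\mathcal I$ is the identity function on $\mathbb R^+$, $\mathbb 1$ the constant function equal to $1$, and $\overline\theta:=H[\mathcal I]$. Let $f(z)=\Lambda z$ with $\Lambda\ge0$ and $H[f]=\Lambda\overline\theta<\beta$, where $\beta$ is a constant. Let $(T_i,Z_i)_{i\ge1}$ be a marked point process (loss times and loss sizes), let $\nu(dt,dz)$ be the associated random counting measure, and assume it is a marked Hawkes process: the compensator of $\nu$ is $\lambda_{t^-}\Theta(dz)\,dt$, where $$\lambda_t=\lambda_0+\beta\int_0^t(\underline\lambda-\lambda_{s^-})\,ds+\int_0^{t^-}\int_{\mathbb R^+}f(z)\,\nu(ds,dz),$$ with constant intensities $\lambda_0>\underline\lambda\ge0$. Under these assumptions $\lambda$ is well defined and has finite moments up to order two. Set $m(t)=\mathbb E[\lambda_t]$, $M(t)=\int_0^t m(s)\,ds$, $m^{(2)}(t)=\mathbb E[\lambda_t^2]$, and $$A(T)=2\int_0^T\int_0^t e^{-(\beta-H[f])(t-s)}\bigl[\beta\underline\lambda M(s)+m^{(2)}(s)\bigr]\,ds\,dt-M(T)^2,$$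 $$B(T)=2\int_0^T\int_0^t e^{-(\beta-H[f])(t-s)}m(s)\,ds\,dt .$$ The set of reinsurance contracts is $\mathcal C=\{h:\mathbb R^+\to\mathbb R\text{ measurable}:\ 0\le h(z)\le z\ \ \Theta\text{-a.s.}\}$, viewed as a subset of $L^2(\Theta)$ (so contracts are identified when equal $\Theta$-a.e.). The insurer's wealth under $\phi\in\mathcal C$ is $$R_t(\phi)=R_0+\int_0^t\int_0^\infty(\phi(z)-z)\,\nu(ds,dz)+\rho\,\overline\theta\,t-c\,t\int_0^\infty\phi(z)\,\Theta(dz),$$ where $R_0,\rho,c$ are constants, and the criterion is $\mathcal U(\phi)=\mathbb E[R_T(\phi)]-\gamma\,\mathbb V[R_T(\phi)]$ with a constant $\gamma>0$. For $\phi\in L^2(\Theta)$ define the function $$\begin{aligned}G(\phi):={}&\Bigl((M(T)-cT)-2\gamma H[\phi-\mathcal I]A(T)-\gamma H[f\cdot(\phi-\mathcal I)]B(T)\Bigr)\mathbb 1\\&-\gamma H[\phi-\mathcal I]B(T)\,f-2\gamma M(T)\,(\phi-\mathcal I).\end{aligned}$$ *)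

theory Defs
  imports "HOL-Probability.Probability"
begin

text \<open>
  Time and marks both live in \<open>{0..}\<close>, represented as a subset of the reals: random measures are
  measures on \<open>Rplus \<Otimes>\<^sub>M Rplus\<close> (time first, mark second), and a process is a function
  \<open>X t \<omega>\<close> whose values at \<open>t < 0\<close> are irrelevant.  Likewise only \<open>F t\<close> with \<open>t \<ge> 0\<close> matters.
\<close>

abbreviation Rplus :: "real measure" where
  "Rplus \<equiv> restrict_space borel {0..}"

definition usual_conditions :: "'a measure \<Rightarrow> (real \<Rightarrow> 'a measure) \<Rightarrow> bool" where
  "usual_conditions Q F \<longleftrightarrow>
     (\<forall>t\<ge>0. subalgebra Q (F t)) \<and>
     (\<forall>s t. 0 \<le> s \<and> s \<le> t \<longrightarrow> sets (F s) \<subseteq> sets (F t)) \<and>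
     (\<forall>t\<ge>0. sets (F t) = (\<Inter>s\<in>{t<..}. sets (F s))) \<and>
     complete_measure Q \<and> null_sets Q \<subseteq> sets (F 0)"

definition predictable :: "'a measure \<Rightarrow> (real \<Rightarrow> 'a measure) \<Rightarrow> ('a \<times> real) measure" where
  "predictable Q F = sigma (space Q \<times> {0..})
     ({A \<times> {0} | A. A \<in> sets (F 0)} \<union>
      {A \<times> {s<..t} | A s t. 0 \<le> s \<and> s \<le> t \<and> A \<in> sets (F s)})"

text \<open>
  The event times \<open>\<tau> i\<close> take values in \<open>[0,\<infinity>]\<close>, where \<open>\<tau> i \<omega> = \<infinity>\<close> means that there are at most
  \<open>i\<close> events in total; this happens with positive probability for a Hawkes process whose base
  intensity is zero.  The second condition says that \<open>\<tau> i\<close> is a stopping time and that \<open>Z i\<close> is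
  known at time \<open>\<tau> i\<close>; the last one is the absence of explosion.
\<close>

definition marked_point_process ::
  "'a measure \<Rightarrow> (real \<Rightarrow> 'a measure) \<Rightarrow> (nat \<Rightarrow> 'a \<Rightarrow> ennreal) \<Rightarrow> (nat \<Rightarrow> 'a \<Rightarrow> real) \<Rightarrow> bool" where
  "marked_point_process Q F \<tau> Z \<longleftrightarrow>
     (\<forall>i. \<tau> i \<in> borel_measurable Q \<and> Z i \<in> measurable Q Rplus) \<and>
     (\<forall>i. \<forall>t\<ge>0. \<forall>B\<in>sets Rplus.
        {\<omega> \<in> space Q. \<tau> i \<omega> \<le> ennreal t \<and> Z i \<omega> \<in> B} \<in> sets (F t)) \<and>
     (AE \<omega> in Q.
        0 < \<tau> 0 \<omega> \<and>
        (\<forall>i. \<tau> i \<omega> \<le> \<tau> (Suc i) \<omega> \<and> (\<tau> i \<omega> < \<infinity> \<longrightarrow> \<tau> i \<omega> < \<tau> (Suc i) \<omega>)) \<and>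
        (\<lambda>i. \<tau> i \<omega>) \<longlonglongrightarrow> \<infinity>)"

text \<open>The sum of the Dirac masses at \<open>(\<tau> i \<omega>, Z i \<omega>)\<close> over all \<open>i\<close> with \<open>\<tau> i \<omega> < \<infinity>\<close>.\<close>

definition counting_measure ::
  "(nat \<Rightarrow> 'a \<Rightarrow> ennreal) \<Rightarrow> (nat \<Rightarrow> 'a \<Rightarrow> real) \<Rightarrow> 'a \<Rightarrow> (real \<times> real) measure" where
  "counting_measure \<tau> Z \<omega> =
     distr (count_space {i. \<tau> i \<omega> < \<infinity>}) (Rplus \<Otimes>\<^sub>M Rplus) (\<lambda>i. (enn2real (\<tau> i \<omega>), Z i \<omega>))"

text \<open>
  \<open>\<mu>\<close> is the compensator (dual predictable projection) of the random measure \<open>\<nu>\<close>: integrals of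
  nonnegative predictable functions against \<open>\<mu>\<close> are predictable processes, and they have the same
  expectation as the integrals against \<open>\<nu>\<close>.
\<close>

definition compensator ::
  "'a measure \<Rightarrow> (real \<Rightarrow> 'a measure) \<Rightarrow>
   ('a \<Rightarrow> (real \<times> real) measure) \<Rightarrow> ('a \<Rightarrow> (real \<times> real) measure) \<Rightarrow> bool" where
  "compensator Q F \<nu> \<mu> \<longleftrightarrow>
     (\<forall>W :: ('a \<times> real) \<times> real \<Rightarrow> ennreal.
        W \<in> borel_measurable (predictable Q F \<Otimes>\<^sub>M Rplus) \<longrightarrow>
          (\<lambda>(\<omega>, t). \<integral>\<^sup>+ (s, z). W ((\<omega>, s), z) * indicator {0..t} s \<partial>\<mu> \<omega>)
             \<in> borel_measurable (predictable Q F) \<and>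
          (\<integral>\<^sup>+ \<omega>. (\<integral>\<^sup>+ (s, z). W ((\<omega>, s), z) \<partial>\<nu> \<omega>) \<partial>Q) =
          (\<integral>\<^sup>+ \<omega>. (\<integral>\<^sup>+ (s, z). W ((\<omega>, s), z) \<partial>\<mu> \<omega>) \<partial>Q))"

definition left_lim :: "(real \<Rightarrow> 'a \<Rightarrow> real) \<Rightarrow> 'a \<Rightarrow> real \<Rightarrow> real" where
  "left_lim X \<omega> t = Lim (at_left t) (\<lambda>s. X s \<omega>)"

text \<open>
  The marked Hawkes process with mark kernel \<open>f\<close>, mean reversion \<open>\<beta>\<close> towards \<open>lbar\<close> and initial
  intensity \<open>lam0\<close>.  The value of \<open>left_lim lam \<omega>\<close> at time \<open>0\<close> is unspecified, but it only enters
  through Lebesgue integrals in time.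
\<close>

definition marked_hawkes ::
  "'a measure \<Rightarrow> (real \<Rightarrow> 'a measure) \<Rightarrow> real measure \<Rightarrow> (real \<Rightarrow> real) \<Rightarrow> real \<Rightarrow> real \<Rightarrow> real \<Rightarrow>
   (nat \<Rightarrow> 'a \<Rightarrow> ennreal) \<Rightarrow> (nat \<Rightarrow> 'a \<Rightarrow> real) \<Rightarrow> (real \<Rightarrow> 'a \<Rightarrow> real) \<Rightarrow> bool" where
  "marked_hawkes Q F \<Theta> f \<beta> lbar lam0 \<tau> Z lam \<longleftrightarrow>
     marked_point_process Q F \<tau> Z \<and>
     compensator Q F (counting_measure \<tau> Z)
       (\<lambda>\<omega>. density (restrict_space lborel {0..} \<Otimes>\<^sub>M \<Theta>) (\<lambda>(s, z). ennreal (left_lim lam \<omega> s))) \<and>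
     (AE \<omega> in Q. \<forall>t\<ge>0.
        set_integrable lborel {0..t} (left_lim lam \<omega>) \<and>
        lam t \<omega> = lam0 + \<beta> * (LINT s:{0..t}|lborel. lbar - left_lim lam \<omega> s)
                + (LINT p:{0..<t} \<times> {0..}|counting_measure \<tau> Z \<omega>. f (snd p)))"

abbreviation H_int :: "real measure \<Rightarrow> (real \<Rightarrow> real) \<Rightarrow> real" where
  "H_int \<Theta> g \<equiv> integral\<^sup>L \<Theta> g"

definition measure_support :: "real measure \<Rightarrow> real set" where
  "measure_support \<Theta> = {z \<in> space \<Theta>. \<forall>e>0. emeasure \<Theta> (ball z e \<inter> space \<Theta>) > 0}"

definition mean_intensity :: "'a measure \<Rightarrow> (real \<Rightarrow> 'a \<Rightarrow> real) \<Rightarrow> real \<Rightarrow> real" where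
  "mean_intensity Q lam t = (\<integral>\<omega>. lam t \<omega> \<partial>Q)"

definition second_moment :: "'a measure \<Rightarrow> (real \<Rightarrow> 'a \<Rightarrow> real) \<Rightarrow> real \<Rightarrow> real" where
  "second_moment Q lam t = (\<integral>\<omega>. (lam t \<omega>)\<^sup>2 \<partial>Q)"

definition cum_mean :: "'a measure \<Rightarrow> (real \<Rightarrow> 'a \<Rightarrow> real) \<Rightarrow> real \<Rightarrow> real" where
  "cum_mean Q lam t = (LINT s:{0..t}|lborel. mean_intensity Q lam s)"

definition A_coeff ::
  "'a measure \<Rightarrow> real measure \<Rightarrow> (real \<Rightarrow> real) \<Rightarrow> real \<Rightarrow> real \<Rightarrow> (real \<Rightarrow> 'a \<Rightarrow> real) \<Rightarrow> real \<Rightarrow> real" where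
  "A_coeff Q \<Theta> f \<beta> lbar lam T =
     2 * (LINT t:{0..T}|lborel. (LINT s:{0..t}|lborel.
            exp (- (\<beta> - H_int \<Theta> f) * (t - s)) * (\<beta> * lbar * cum_mean Q lam s + second_moment Q lam s)))
     - (cum_mean Q lam T)\<^sup>2"

definition B_coeff ::
  "'a measure \<Rightarrow> real measure \<Rightarrow> (real \<Rightarrow> real) \<Rightarrow> real \<Rightarrow> (real \<Rightarrow> 'a \<Rightarrow> real) \<Rightarrow> real \<Rightarrow> real" where
  "B_coeff Q \<Theta> f \<beta> lam T =
     2 * (LINT t:{0..T}|lborel. (LINT s:{0..t}|lborel.
            exp (- (\<beta> - H_int \<Theta> f) * (t - s)) * mean_intensity Q lam s))"

definition contracts :: "real measure \<Rightarrow> (real \<Rightarrow> real) set" where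
  "contracts \<Theta> = {h \<in> borel_measurable \<Theta>. AE z in \<Theta>. 0 \<le> h z \<and> h z \<le> z}"

definition wealth ::
  "real measure \<Rightarrow> (nat \<Rightarrow> 'a \<Rightarrow> ennreal) \<Rightarrow> (nat \<Rightarrow> 'a \<Rightarrow> real) \<Rightarrow> real \<Rightarrow> real \<Rightarrow> real \<Rightarrow>
   (real \<Rightarrow> real) \<Rightarrow> real \<Rightarrow> 'a \<Rightarrow> real" where
  "wealth \<Theta> \<tau> Z R0 \<rho> c \<phi> t \<omega> =
     R0 + (LINT p:{0..t} \<times> {0..}|counting_measure \<tau> Z \<omega>. \<phi> (snd p) - snd p)
        + \<rho> * H_int \<Theta> (\<lambda>z. z) * t - c * t * H_int \<Theta> \<phi>"

definition criterion ::
  "'a measure \<Rightarrow> real measure \<Rightarrow> (nat \<Rightarrow> 'a \<Rightarrow> ennreal) \<Rightarrow> (nat \<Rightarrow> 'a \<Rightarrow> real) \<Rightarrow> real \<Rightarrow> real \<Rightarrow> real \<Rightarrow>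
   real \<Rightarrow> real \<Rightarrow> (real \<Rightarrow> real) \<Rightarrow> real" where
  "criterion Q \<Theta> \<tau> Z R0 \<rho> c \<gamma> T \<phi> =
     prob_space.expectation Q (wealth \<Theta> \<tau> Z R0 \<rho> c \<phi> T)
     - \<gamma> * prob_space.variance Q (wealth \<Theta> \<tau> Z R0 \<rho> c \<phi> T)"

definition optimal_contract ::
  "'a measure \<Rightarrow> real measure \<Rightarrow> (nat \<Rightarrow> 'a \<Rightarrow> ennreal) \<Rightarrow> (nat \<Rightarrow> 'a \<Rightarrow> real) \<Rightarrow> real \<Rightarrow> real \<Rightarrow> real \<Rightarrow>
   real \<Rightarrow> real \<Rightarrow> (real \<Rightarrow> real) \<Rightarrow> bool" where
  "optimal_contract Q \<Theta> \<tau> Z R0 \<rho> c \<gamma> T \<phi> \<longleftrightarrow>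
     \<phi> \<in> contracts \<Theta> \<and>
     (\<forall>h\<in>contracts \<Theta>. criterion Q \<Theta> \<tau> Z R0 \<rho> c \<gamma> T h \<le> criterion Q \<Theta> \<tau> Z R0 \<rho> c \<gamma> T \<phi>)"

definition G_fun ::
  "'a measure \<Rightarrow> real measure \<Rightarrow> (real \<Rightarrow> real) \<Rightarrow> real \<Rightarrow> real \<Rightarrow> (real \<Rightarrow> 'a \<Rightarrow> real) \<Rightarrow>
   real \<Rightarrow> real \<Rightarrow> real \<Rightarrow> (real \<Rightarrow> real) \<Rightarrow> real \<Rightarrow> real" where
  "G_fun Q \<Theta> f \<beta> lbar lam c \<gamma> T \<phi> z =
     ((cum_mean Q lam T - c * T)
        - 2 * \<gamma> * H_int \<Theta> (\<lambda>x. \<phi> x - x) * A_coeff Q \<Theta> f \<beta> lbar lam T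
        - \<gamma> * H_int \<Theta> (\<lambda>x. f x * (\<phi> x - x)) * B_coeff Q \<Theta> f \<beta> lam T)
     - \<gamma> * H_int \<Theta> (\<lambda>x. \<phi> x - x) * B_coeff Q \<Theta> f \<beta> lam T * f z
     - 2 * \<gamma> * cum_mean Q lam T * (\<phi> z - z)"

end

theory Submission
  imports Defs
begin

text \<open>
  The insurer keeps \<open>\<eta>(z) = z - \<phi>(z)\<close> of a claim of size \<open>z\<close>. The terminal wealth is therefore a constant
  minus the total \<open>Y\<close> of the \<open>\<eta>(Z\<^sub>i)\<close> over the claims up to time \<open>T\<close>, and the criterion depends on the
  contract only through the mean and the variance of \<open>Y\<close>.

  Both are computed from the compensator. Between claims the intensity relaxes exponentially, so it is
  almost surely the explicit sum of \<open>lbar + (lam0 - lbar) e^(- \<beta> t)\<close> and of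
  \<open>\<Lambda> Z\<^sub>i e^(- \<beta> (t - \<tau>\<^sub>i))\<close> over the claims before \<open>t\<close> (\<open>AE_lam_eq_intensity\<close>), which is a predictable
  process. The compensator then gives the expectation of a sum over claims with predictable weights
  (\<open>campbell_formula\<close>). As the product of two sums over claims is again a sum over claims
  (\<open>jump_sum_mult\<close>), the second moments of the intensity and of \<open>Y\<close> satisfy linear integral equations.
  That these moments are finite comes from a renewal inequality, first up to the time at which the
  jumps of the intensity exceed a level; its kernel has mass less than one because \<open>H[f] < \<beta>\<close>
  (\<open>active_mean_le\<close>, \<open>active_square_ineq\<close>).

  Read as differential equations, the integral equations yield
  \<open>Var Y = M H[\<eta>\<^sup>2] + A H[\<eta>]\<^sup>2 + B H[\<eta>] H[f \<eta>]\<close> (\<open>claims_real_moments\<close>). They also yield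
  \<open>A = H[f\<^sup>2] \<integral> m w\<^sup>2\<close> and \<open>B = 2 \<integral> m w\<close> over \<open>[0, T]\<close>, where \<open>m\<close> is the mean intensity and
  \<open>w(s) = (1 - e^(- \<delta> (T - s))) / \<delta>\<close> with \<open>\<delta> = \<beta> - H[f]\<close>. Since \<open>w\<close> is not constant, the Cauchy-Schwarz
  inequality for the weight \<open>m\<close> is strict, that is \<open>H[f\<^sup>2] B\<^sup>2 < 4 M A\<close> (\<open>coeff_strict_ineq\<close>). Completing the
  square, the variance is a positive definite quadratic form in \<open>\<eta>\<close> (\<open>claim_quadratic_pos_def\<close>), so the
  criterion is strictly concave and the first-order condition characterises its only maximiser
  (\<open>retention_value_le\<close>).

  That condition says that \<open>\<eta>(z)\<close> is an affine function \<open>l(z)\<close> clamped to \<open>[0, z]\<close>, where \<open>l\<close> depends on \<open>\<eta>\<close>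
  only through the two numbers \<open>H[\<eta>]\<close> and \<open>H[z \<eta>]\<close>. Brouwer's theorem, applied to this pair of numbers,
  provides a solution (\<open>first_order_solvable\<close>). Finally \<open>G(\<phi>) = 2 \<gamma> M (\<eta> - l)\<close>, so the three sets of the
  theorem are those where \<open>l(z)\<close> lies above \<open>z\<close>, between \<open>0\<close> and \<open>z\<close>, and below \<open>0\<close>. The line has a positive
  intercept and a negative slope (\<open>first_order_positive\<close>), hence none of them is empty.
\<close>

section \<open>Predictable processes and sums over events\<close>

text \<open>
  That the mean mark is positive follows from the support of \<open>\<Theta>\<close> being unbounded.
\<close>

locale marked_hawkes_model = prob_space Q for Q :: "'a measure" +
  fixes F :: "real \<Rightarrow> 'a measure" and \<Theta> :: "real measure"
    and \<tau> :: "nat \<Rightarrow> 'a \<Rightarrow> ennreal" and Z :: "nat \<Rightarrow> 'a \<Rightarrow> real" and lam :: "real \<Rightarrow> 'a \<Rightarrow> real"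
    and \<Lambda> \<beta> lbar lam0 :: real
  assumes usual: "usual_conditions Q F"
    and sets_Theta [measurable_cong]: "sets \<Theta> = sets Rplus"
    and moments: "integrable \<Theta> (\<lambda>z. 1 + z + z\<^sup>2)"
    and Lambda_pos: "0 < \<Lambda>"
    and mean_mark_pos: "0 < H_int \<Theta> (\<lambda>z. z)"
    and stable: "H_int \<Theta> (\<lambda>z. \<Lambda> * z) < \<beta>"
    and lbar_nonneg: "0 \<le> lbar" and lbar_less: "lbar < lam0"
    and hawkes: "marked_hawkes Q F \<Theta> (\<lambda>z. \<Lambda> * z) \<beta> lbar lam0 \<tau> Z lam"
begin

abbreviation nn_expectation :: "('a \<Rightarrow> ennreal) \<Rightarrow> ennreal" (binder "\<E>" 10) where
  "nn_expectation X \<equiv> integral\<^sup>N Q X"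

lemma space_Theta [simp]: "space \<Theta> = {0..}"
  using sets_eq_imp_space_eq[OF sets_Theta] by (simp add: space_restrict_space)

lemma mpp: "marked_point_process Q F \<tau> Z"
  using hawkes by (simp add: marked_hawkes_def)

lemma measurable_tau [measurable]: "\<tau> i \<in> borel_measurable Q"
  and measurable_Z [measurable]: "Z i \<in> measurable Q Rplus"
  using mpp unfolding marked_point_process_def by blast+

lemma event_adapted:
  "0 \<le> t \<Longrightarrow> B \<in> sets Rplus \<Longrightarrow> {\<omega> \<in> space Q. \<tau> i \<omega> \<le> ennreal t \<and> Z i \<omega> \<in> B} \<in> sets (F t)"
  using mpp by (auto simp: marked_point_process_def)

lemma Z_nonneg: "\<omega> \<in> space Q \<Longrightarrow> 0 \<le> Z i \<omega>"
  using measurable_space[OF measurable_Z, of \<omega> i] by (simp add: space_restrict_space)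

lemma subalgebra_F: "0 \<le> t \<Longrightarrow> subalgebra Q (F t)"
  using usual[unfolded usual_conditions_def, THEN conjunct1] by simp

lemma F_mono: "0 \<le> s \<Longrightarrow> s \<le> t \<Longrightarrow> sets (F s) \<subseteq> sets (F t)"
  using usual[unfolded usual_conditions_def, THEN conjunct2, THEN conjunct1] by simp

lemma sets_F_subset: "0 \<le> t \<Longrightarrow> A \<in> sets (F t) \<Longrightarrow> A \<in> sets Q"
  using subalgebra_F by (auto simp: subalgebra_def)

lemma predictable_generator_subset:
  "{A \<times> {0} | A. A \<in> sets (F 0)} \<union> {A \<times> {s<..t} | A s t. 0 \<le> s \<and> s \<le> t \<and> A \<in> sets (F s)}
     \<subseteq> Pow (space Q \<times> {0..})"
proof (intro Un_least subsetI)
  have *: "A \<subseteq> space Q" if "0 \<le> s" "A \<in> sets (F s)" for A s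
    using sets_F_subset[OF that] by (rule sets.sets_into_space)
  fix X :: "('a \<times> real) set"
  show "X \<in> Pow (space Q \<times> {0..})" if "X \<in> {A \<times> {0} | A. A \<in> sets (F 0)}"
  proof -
    from that obtain A where "X = A \<times> {0}" "A \<in> sets (F 0)" by blast
    then show ?thesis using *[of 0 A] by auto
  qed
  show "X \<in> Pow (space Q \<times> {0..})"
    if "X \<in> {A \<times> {s<..t} | A s t. 0 \<le> s \<and> s \<le> t \<and> A \<in> sets (F s)}"
  proof -
    from that obtain A s t where "X = A \<times> {s<..t}" "0 \<le> s" "A \<in> sets (F s)" by blast
    then show ?thesis using *[of s A] by auto
  qed
qed

lemma space_predictable: "space (predictable Q F) = space Q \<times> {0..}"
  unfolding predictable_def by (rule space_measure_of[OF predictable_generator_subset])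

lemma sets_predictable: "sets (predictable Q F) = sigma_sets (space Q \<times> {0..})
     ({A \<times> {0} | A. A \<in> sets (F 0)} \<union>
      {A \<times> {s<..t} | A s t. 0 \<le> s \<and> s \<le> t \<and> A \<in> sets (F s)})"
  unfolding predictable_def by (rule sets_measure_of[OF predictable_generator_subset])

lemma predictable_rectangle:
  assumes "0 \<le> q" "A \<in> sets (F q)"
  shows "A \<times> {q<..} \<in> sets (predictable Q F)"
proof -
  have "A \<times> {q<..q + real n} \<in> sets (predictable Q F)" for n
    unfolding sets_predictable
    by (rule sigma_sets.Basic, rule UnI2, rule CollectI, rule exI[of _ A], rule exI[of _ q], rule exI[of _ "q + real n"])
       (simp add: assms)
  then have "(\<Union>n. A \<times> {q<..q + real n}) \<in> sets (predictable Q F)"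
    by (intro sets.countable_UN) auto
  moreover have "(\<Union>n. A \<times> {q<..q + real n}) = A \<times> {q<..}"
  proof -
    have "\<exists>n. x \<le> q + real n" for x
      using real_arch_simple[of "x - q"] by (auto simp: algebra_simps)
    then show ?thesis by auto
  qed
  ultimately show ?thesis by simp
qed

text \<open>
  Predictable processes are jointly measurable, so that Fubini's theorem applies to them.
\<close>

lemma measurable_predictable_subset:
  "(\<lambda>x. x) \<in> measurable (Q \<Otimes>\<^sub>M Rplus) (predictable Q F)"
  unfolding predictable_def
proof (rule measurable_measure_of[OF predictable_generator_subset])
  show "(\<lambda>x. x) \<in> space (Q \<Otimes>\<^sub>M Rplus) \<rightarrow> space Q \<times> {0..}"
    by (auto simp: space_pair_measure space_restrict_space)
  fix y :: "('a \<times> real) set"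
  assume y: "y \<in> {A \<times> {0} |A. A \<in> sets (F 0)} \<union> {A \<times> {s<..t} |A s t. 0 \<le> s \<and> s \<le> t \<and> A \<in> sets (F s)}"
  then obtain A B where "y = A \<times> B" "A \<in> sets Q" "B \<in> sets Rplus"
  proof
    assume "y \<in> {A \<times> {0} |A. A \<in> sets (F 0)}"
    then obtain A where "y = A \<times> {0}" "A \<in> sets (F 0)" by blast
    then show ?thesis using sets_F_subset[of 0 A] that[of A "{0}"] by (simp add: sets_restrict_space_iff)
  next
    assume "y \<in> {A \<times> {s<..t} |A s t. 0 \<le> s \<and> s \<le> t \<and> A \<in> sets (F s)}"
    then obtain A s t where *: "y = A \<times> {s<..t}" "0 \<le> s" "A \<in> sets (F s)" by blast
    then have "{s<..t} \<subseteq> {0..}" by auto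
    then show ?thesis using * sets_F_subset[of s A] that[of A "{s<..t}"] by (simp add: sets_restrict_space_iff)
  qed
  then have "y \<in> sets (Q \<Otimes>\<^sub>M Rplus)" by auto
  then show "(\<lambda>x. x) -` y \<inter> space (Q \<Otimes>\<^sub>M Rplus) \<in> sets (Q \<Otimes>\<^sub>M Rplus)"
    by auto
qed

lemma predictable_imp_jointly_measurable:
  "X \<in> borel_measurable (predictable Q F) \<Longrightarrow> X \<in> borel_measurable (Q \<Otimes>\<^sub>M Rplus)"
  using measurable_compose[OF measurable_predictable_subset] by auto

text \<open>
  Strictly after the event: at such times the event time and the mark are already known, which makes both of them
  predictable on this set.
\<close>

definition past :: "nat \<Rightarrow> ('a \<times> real) set" where
  "past i = {(\<omega>, t). \<omega> \<in> space Q \<and> 0 \<le> t \<and> \<tau> i \<omega> < ennreal t}"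

text \<open>
  The event lies strictly before \<open>t\<close> iff it lies before some rational \<open>q < t\<close>. This
  exhibits the set as a countable union of rectangles from the generator of the predictable sets.
\<close>

lemma past_mark_predictable:
  assumes "B \<in> sets Rplus" "0 \<le> a"
  shows "{(\<omega>, t) \<in> past i. \<tau> i \<omega> \<le> ennreal a \<and> Z i \<omega> \<in> B} \<in> sets (predictable Q F)"
proof -
  let ?S = "\<lambda>q. {\<omega> \<in> space Q. \<tau> i \<omega> \<le> ennreal (min a (real_of_rat q)) \<and> Z i \<omega> \<in> B} \<times> {real_of_rat q<..}"
  have "{(\<omega>, t) \<in> past i. \<tau> i \<omega> \<le> ennreal a \<and> Z i \<omega> \<in> B} = (\<Union>q\<in>{0..}. ?S q)"
  proof (intro subset_antisym subsetI)
    fix x assume "x \<in> {(\<omega>, t) \<in> past i. \<tau> i \<omega> \<le> ennreal a \<and> Z i \<omega> \<in> B}"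
    then obtain \<omega> t where x: "x = (\<omega>, t)"
      and *: "(\<omega>, t) \<in> past i" "\<tau> i \<omega> \<le> ennreal a" "Z i \<omega> \<in> B" by blast
    have lt: "\<tau> i \<omega> < ennreal t" "0 \<le> t" "\<omega> \<in> space Q" using * by (auto simp: past_def)
    then obtain r where r: "\<tau> i \<omega> = ennreal r" "0 \<le> r" by (cases "\<tau> i \<omega>") auto
    then have "r < t" using lt by (simp add: ennreal_less_iff)
    then obtain q where q: "r < real_of_rat q" "real_of_rat q < t" using of_rat_dense by blast
    then have "0 < real_of_rat q" using r by linarith
    then have "q \<ge> 0" using zero_le_of_rat_iff[of q, where 'a=real] by linarith
    have "r \<le> a" using * r assms by (simp add: ennreal_le_iff)
    then show "x \<in> (\<Union>q\<in>{0..}. ?S q)"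
      using * lt r q x \<open>q \<ge> 0\<close> by (auto simp: ennreal_le_iff intro!: bexI[of _ q] ennreal_leI)
  next
    fix x assume "x \<in> (\<Union>q\<in>{0..}. ?S q)"
    then obtain \<omega> t q where x: "x = (\<omega>, t)" and q: "(q::rat) \<in> {0..}" and *: "\<omega> \<in> space Q"
      "\<tau> i \<omega> \<le> ennreal (min a (real_of_rat q))" "Z i \<omega> \<in> B" "t \<in> {real_of_rat q<..}" by blast
    have q0: "0 \<le> real_of_rat q" using q by simp
    have le: "ennreal (min a (real_of_rat q)) \<le> ennreal a" "ennreal (min a (real_of_rat q)) \<le> ennreal (real_of_rat q)"
      by (rule ennreal_leI, simp)+
    have "ennreal (real_of_rat q) < ennreal t" using * q0 by (simp add: ennreal_less_iff)
    moreover have "0 \<le> t" using * q0 by (meson greaterThan_iff less_imp_le order_le_less_trans)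
    ultimately have "\<tau> i \<omega> \<le> ennreal a" "\<tau> i \<omega> < ennreal t" "0 \<le> t"
      using order_trans[OF *(2) le(1)] order_trans[OF *(2) le(2)] * q0 by (auto intro: order_le_less_trans)
    then show "x \<in> {(\<omega>, t) \<in> past i. \<tau> i \<omega> \<le> ennreal a \<and> Z i \<omega> \<in> B}"
      using * x by (auto simp: past_def)
  qed
  moreover have "?S q \<in> sets (predictable Q F)" if "q \<in> {0..}" for q
  proof (rule predictable_rectangle)
    show q0: "0 \<le> real_of_rat q" using that by simp
    have "{\<omega> \<in> space Q. \<tau> i \<omega> \<le> ennreal (min a (real_of_rat q)) \<and> Z i \<omega> \<in> B} \<in> sets (F (min a (real_of_rat q)))"
      by (rule event_adapted) (use assms q0 in auto)
    moreover have "sets (F (min a (real_of_rat q))) \<subseteq> sets (F (real_of_rat q))"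
      using assms q0 by (intro F_mono) auto
    ultimately show "{\<omega> \<in> space Q. \<tau> i \<omega> \<le> ennreal (min a (real_of_rat q)) \<and> Z i \<omega> \<in> B} \<in> sets (F (real_of_rat q))"
      by blast
  qed
  ultimately show ?thesis by (auto intro!: sets.countable_UN')
qed

lemma past_predictable': assumes "B \<in> sets Rplus"
  shows "{(\<omega>, t) \<in> past i. Z i \<omega> \<in> B} \<in> sets (predictable Q F)"
proof -
  have "{(\<omega>, t) \<in> past i. Z i \<omega> \<in> B} = (\<Union>n. {(\<omega>, t) \<in> past i. \<tau> i \<omega> \<le> ennreal (real n) \<and> Z i \<omega> \<in> B})"
  proof (intro set_eqI iffI; clarify)
    fix \<omega> t assume *: "(\<omega>, t) \<in> past i" "Z i \<omega> \<in> B"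
    then have "\<tau> i \<omega> < ennreal t" by (auto simp: past_def)
    moreover obtain n where "t \<le> real n" using real_arch_simple by blast
    ultimately have "\<tau> i \<omega> \<le> ennreal (real n)" using ennreal_leI[of t "real n"] by (meson less_le_trans less_imp_le)
    then show "(\<omega>, t) \<in> (\<Union>n. {(\<omega>, t) \<in> past i. \<tau> i \<omega> \<le> ennreal (real n) \<and> Z i \<omega> \<in> B})"
      using * by auto
  qed
  then show ?thesis using past_mark_predictable[OF assms] by auto
qed

lemma past_predictable [measurable]: "past i \<in> sets (predictable Q F)"
proof -
  have "{(\<omega>, t) \<in> past i. Z i \<omega> \<in> {0..}} = past i"
    using Z_nonneg by (auto simp: past_def)
  with past_predictable'[of "{0..}" i] show ?thesis by (simp add: sets_restrict_space_iff)
qed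

lemma measurable_past_event:
  "(\<lambda>(\<omega>, t). (enn2real (\<tau> i \<omega>), Z i \<omega>))
     \<in> measurable (restrict_space (predictable Q F) (past i)) (borel \<Otimes>\<^sub>M Rplus)"
proof -
  let ?R = "restrict_space (predictable Q F) (past i)"
  have sp: "space ?R = past i"
    by (auto simp: space_restrict_space space_predictable past_def)
  have sets_R: "X \<in> sets ?R" if "X \<in> sets (predictable Q F)" "X \<subseteq> past i" for X
    using that sets.sets_into_space[OF past_predictable, of i]
    by (subst sets_restrict_space_iff) (auto simp: Int_absorb2)
  have "(\<lambda>x. enn2real (\<tau> i (fst x))) \<in> borel_measurable ?R"
  proof (rule borel_measurableI_le)
    fix y :: real
    show "{x \<in> space ?R. enn2real (\<tau> i (fst x)) \<le> y} \<in> sets ?R"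
    proof (cases "0 \<le> y")
      case True
      have "{x \<in> space ?R. enn2real (\<tau> i (fst x)) \<le> y}
          = {(\<omega>, t) \<in> past i. \<tau> i \<omega> \<le> ennreal y \<and> Z i \<omega> \<in> {0..}}"
      proof -
        have "enn2real (\<tau> i \<omega>) \<le> y \<longleftrightarrow> \<tau> i \<omega> \<le> ennreal y" if "(\<omega>, t) \<in> past i" for \<omega> t
          using that True by (cases "\<tau> i \<omega>") (auto simp: past_def ennreal_le_iff)
        then show ?thesis using Z_nonneg unfolding sp by (auto simp: past_def)
      qed
      then show ?thesis
        using past_mark_predictable[of "{0..}" y i] True by (auto intro!: sets_R simp: sets_restrict_space_iff)
    next
      case False
      then have "{x \<in> space ?R. enn2real (\<tau> i (fst x)) \<le> y} = {}"
        using enn2real_nonneg order_trans by blast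
      then show ?thesis by (metis sets.empty_sets)
    qed
  qed
  moreover have "(\<lambda>x. Z i (fst x)) \<in> measurable ?R Rplus"
  proof (rule measurableI)
    fix x assume "x \<in> space ?R" then show "Z i (fst x) \<in> space Rplus"
      unfolding sp using Z_nonneg by (auto simp: past_def space_restrict_space)
  next
    fix B assume "B \<in> sets Rplus"
    from past_predictable'[OF this, of i]
    have "{(\<omega>, t) \<in> past i. Z i \<omega> \<in> B} \<in> sets ?R" by (rule sets_R) auto
    moreover have "(\<lambda>x. Z i (fst x)) -` B \<inter> space ?R = {(\<omega>, t) \<in> past i. Z i \<omega> \<in> B}"
      unfolding sp by auto
    ultimately show "(\<lambda>x. Z i (fst x)) -` B \<inter> space ?R \<in> sets ?R" by simp
  qed
  ultimately show ?thesis
    unfolding split_beta by (rule measurable_Pair)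
qed

text \<open>
  Only events strictly before \<open>t\<close> count. This makes the sum left-continuous in \<open>t\<close>, and
  predictable. The weight may depend on the outcome as well.
\<close>

definition jump_sum :: "(real \<times> real \<Rightarrow> ennreal) \<Rightarrow> real \<Rightarrow> 'a \<Rightarrow> ennreal" where
  "jump_sum w t \<omega> = (\<Sum>i. if \<tau> i \<omega> < ennreal t then w (enn2real (\<tau> i \<omega>), Z i \<omega>) else 0)"

lemma jump_sum_predictable:
  assumes "w \<in> borel_measurable (borel \<Otimes>\<^sub>M Rplus)"
  shows "(\<lambda>(\<omega>, t). jump_sum w t \<omega>) \<in> borel_measurable (predictable Q F)"
proof -
  have "(\<lambda>x. if x \<in> past i then w (enn2real (\<tau> i (fst x)), Z i (fst x)) else 0)
        \<in> borel_measurable (predictable Q F)" for i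
    using measurable_compose[OF measurable_past_event[of i] assms]
    by (subst measurable_If_restrict_space_iff) (auto simp: split_beta)
  then have "(\<lambda>x. \<Sum>i. if x \<in> past i then w (enn2real (\<tau> i (fst x)), Z i (fst x)) else 0)
        \<in> borel_measurable (predictable Q F)" by measurable
  also have "?this \<longleftrightarrow> ?thesis"
    by (intro measurable_cong) (auto simp: space_predictable jump_sum_def past_def intro!: suminf_cong)
  finally show ?thesis .
qed

lemma jump_sum_measurable [measurable]:
  assumes [measurable]: "w \<in> borel_measurable (borel \<Otimes>\<^sub>M Rplus)"
  shows "(\<lambda>(\<omega>, t). jump_sum w t \<omega>) \<in> borel_measurable (Q \<Otimes>\<^sub>M borel)"
  unfolding jump_sum_def by measurable

text \<open>
  The almost sure properties of the event times, gathered so that one can argue path by path.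
\<close>

definition regular_path :: "'a \<Rightarrow> bool" where
  "regular_path \<omega> \<longleftrightarrow> \<omega> \<in> space Q \<and> 0 < \<tau> 0 \<omega> \<and>
     (\<forall>i. \<tau> i \<omega> \<le> \<tau> (Suc i) \<omega> \<and> (\<tau> i \<omega> < \<infinity> \<longrightarrow> \<tau> i \<omega> < \<tau> (Suc i) \<omega>)) \<and>
     (\<lambda>i. \<tau> i \<omega>) \<longlonglongrightarrow> \<infinity>"

lemma AE_regular_path: "AE \<omega> in Q. regular_path \<omega>"
  using mpp unfolding marked_point_process_def regular_path_def by (auto simp: AE_space)

lemma regular_path_mono: "regular_path \<omega> \<Longrightarrow> i \<le> j \<Longrightarrow> \<tau> i \<omega> \<le> \<tau> j \<omega>"
  by (rule lift_Suc_mono_le) (auto simp: regular_path_def)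

lemma regular_path_less_iff:
  assumes "regular_path \<omega>" "\<tau> i \<omega> < \<infinity>"
  shows "\<tau> j \<omega> < \<tau> i \<omega> \<longleftrightarrow> j < i"
proof
  assume "j < i"
  then have le: "\<tau> (Suc j) \<omega> \<le> \<tau> i \<omega>" using regular_path_mono[OF assms(1)] by auto
  have "\<tau> j \<omega> \<le> \<tau> i \<omega>" using regular_path_mono[OF assms(1)] \<open>j < i\<close> by auto
  then have "\<tau> j \<omega> < \<infinity>" using assms(2) by (auto simp: less_top[symmetric] top_unique)
  then have "\<tau> j \<omega> < \<tau> (Suc j) \<omega>" using assms(1) by (auto simp: regular_path_def)
  with le show "\<tau> j \<omega> < \<tau> i \<omega>" by simp
next
  assume "\<tau> j \<omega> < \<tau> i \<omega>"
  then show "j < i" using regular_path_mono[OF assms(1), of i j] by (meson not_less)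
qed

lemma regular_path_bound:
  assumes "regular_path \<omega>" obtains N where "\<And>i. i \<ge> N \<Longrightarrow> ennreal t < \<tau> i \<omega>"
proof -
  have "\<forall>\<^sub>F i in sequentially. ennreal t < \<tau> i \<omega>"
    using assms by (intro order_tendstoD(1)[where y=\<infinity>]) (auto simp: regular_path_def)
  then show ?thesis using that by (auto simp: eventually_sequentially)
qed

lemma jump_sum_finite:
  assumes "\<And>i. i \<ge> N \<Longrightarrow> ennreal t \<le> \<tau> i \<omega>"
  shows "jump_sum w t \<omega> = (\<Sum>i<N. if \<tau> i \<omega> < ennreal t then w (enn2real (\<tau> i \<omega>), Z i \<omega>) else 0)"
  unfolding jump_sum_def
  by (intro suminf_finite) (auto simp: not_less dest: assms)

lemma jump_sum_event:
  assumes "regular_path \<omega>" "\<tau> i \<omega> < \<infinity>"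
  shows "jump_sum w (enn2real (\<tau> i \<omega>)) \<omega> = (\<Sum>j<i. w (enn2real (\<tau> j \<omega>), Z j \<omega>))"
proof -
  have eq: "ennreal (enn2real (\<tau> i \<omega>)) = \<tau> i \<omega>" using assms by (simp add: less_top)
  then show ?thesis
    using regular_path_less_iff[OF assms] by (subst jump_sum_finite[of i]) (auto intro!: sum.cong regular_path_mono[OF assms(1)])
qed

lemma prod_sum_lessThan_triangle:
  fixes a b :: "nat \<Rightarrow> 'b :: comm_semiring_1"
  shows "(\<Sum>i<N. a i) * (\<Sum>i<N. b i) = (\<Sum>i<N. a i * b i + a i * (\<Sum>j<i. b j) + b i * (\<Sum>j<i. a j))"
  by (induction N) (auto simp: algebra_simps)

text \<open>
  In the product of two sums over events, each event is paired with itself once, and every pair of distinct events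
  is attributed to the later of the two.
\<close>

lemma jump_sum_mult:
  assumes "regular_path \<omega>"
  shows "jump_sum v t \<omega> * jump_sum w t \<omega> =
    jump_sum (\<lambda>(s, z). v (s, z) * w (s, z) + v (s, z) * jump_sum w s \<omega> + w (s, z) * jump_sum v s \<omega>) t \<omega>"
proof -
  obtain N0 where N0: "\<And>i. i \<ge> N0 \<Longrightarrow> ennreal t < \<tau> i \<omega>"
    using regular_path_bound[OF assms] by blast
  \<comment> \<open>the number of events before \<open>t\<close>\<close>
  define N where "N = (LEAST n. ennreal t \<le> \<tau> n \<omega>)"
  have "ennreal t \<le> \<tau> N \<omega>" unfolding N_def by (rule LeastI[of _ N0]) (simp add: N0 less_imp_le)
  then have ge: "ennreal t \<le> \<tau> i \<omega>" if "i \<ge> N" for i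
    using regular_path_mono[OF assms that] by auto
  have lt: "\<tau> i \<omega> < ennreal t" if "i < N" for i
    using not_less_Least[of i "\<lambda>n. ennreal t \<le> \<tau> n \<omega>"] that by (auto simp: N_def)
  have fin: "\<tau> i \<omega> < \<infinity>" if "i < N" for i
    using lt[OF that] by (rule order_less_trans) simp
  have S: "jump_sum u t \<omega> = (\<Sum>i<N. u (enn2real (\<tau> i \<omega>), Z i \<omega>))" for u
    using lt by (subst jump_sum_finite[OF ge]) (auto intro!: sum.cong)
  show ?thesis
    unfolding S prod_sum_lessThan_triangle
    by (intro sum.cong refl) (use fin jump_sum_event[OF assms] in simp)
qed

lemma jump_sum_add: "jump_sum (\<lambda>p. v p + w p) t \<omega> = jump_sum v t \<omega> + jump_sum w t \<omega>"
  unfolding jump_sum_def suminf_add[OF summableI summableI] by (intro suminf_cong) simp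

lemma jump_sum_mono:
  "s \<le> t \<Longrightarrow> (\<And>r z. v (r, z) \<le> w (r, z)) \<Longrightarrow> jump_sum v s \<omega> \<le> jump_sum w t \<omega>"
  unfolding jump_sum_def
  by (intro suminf_le summableI) (auto dest: less_le_trans[OF _ ennreal_leI])

lemma jump_sum_finite_value:
  assumes "regular_path \<omega>" and "\<And>s z. v (s, z) < \<infinity>"
  shows "jump_sum v t \<omega> < \<infinity>"
proof -
  obtain N where "\<And>i. i \<ge> N \<Longrightarrow> ennreal t < \<tau> i \<omega>" using regular_path_bound[OF assms(1)] by blast
  then show ?thesis
    using assms(2) by (subst jump_sum_finite[of N]) (auto simp: less_imp_le)
qed

lemma nn_integral_counting_measure:
  assumes "\<omega> \<in> space Q" and [measurable]: "V \<in> borel_measurable (Rplus \<Otimes>\<^sub>M Rplus)"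
  shows "(\<integral>\<^sup>+ p. V p \<partial>counting_measure \<tau> Z \<omega>) =
    (\<Sum>i. if \<tau> i \<omega> < \<infinity> then V (enn2real (\<tau> i \<omega>), Z i \<omega>) else 0)"
proof -
  have "(\<lambda>i. (enn2real (\<tau> i \<omega>), Z i \<omega>)) \<in> measurable (count_space {i. \<tau> i \<omega> < \<infinity>}) (Rplus \<Otimes>\<^sub>M Rplus)"
    using Z_nonneg[OF assms(1)] by (auto simp: space_pair_measure space_restrict_space)
  then have "(\<integral>\<^sup>+ p. V p \<partial>counting_measure \<tau> Z \<omega>) =
      (\<integral>\<^sup>+ i. V (enn2real (\<tau> i \<omega>), Z i \<omega>) \<partial>count_space {i. \<tau> i \<omega> < \<infinity>})"
    unfolding counting_measure_def by (subst nn_integral_distr) auto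
  also have "\<dots> = (\<integral>\<^sup>+ i. (if \<tau> i \<omega> < \<infinity> then V (enn2real (\<tau> i \<omega>), Z i \<omega>) else 0) \<partial>count_space UNIV)"
    by (subst nn_integral_count_space_indicator) (auto intro!: nn_integral_cong)
  finally show ?thesis by (simp add: nn_integral_count_space_nat)
qed

end

section \<open>The intensity along a path\<close>

text \<open>
  The integrating factor \<open>exp (- c * t)\<close> turns the equation into a vanishing derivative.
\<close>

lemma ode_zero:
  fixes x :: "real \<Rightarrow> real"
  assumes "\<And>t. t \<in> {0..T} \<Longrightarrow> (x has_real_derivative c * x t) (at t within {0..T})"
    and "x 0 = 0" and t: "t \<in> {0..T}"
  shows "x t = 0"
proof -
  have "\<exists>k. \<forall>s\<in>{0..T}. exp (- c * s) * x s = k"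
  proof (rule has_field_derivative_zero_constant)
    fix s assume "s \<in> {0..T}"
    from assms(1)[OF this]
    show "((\<lambda>s. exp (- c * s) * x s) has_field_derivative 0) (at s within {0..T})"
      by (auto intro!: derivative_eq_intros)
  qed simp
  then obtain k where k: "\<And>s. s \<in> {0..T} \<Longrightarrow> exp (- c * s) * x s = k" by blast
  have "k = 0" using k[of 0] assms(2) t by simp
  with k[OF t] show ?thesis by simp
qed

text \<open>
  The right-hand side is continuous in \<open>t\<close>, hence so is \<open>d\<close>, and the integral of
  \<open>d\<close> solves a homogeneous linear differential equation.
\<close>

lemma volterra_zero:
  fixes d :: "real \<Rightarrow> real"
  assumes int: "d integrable_on {0..T}"
    and eq: "\<And>t. t \<in> {0..T} \<Longrightarrow> d t = c * integral {0..t} d" and t: "t \<in> {0..T}"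
  shows "d t = 0"
proof -
  have "continuous_on {0..T} (\<lambda>t. c * integral {0..t} d)"
    by (intro continuous_intros indefinite_integral_continuous_1 int)
  then have cont: "continuous_on {0..T} d"
    by (rule continuous_on_cong[THEN iffD1, rotated -1]) (auto simp: eq)
  have "integral {0..t} d = 0"
  proof (rule ode_zero[where c=c and T=T, OF _ _ t])
    fix s assume s: "s \<in> {0..T}"
    show "((\<lambda>t. integral {0..t} d) has_real_derivative c * integral {0..s} d) (at s within {0..T})"
      using integral_has_real_derivative[OF cont s] eq[OF s] by simp
  qed simp
  then show ?thesis using eq[OF t] by simp
qed

lemma has_integral_delayed_exp:
  fixes \<beta> r t :: real
  assumes "\<beta> \<noteq> 0" "0 \<le> r" "0 \<le> t"
  shows "((\<lambda>s. if r < s then exp (- \<beta> * (s - r)) else 0) has_integral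
           (if r < t then (1 - exp (- \<beta> * (t - r))) / \<beta> else 0)) {0..t}"
proof (cases "r < t")
  case True
  have "((\<lambda>s. exp (- \<beta> * (s - r))) has_integral
      (- exp (- \<beta> * (t - r)) / \<beta> - - exp (- \<beta> * (r - r)) / \<beta>)) {r..t}"
    by (rule fundamental_theorem_of_calculus)
       (use True assms in \<open>auto intro!: derivative_eq_intros
          simp: has_real_derivative_iff_has_vector_derivative[symmetric]\<close>)
  then have "((\<lambda>s. if s \<in> {r..t} then exp (- \<beta> * (s - r)) else 0) has_integral
      (1 - exp (- \<beta> * (t - r))) / \<beta>) {0..t}"
    using assms by (subst has_integral_restrict) (auto simp: diff_divide_distrib)
  then have "((\<lambda>s. if r < s then exp (- \<beta> * (s - r)) else 0) has_integral
      (1 - exp (- \<beta> * (t - r))) / \<beta>) {0..t}"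
    by (rule has_integral_spike_finite[of "{r}", rotated 2]) auto
  then show ?thesis using True by simp
next
  case False
  have "((\<lambda>s. if r < s then exp (- \<beta> * (s - r)) else 0) has_integral 0) {0..t}"
    by (rule has_integral_is_0) (use False in auto)
  then show ?thesis using False by simp
qed

text \<open>
  The right-hand side of the equation is left-continuous, so \<open>l\<close> agrees with its left limit
  \<open>ll\<close> away from \<open>0\<close>. The explicit formula solves the equation too, and the difference
  of the two solutions vanishes by \<open>volterra_zero\<close>.
\<close>

lemma jump_ode_solution:
  fixes l ll r c :: "_ \<Rightarrow> real"
  assumes I: "finite I" and r: "\<And>i. i \<in> I \<Longrightarrow> 0 \<le> r i" and b: "\<beta> \<noteq> 0" and T: "0 \<le> T"
    and ll: "ll integrable_on {0..T}"
    and eq: "\<And>t. t \<in> {0..T} \<Longrightarrow> l t = lam0 + \<beta> * integral {0..t} (\<lambda>s. lbar - ll s)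
               + (\<Sum>i\<in>I. if r i < t then c i else 0)"
    and lim: "\<And>t. t \<in> {0<..T} \<Longrightarrow> ll t = Lim (at_left t) l"
  shows "t \<in> {0..T} \<Longrightarrow> l t = lbar + (lam0 - lbar) * exp (- \<beta> * t)
            + (\<Sum>i\<in>I. if r i < t then c i * exp (- \<beta> * (t - r i)) else 0)"
    and "t \<in> {0<..T} \<Longrightarrow> ll t = l t"
proof -
  have ll_eq: "ll t = l t" if t: "t \<in> {0<..T}" for t
  proof -
    have "(\<lambda>s. lbar - ll s) integrable_on {0..t}"
      using t by (intro integrable_diff integrable_on_subinterval[OF ll]) auto
    then have "continuous_on {0..t} (\<lambda>t. integral {0..t} (\<lambda>s. lbar - ll s))"
      by (rule indefinite_integral_continuous_1)
    then have 1: "((\<lambda>t. integral {0..t} (\<lambda>s. lbar - ll s)) \<longlongrightarrow> integral {0..t} (\<lambda>s. lbar - ll s)) (at_left t)"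
      using t by (auto simp: continuous_on_def at_within_Icc_at_left dest: bspec[of _ _ t])
    have 2: "((\<lambda>s. if r i < s then c i else 0) \<longlongrightarrow> (if r i < t then c i else 0)) (at_left t)" for i
    proof (cases "r i < t")
      case True
      then have "\<forall>\<^sub>F s in at_left t. r i < s" by (auto simp: eventually_at_left)
      then show ?thesis by (intro tendsto_eventually, elim eventually_mono) (use True in auto)
    next
      case False
      have "\<forall>\<^sub>F s in at_left t. s < t" by (simp add: eventually_at_filter)
      then show ?thesis by (intro tendsto_eventually, elim eventually_mono) (use False in auto)
    qed
    have "((\<lambda>s. lam0 + \<beta> * integral {0..s} (\<lambda>s. lbar - ll s) + (\<Sum>i\<in>I. if r i < s then c i else 0))
        \<longlongrightarrow> lam0 + \<beta> * integral {0..t} (\<lambda>s. lbar - ll s) + (\<Sum>i\<in>I. if r i < t then c i else 0)) (at_left t)"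
      by (intro tendsto_intros 1 2)
    moreover have "\<forall>\<^sub>F s in at_left t. s \<in> {0..T}"
      using t by (auto simp: eventually_at_left intro!: exI[of _ 0])
    then have "\<forall>\<^sub>F s in at_left t. lam0 + \<beta> * integral {0..s} (\<lambda>s. lbar - ll s)
        + (\<Sum>i\<in>I. if r i < s then c i else 0) = l s"
      by (elim eventually_mono) (use eq in simp)
    ultimately have "(l \<longlongrightarrow> lam0 + \<beta> * integral {0..t} (\<lambda>s. lbar - ll s)
        + (\<Sum>i\<in>I. if r i < t then c i else 0)) (at_left t)"
      by (rule Lim_transform_eventually)
    then have "(l \<longlongrightarrow> l t) (at_left t)"
      using t eq[of t] by simp
    then have "Lim (at_left t) l = l t" by (intro tendsto_Lim) auto
    with lim[OF t] show ?thesis by simp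
  qed
  show "t \<in> {0<..T} \<Longrightarrow> ll t = l t" by (rule ll_eq)
  have l_int: "l integrable_on {0..T}"
    by (rule integrable_spike_finite[of "{0}", OF _ _ ll]) (use ll_eq in auto)
  have l_eq: "l t = lam0 + \<beta> * integral {0..t} (\<lambda>s. lbar - l s) + (\<Sum>i\<in>I. if r i < t then c i else 0)"
    if t: "t \<in> {0..T}" for t
  proof -
    have "integral {0..t} (\<lambda>s. lbar - ll s) = integral {0..t} (\<lambda>s. lbar - l s)"
      by (rule integral_spike[of "{0}"]) (use ll_eq t in auto)
    with eq[OF t] show ?thesis by simp
  qed
  \<comment> \<open>the explicit solution\<close>
  define x where "x t = lbar + (lam0 - lbar) * exp (- \<beta> * t)
            + (\<Sum>i\<in>I. if r i < t then c i * exp (- \<beta> * (t - r i)) else 0)" for t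
  have x_int: "(x has_integral lbar * t + (lam0 - lbar) * ((1 - exp (- \<beta> * t)) / \<beta>)
      + (\<Sum>i\<in>I. c i * (if r i < t then (1 - exp (- \<beta> * (t - r i))) / \<beta> else 0))) {0..t}"
    if t: "t \<in> {0..T}" for t
  proof -
    have 1: "((\<lambda>t. lbar + (lam0 - lbar) * exp (- \<beta> * t)) has_integral
       (lbar * t + (lam0 - lbar) * (- exp (- \<beta> * t) / \<beta>)) - (lbar * 0 + (lam0 - lbar) * (- exp (- \<beta> * 0) / \<beta>))) {0..t}"
      by (rule fundamental_theorem_of_calculus)
        (use t b in \<open>auto intro!: derivative_eq_intros
          simp: has_real_derivative_iff_has_vector_derivative[symmetric]\<close>)
    have 2: "((\<lambda>t. \<Sum>i\<in>I. c i * (if r i < t then exp (- \<beta> * (t - r i)) else 0)) has_integral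
       (\<Sum>i\<in>I. c i * (if r i < t then (1 - exp (- \<beta> * (t - r i))) / \<beta> else 0))) {0..t}"
      using t b r by (intro has_integral_sum I has_integral_mult_right has_integral_delayed_exp) auto
    have "x = (\<lambda>t. lbar + (lam0 - lbar) * exp (- \<beta> * t) + (\<Sum>i\<in>I. c i * (if r i < t then exp (- \<beta> * (t - r i)) else 0)))"
      by (auto simp: x_def fun_eq_iff intro!: sum.cong)
    moreover have "(lbar * t + (lam0 - lbar) * (- exp (- \<beta> * t) / \<beta>)) - (lbar * 0 + (lam0 - lbar) * (- exp (- \<beta> * 0) / \<beta>))
       = lbar * t + (lam0 - lbar) * ((1 - exp (- \<beta> * t)) / \<beta>)"
      using b by (simp add: field_simps)
    ultimately show ?thesis using has_integral_add[OF 1 2] by (simp only:)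
  qed
  have "l t - x t = 0" if t: "t \<in> {0..T}" for t
  proof (rule volterra_zero[where c="-\<beta>" and T=T, OF _ _ t])
    show "(\<lambda>t. l t - x t) integrable_on {0..T}"
      using x_int[of T] T by (intro integrable_diff l_int) auto
    fix t assume t: "t \<in> {0..T}"
    have li: "l integrable_on {0..t}" using l_int by (rule integrable_on_subinterval) (use t in auto)
    have xi: "x integrable_on {0..t}" using x_int[OF t] by auto
    have I1: "integral {0..t} (\<lambda>s. lbar - l s) = lbar * t - integral {0..t} l"
      using t li by (subst integral_diff) auto
    have I2: "integral {0..t} (\<lambda>t. l t - x t) = integral {0..t} l - integral {0..t} x"
      using li xi by (rule integral_diff)
    have S: "\<beta> * (\<Sum>i\<in>I. c i * (if r i < t then (1 - exp (- \<beta> * (t - r i))) / \<beta> else 0))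
       = (\<Sum>i\<in>I. if r i < t then c i else 0) - (\<Sum>i\<in>I. if r i < t then c i * exp (- \<beta> * (t - r i)) else 0)"
      unfolding sum_distrib_left sum_subtractf[symmetric] using b by (intro sum.cong) (auto simp: field_simps)
    have "\<beta> * integral {0..t} x = \<beta> * lbar * t + (lam0 - lbar) * (1 - exp (- \<beta> * t))
       + ((\<Sum>i\<in>I. if r i < t then c i else 0) - (\<Sum>i\<in>I. if r i < t then c i * exp (- \<beta> * (t - r i)) else 0))"
      unfolding integral_unique[OF x_int[OF t]] S[symmetric] using b by (simp add: field_simps)
    then have "x t = lam0 + \<beta> * (lbar * t - integral {0..t} x) + (\<Sum>i\<in>I. if r i < t then c i else 0)"
      by (simp add: x_def algebra_simps)
    then show "l t - x t = - \<beta> * integral {0..t} (\<lambda>t. l t - x t)"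
      using l_eq[OF t] unfolding I1 I2 by (simp add: algebra_simps)
  qed
  then show "t \<in> {0..T} \<Longrightarrow> l t = lbar + (lam0 - lbar) * exp (- \<beta> * t)
            + (\<Sum>i\<in>I. if r i < t then c i * exp (- \<beta> * (t - r i)) else 0)"
    unfolding x_def by fastforce
qed

context marked_hawkes_model begin

lemma ident_Rplus_borel [measurable]: "(\<lambda>x. x) \<in> borel_measurable Rplus"
  by (rule measurable_restrict_space1) measurable

lemma snd_Rplus_borel [measurable]: "snd \<in> borel_measurable (M \<Otimes>\<^sub>M Rplus)"
  using measurable_compose[OF measurable_snd ident_Rplus_borel] by simp

lemma beta_pos: "0 < \<beta>"
  using stable mean_mark_pos Lambda_pos by (auto intro: order.strict_trans[rotated])

lemma set_integral_counting_measure: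
  fixes g :: "real \<Rightarrow> real"
  assumes \<omega>: "\<omega> \<in> space Q" and S: "S \<in> sets Rplus" and [measurable]: "g \<in> borel_measurable Rplus"
    and N: "\<And>i. i \<ge> N \<Longrightarrow> \<tau> i \<omega> < \<infinity> \<Longrightarrow> enn2real (\<tau> i \<omega>) \<notin> S"
  shows "(LINT p:S \<times> {0..}|counting_measure \<tau> Z \<omega>. g (snd p)) =
    (\<Sum>i<N. if \<tau> i \<omega> < \<infinity> \<and> enn2real (\<tau> i \<omega>) \<in> S then g (Z i \<omega>) else 0)"
proof -
  have M: "(\<lambda>i. (enn2real (\<tau> i \<omega>), Z i \<omega>)) \<in> measurable (count_space {i. \<tau> i \<omega> < \<infinity>}) (Rplus \<Otimes>\<^sub>M Rplus)"
    using Z_nonneg[OF \<omega>] by (auto simp: space_pair_measure space_restrict_space)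
  have [measurable]: "S \<times> {0..} \<in> sets (Rplus \<Otimes>\<^sub>M Rplus)"
    using S by (auto simp: sets_restrict_space_iff)
  have N': "i < N" if "\<tau> i \<omega> < \<infinity>" "enn2real (\<tau> i \<omega>) \<in> S" for i
    using N[of i] that by (meson not_less)
  let ?g = "\<lambda>i. indicator (S \<times> {0..}) (enn2real (\<tau> i \<omega>), Z i \<omega>) *\<^sub>R g (Z i \<omega>)"
  have "(LINT p:S \<times> {0..}|counting_measure \<tau> Z \<omega>. g (snd p))
     = (\<integral>i. ?g i \<partial>count_space {i. \<tau> i \<omega> < \<infinity>})"
    unfolding set_lebesgue_integral_def counting_measure_def
    by (subst integral_distr[OF M]) auto
  also have "\<dots> = (\<Sum>i | i \<in> {i. \<tau> i \<omega> < \<infinity>} \<and> ?g i \<noteq> 0. ?g i)"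
    by (rule lebesgue_integral_count_space_finite_support, rule finite_subset[of _ "{..<N}"])
      (use N' in \<open>auto simp: indicator_def split: if_splits\<close>)
  also have "\<dots> = (\<Sum>i<N. if \<tau> i \<omega> < \<infinity> \<and> enn2real (\<tau> i \<omega>) \<in> S then g (Z i \<omega>) else 0)"
    using Z_nonneg[OF \<omega>]
    by (intro sum.mono_neutral_cong_left) (use N' in \<open>auto simp: indicator_def split: if_splits\<close>)
  finally show ?thesis .
qed

definition base_intensity :: "real \<Rightarrow> real" where
  "base_intensity t = lbar + (lam0 - lbar) * exp (- \<beta> * t)"

text \<open>
  The factor \<open>exp (- \<beta> * t)\<close> of the discounted jump
  \<open>\<Lambda> * z * exp (- \<beta> * (t - s))\<close> is left out, so that the kernel does not depend on the
  current time.
\<close>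

definition intensity_kernel :: "real \<times> real \<Rightarrow> ennreal" where
  "intensity_kernel = (\<lambda>(s, z). ennreal (exp (\<beta> * s) * (\<Lambda> * z)))"

definition intensity :: "real \<Rightarrow> 'a \<Rightarrow> ennreal" where
  "intensity t \<omega> = ennreal (base_intensity t) + ennreal (exp (- \<beta> * t)) * jump_sum intensity_kernel t \<omega>"

lemma base_intensity_nonneg: "0 \<le> base_intensity t"
  using lbar_nonneg lbar_less by (simp add: base_intensity_def)

lemma base_intensity_pos: "0 < base_intensity t"
  unfolding base_intensity_def using lbar_nonneg lbar_less by (intro add_nonneg_pos mult_pos_pos) auto

lemma intensity_kernel_measurable [measurable]: "intensity_kernel \<in> borel_measurable (borel \<Otimes>\<^sub>M Rplus)"
  unfolding intensity_kernel_def split_beta by measurable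

text \<open>
  Identifies the given intensity with an explicit predictable process, and with its own left limits, which are
  what the compensator is built from.
\<close>

lemma AE_lam_eq_intensity:
  "AE \<omega> in Q. regular_path \<omega> \<and> (\<forall>t\<ge>0. 0 \<le> lam t \<omega> \<and> ennreal (lam t \<omega>) = intensity t \<omega>) \<and>
      (\<forall>t>0. left_lim lam \<omega> t = lam t \<omega>)"
proof -
  have AE: "AE \<omega> in Q. \<forall>t\<ge>0.
        set_integrable lborel {0..t} (left_lim lam \<omega>) \<and>
        lam t \<omega> = lam0 + \<beta> * (LINT s:{0..t}|lborel. lbar - left_lim lam \<omega> s)
                + (LINT p:{0..<t} \<times> {0..}|counting_measure \<tau> Z \<omega>. \<Lambda> * snd p)"
    using hawkes by (simp add: marked_hawkes_def)
  show ?thesis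
    using AE AE_regular_path
  proof eventually_elim
    fix \<omega> assume *: "\<forall>t\<ge>0.
        set_integrable lborel {0..t} (left_lim lam \<omega>) \<and>
        lam t \<omega> = lam0 + \<beta> * (LINT s:{0..t}|lborel. lbar - left_lim lam \<omega> s)
                + (LINT p:{0..<t} \<times> {0..}|counting_measure \<tau> Z \<omega>. \<Lambda> * snd p)"
      and reg: "regular_path \<omega>"
    then have \<omega>: "\<omega> \<in> space Q" by (simp add: regular_path_def)
    have main: "(0 \<le> lam T \<omega> \<and> ennreal (lam T \<omega>) = intensity T \<omega>) \<and> (T > 0 \<longrightarrow> left_lim lam \<omega> T = lam T \<omega>)"
      if T: "0 \<le> T" for T
    proof -
      obtain N where N: "\<And>i. i \<ge> N \<Longrightarrow> ennreal T < \<tau> i \<omega>" using regular_path_bound[OF reg] by blast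
      define I where "I = {i. i < N \<and> \<tau> i \<omega> < \<infinity>}"
      define r where "r i = enn2real (\<tau> i \<omega>)" for i
      have I: "finite I" by (simp add: I_def)
      have less: "\<tau> i \<omega> < ennreal t \<longleftrightarrow> r i < t" if "i \<in> I" "0 \<le> t" for i t
        using that by (cases "\<tau> i \<omega>") (auto simp: I_def r_def ennreal_less_iff)
      have eq: "lam t \<omega> = lam0 + \<beta> * integral {0..t} (\<lambda>s. lbar - left_lim lam \<omega> s)
               + (\<Sum>i\<in>I. if r i < t then \<Lambda> * Z i \<omega> else 0)" if t: "t \<in> {0..T}" for t
      proof -
        have "(LINT p:{0..<t} \<times> {0..}|counting_measure \<tau> Z \<omega>. \<Lambda> * snd p)
          = (\<Sum>i<N. if \<tau> i \<omega> < \<infinity> \<and> enn2real (\<tau> i \<omega>) \<in> {0..<t} then \<Lambda> * Z i \<omega> else 0)"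
        proof (rule set_integral_counting_measure[OF \<omega>])
          show "{0..<t} \<in> sets Rplus" by (auto simp: sets_restrict_space_iff)
          fix i assume i: "N \<le> i" "\<tau> i \<omega> < \<infinity>"
          then have "ennreal T < ennreal (enn2real (\<tau> i \<omega>))" using N by (simp add: less_top)
          then show "enn2real (\<tau> i \<omega>) \<notin> {0..<t}" using t T by (simp add: ennreal_less_iff)
        qed measurable
        also have "\<dots> = (\<Sum>i\<in>I. if r i < t then \<Lambda> * Z i \<omega> else 0)"
          by (rule sum.mono_neutral_cong_right) (auto simp: I_def r_def split: if_splits)
        finally have J: "(LINT p:{0..<t} \<times> {0..}|counting_measure \<tau> Z \<omega>. \<Lambda> * snd p)
          = (\<Sum>i\<in>I. if r i < t then \<Lambda> * Z i \<omega> else 0)" .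
        have si: "set_integrable lborel {0..t} (left_lim lam \<omega>)" using * t by simp
        have "set_integrable lborel {0..t} (\<lambda>s. lbar - left_lim lam \<omega> s)"
          by (intro set_integral_diff si borel_integrable_atLeastAtMost' continuous_intros)
        then have "(LINT s:{0..t}|lborel. lbar - left_lim lam \<omega> s) = integral {0..t} (\<lambda>s. lbar - left_lim lam \<omega> s)"
          by (rule set_borel_integral_eq_integral)
        then show ?thesis using * t J by simp
      qed
      have ll: "left_lim lam \<omega> integrable_on {0..T}"
        using * T by (intro set_borel_integral_eq_integral) auto
      have lim: "left_lim lam \<omega> t = Lim (at_left t) (\<lambda>s. lam s \<omega>)" for t
        by (simp add: left_lim_def)
      have r0: "i \<in> I \<Longrightarrow> 0 \<le> r i" for i by (simp add: r_def)
      note sol = jump_ode_solution[OF I r0 _ T ll eq lim]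
      have lam_T: "lam T \<omega> = base_intensity T
            + (\<Sum>i\<in>I. if r i < T then \<Lambda> * Z i \<omega> * exp (- \<beta> * (T - r i)) else 0)"
        using sol(1)[of T] T beta_pos by (simp add: base_intensity_def)
      have nn: "0 \<le> (if r i < T then \<Lambda> * Z i \<omega> * exp (- \<beta> * (T - r i)) else 0)" for i
        using Z_nonneg[OF \<omega>] Lambda_pos by auto
      have js: "jump_sum intensity_kernel T \<omega>
          = (\<Sum>i\<in>I. if r i < T then ennreal (exp (\<beta> * r i) * (\<Lambda> * Z i \<omega>)) else 0)"
      proof -
        have "jump_sum intensity_kernel T \<omega>
          = (\<Sum>i<N. if \<tau> i \<omega> < ennreal T then intensity_kernel (enn2real (\<tau> i \<omega>), Z i \<omega>) else 0)"
          by (rule jump_sum_finite) (use N less_imp_le in auto)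
        also have "\<dots> = (\<Sum>i\<in>I. if r i < T then ennreal (exp (\<beta> * r i) * (\<Lambda> * Z i \<omega>)) else 0)"
        proof (rule sum.mono_neutral_cong_right)
          show "\<forall>i\<in>{..<N} - I. (if \<tau> i \<omega> < ennreal T then intensity_kernel (enn2real (\<tau> i \<omega>), Z i \<omega>) else 0) = 0"
            using order_less_trans[OF _ ennreal_less_top[of T]] by (auto simp: I_def)
          fix i assume "i \<in> I"
          then show "(if \<tau> i \<omega> < ennreal T then intensity_kernel (enn2real (\<tau> i \<omega>), Z i \<omega>) else 0)
            = (if r i < T then ennreal (exp (\<beta> * r i) * (\<Lambda> * Z i \<omega>)) else 0)"
            using less[of i T] T by (simp add: intensity_kernel_def r_def)
        qed (auto simp: I_def)
        finally show ?thesis .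
      qed
      have "intensity T \<omega> = ennreal (base_intensity T) +
          (\<Sum>i\<in>I. ennreal (if r i < T then \<Lambda> * Z i \<omega> * exp (- \<beta> * (T - r i)) else 0))"
        unfolding intensity_def js sum_distrib_left
        by (intro arg_cong2[where f="(+)"] sum.cong refl)
           (auto simp: ennreal_mult'[symmetric] exp_diff[symmetric] exp_add[symmetric] algebra_simps exp_minus field_simps)
      also have "\<dots> = ennreal (lam T \<omega>)"
        unfolding lam_T using nn base_intensity_nonneg
        by (subst sum_ennreal) (auto simp: ennreal_plus[symmetric] sum_nonneg simp del: ennreal_plus)
      finally have "ennreal (lam T \<omega>) = intensity T \<omega>" by simp
      moreover have "0 \<le> lam T \<omega>"
        unfolding lam_T using nn base_intensity_nonneg by (intro add_nonneg_nonneg sum_nonneg) auto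
      moreover have "T > 0 \<longrightarrow> left_lim lam \<omega> T = lam T \<omega>"
        using sol(2)[of T] beta_pos by auto
      ultimately show ?thesis by blast
    qed
    then show "regular_path \<omega> \<and> (\<forall>t\<ge>0. 0 \<le> lam t \<omega> \<and> ennreal (lam t \<omega>) = intensity t \<omega>) \<and>
      (\<forall>t>0. left_lim lam \<omega> t = lam t \<omega>)"
      using reg by (auto simp: less_imp_le)
  qed
qed

end

section \<open>Campbell's formula\<close>

context marked_hawkes_model begin

lemma finite_measure_Theta: "finite_measure \<Theta>"
proof
  have "emeasure \<Theta> (space \<Theta>) = (\<integral>\<^sup>+ z. 1 \<partial>\<Theta>)" by simp
  also have "\<dots> \<le> (\<integral>\<^sup>+ z. ennreal (norm (1 + z + z\<^sup>2)) \<partial>\<Theta>)"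
    by (intro nn_integral_mono) (auto simp: ennreal_1[symmetric] simp del: ennreal_1 intro!: ennreal_leI)
  also have "\<dots> < \<infinity>" using moments by (simp add: integrable_iff_bounded)
  finally show "emeasure \<Theta> (space \<Theta>) \<noteq> \<infinity>" by simp
qed

sublocale Theta: finite_measure \<Theta> by (rule finite_measure_Theta)

lemma integrable_Theta_bound:
  assumes [measurable]: "g \<in> borel_measurable Rplus" and "\<And>z. 0 \<le> z \<Longrightarrow> \<bar>g z\<bar> \<le> C * (1 + z + z\<^sup>2)"
  shows "integrable \<Theta> (g :: real \<Rightarrow> real)"
proof (rule Bochner_Integration.integrable_bound)
  show "integrable \<Theta> (\<lambda>z. C * (1 + z + z\<^sup>2))" using moments by simp
  show "g \<in> borel_measurable \<Theta>" by measurable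
  show "AE z in \<Theta>. norm (g z) \<le> norm (C * (1 + z + z\<^sup>2))"
    by (rule AE_I2) (use assms(2) in \<open>force intro: order_trans\<close>)
qed

lemma intensity_measurable [measurable]: "(\<lambda>(\<omega>, t). intensity t \<omega>) \<in> borel_measurable (Q \<Otimes>\<^sub>M borel)"
  unfolding intensity_def base_intensity_def using jump_sum_measurable[OF intensity_kernel_measurable]
  by (simp add: split_beta)

lemma intensity_path_measurable:
  "\<omega> \<in> space Q \<Longrightarrow> (\<lambda>t. intensity t \<omega>) \<in> borel_measurable borel"
  using measurable_compose[OF measurable_Pair1' intensity_measurable] by simp

lemma time_predictable: "snd \<in> borel_measurable (predictable Q F)"
proof (rule borel_measurableI_le)
  fix y
  have "{x \<in> space (predictable Q F). snd x \<le> y} = space (predictable Q F)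
      - space Q \<times> {max 0 y<..} - (if y < 0 then space (predictable Q F) else {})"
    by (auto simp: space_predictable split: if_splits)
  moreover have "space Q \<times> {max 0 y<..} \<in> sets (predictable Q F)"
    by (rule predictable_rectangle)
      (use subalgebra_F[of "max 0 y"] sets.top[of "F (max 0 y)"] in \<open>auto simp: subalgebra_def\<close>)
  ultimately show "{x \<in> space (predictable Q F). snd x \<le> y} \<in> sets (predictable Q F)" by auto
qed

lemma intensity_predictable: "(\<lambda>(\<omega>, t). intensity t \<omega>) \<in> borel_measurable (predictable Q F)"
proof -
  note [measurable] = time_predictable
  have [measurable]: "(\<lambda>x. jump_sum intensity_kernel (snd x) (fst x)) \<in> borel_measurable (predictable Q F)"
    using jump_sum_predictable[OF intensity_kernel_measurable] by (simp add: split_beta')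
  show ?thesis unfolding intensity_def base_intensity_def split_beta' by measurable
qed

lemma intensity_jointly_measurable [measurable]:
  "(\<lambda>x. intensity (snd x) (fst x)) \<in> borel_measurable (Q \<Otimes>\<^sub>M Rplus)"
  using predictable_imp_jointly_measurable[OF intensity_predictable] by (simp add: split_beta)

text \<open>
  The defining property of the compensator for the explicit intensity, with the integration over the outcomes
  moved inside.
\<close>

theorem compensation_formula:
  assumes W: "W \<in> borel_measurable (predictable Q F \<Otimes>\<^sub>M Rplus)"
  shows "(\<E> \<omega>. (\<Sum>i. if \<tau> i \<omega> < \<infinity> then W ((\<omega>, enn2real (\<tau> i \<omega>)), Z i \<omega>) else 0)) =
    (\<integral>\<^sup>+ s. (\<E> \<omega>. intensity s \<omega> * (\<integral>\<^sup>+ z. W ((\<omega>, s), z) \<partial>\<Theta>)) \<partial>restrict_space lborel {0..})"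
proof -
  let ?R = "restrict_space lborel {0..} :: real measure"
  have [measurable_cong]: "sets ?R = sets Rplus" by (simp add: sets_restrict_space)
  have "(\<lambda>x. (fst x, snd x)) \<in> measurable ((Q \<Otimes>\<^sub>M Rplus) \<Otimes>\<^sub>M Rplus) (predictable Q F \<Otimes>\<^sub>M Rplus)"
    by (intro measurable_Pair measurable_compose[OF measurable_fst measurable_predictable_subset]) simp
  then have W' [measurable]: "W \<in> borel_measurable ((Q \<Otimes>\<^sub>M Rplus) \<Otimes>\<^sub>M Rplus)"
    using measurable_compose[OF _ W] by simp
  interpret R: sigma_finite_measure ?R
    by (rule sigma_finite_measure_restrict_space) (auto intro: sigma_finite_lborel)
  interpret QR: pair_sigma_finite Q ?R ..
  have sec: "(\<lambda>(s, z). W ((\<omega>, s), z)) \<in> borel_measurable (Rplus \<Otimes>\<^sub>M Rplus)" if "\<omega> \<in> space Q" for \<omega>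
    using that by measurable
  have "(\<E> \<omega>. (\<Sum>i. if \<tau> i \<omega> < \<infinity> then W ((\<omega>, enn2real (\<tau> i \<omega>)), Z i \<omega>) else 0))
      = (\<E> \<omega>. (\<integral>\<^sup>+ (s, z). W ((\<omega>, s), z) \<partial>counting_measure \<tau> Z \<omega>))"
    by (intro nn_integral_cong, subst nn_integral_counting_measure[OF _ sec]) (auto intro!: suminf_cong)
  also have "\<dots> = (\<E> \<omega>. (\<integral>\<^sup>+ (s, z). W ((\<omega>, s), z)
       \<partial>density (?R \<Otimes>\<^sub>M \<Theta>) (\<lambda>(s, z). ennreal (left_lim lam \<omega> s))))"
    using hawkes W by (simp add: marked_hawkes_def compensator_def)
  also have "\<dots> = (\<E> \<omega>. (\<integral>\<^sup>+ s. intensity s \<omega> * (\<integral>\<^sup>+ z. W ((\<omega>, s), z) \<partial>\<Theta>) \<partial>?R))"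
  proof (rule nn_integral_cong_AE)
    show "AE \<omega> in Q. (\<integral>\<^sup>+ (s, z). W ((\<omega>, s), z) \<partial>density (?R \<Otimes>\<^sub>M \<Theta>) (\<lambda>(s, z). ennreal (left_lim lam \<omega> s)))
        = (\<integral>\<^sup>+ s. intensity s \<omega> * (\<integral>\<^sup>+ z. W ((\<omega>, s), z) \<partial>\<Theta>) \<partial>?R)"
      using AE_lam_eq_intensity
    proof eventually_elim
      fix \<omega> assume *: "regular_path \<omega> \<and> (\<forall>t\<ge>0. 0 \<le> lam t \<omega> \<and> ennreal (lam t \<omega>) = intensity t \<omega>) \<and>
        (\<forall>t>0. left_lim lam \<omega> t = lam t \<omega>)"
      then have \<omega>: "\<omega> \<in> space Q" by (simp add: regular_path_def)
      have sec' [measurable]: "(\<lambda>(s, z). W ((\<omega>, s), z)) \<in> borel_measurable (?R \<Otimes>\<^sub>M \<Theta>)"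
        using sec[OF \<omega>] by measurable
      have i_meas: "(\<lambda>t. intensity t \<omega>) \<in> borel_measurable ?R"
        using intensity_path_measurable[OF \<omega>] by (intro measurable_restrict_space1) simp
      \<comment> \<open>The value of \<open>left_lim\<close> at \<open>0\<close> is arbitrary, but it only concerns one point.\<close>
      have "(\<lambda>s. if s = 0 then ennreal (left_lim lam \<omega> 0) else intensity s \<omega>) \<in> borel_measurable borel"
        using intensity_path_measurable[OF \<omega>] by measurable
      then have "(\<lambda>s. if s = 0 then ennreal (left_lim lam \<omega> 0) else intensity s \<omega>) \<in> borel_measurable ?R"
        by (intro measurable_restrict_space1) simp
      also have "?this \<longleftrightarrow> (\<lambda>s. ennreal (left_lim lam \<omega> s)) \<in> borel_measurable ?R"
        using * by (intro measurable_cong) (auto simp: space_restrict_space less_le)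
      finally have l_meas [measurable]: "(\<lambda>s. ennreal (left_lim lam \<omega> s)) \<in> borel_measurable ?R" .
      have l_meas' [measurable]: "(\<lambda>(s, z). ennreal (left_lim lam \<omega> s)) \<in> borel_measurable (?R \<Otimes>\<^sub>M \<Theta>)"
        using measurable_compose[OF measurable_fst l_meas] by (simp add: split_beta)
      have "(\<integral>\<^sup>+ (s, z). W ((\<omega>, s), z) \<partial>density (?R \<Otimes>\<^sub>M \<Theta>) (\<lambda>(s, z). ennreal (left_lim lam \<omega> s)))
         = (\<integral>\<^sup>+ p. ennreal (left_lim lam \<omega> (fst p)) * W ((\<omega>, fst p), snd p) \<partial>(?R \<Otimes>\<^sub>M \<Theta>))"
        by (subst nn_integral_density[OF l_meas' sec']) (simp add: split_beta)
      also have "\<dots> = (\<integral>\<^sup>+ s. \<integral>\<^sup>+ z. ennreal (left_lim lam \<omega> s) * W ((\<omega>, s), z) \<partial>\<Theta> \<partial>?R)"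
        using l_meas' sec' by (subst Theta.nn_integral_fst[symmetric]) (auto simp: split_beta)
      also have "\<dots> = (\<integral>\<^sup>+ s. ennreal (left_lim lam \<omega> s) * (\<integral>\<^sup>+ z. W ((\<omega>, s), z) \<partial>\<Theta>) \<partial>?R)"
      proof (intro nn_integral_cong nn_integral_cmult)
        fix s assume "s \<in> space ?R"
        then show "(\<lambda>z. W ((\<omega>, s), z)) \<in> borel_measurable \<Theta>"
          using measurable_compose[OF measurable_Pair1' sec'] by simp
      qed
      also have "\<dots> = (\<integral>\<^sup>+ s. intensity s \<omega> * (\<integral>\<^sup>+ z. W ((\<omega>, s), z) \<partial>\<Theta>) \<partial>?R)"
      proof (rule nn_integral_cong_AE)
        have "AE s in lborel. (s::real) \<noteq> 0" by (rule AE_lborel_singleton)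
        then show "AE s in ?R. ennreal (left_lim lam \<omega> s) * (\<integral>\<^sup>+ z. W ((\<omega>, s), z) \<partial>\<Theta>)
           = intensity s \<omega> * (\<integral>\<^sup>+ z. W ((\<omega>, s), z) \<partial>\<Theta>)"
          using * by (subst AE_restrict_space_iff) (auto elim!: eventually_mono)
      qed
      finally show "(\<integral>\<^sup>+ (s, z). W ((\<omega>, s), z) \<partial>density (?R \<Otimes>\<^sub>M \<Theta>) (\<lambda>(s, z). ennreal (left_lim lam \<omega> s)))
        = (\<integral>\<^sup>+ s. intensity s \<omega> * (\<integral>\<^sup>+ z. W ((\<omega>, s), z) \<partial>\<Theta>) \<partial>?R)" .
    qed
  qed
  also have "\<dots> = (\<integral>\<^sup>+ s. (\<E> \<omega>. intensity s \<omega> * (\<integral>\<^sup>+ z. W ((\<omega>, s), z) \<partial>\<Theta>)) \<partial>?R)"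
  proof -
    have "W \<in> borel_measurable ((Q \<Otimes>\<^sub>M ?R) \<Otimes>\<^sub>M \<Theta>)" by measurable
    then have "(\<lambda>x. \<integral>\<^sup>+ z. W (x, z) \<partial>\<Theta>) \<in> borel_measurable (Q \<Otimes>\<^sub>M ?R)"
      by (rule Theta.borel_measurable_nn_integral_fst)
    moreover have "(\<lambda>x. intensity (snd x) (fst x)) \<in> borel_measurable (Q \<Otimes>\<^sub>M ?R)" by measurable
    ultimately have "(\<lambda>(\<omega>, s). intensity s \<omega> * (\<integral>\<^sup>+ z. W ((\<omega>, s), z) \<partial>\<Theta>)) \<in> borel_measurable (Q \<Otimes>\<^sub>M ?R)"
      by (simp add: split_beta)
    from QR.Fubini'[OF this] show ?thesis by simp
  qed
  finally show ?thesis .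
qed

text \<open>
  Under the expectation, a sum over events becomes an integral against the intensity and the mark distribution,
  provided that the weight at an event depends on the strict past only.
\<close>

corollary campbell_formula:
  assumes X: "X \<in> borel_measurable (predictable Q F)" and w: "w \<in> borel_measurable (borel \<Otimes>\<^sub>M Rplus)"
  shows "(\<E> \<omega>. jump_sum (\<lambda>(s, z). X (\<omega>, s) * w (s, z)) t \<omega>) =
    (\<integral>\<^sup>+ s\<in>{0..t}. (\<integral>\<^sup>+ z. w (s, z) \<partial>\<Theta>) * (\<E> \<omega>. intensity s \<omega> * X (\<omega>, s)) \<partial>lborel)"
proof -
  let ?R = "restrict_space lborel {0..} :: real measure"
  note X' [measurable] = predictable_imp_jointly_measurable[OF X]
  define W where "W = (\<lambda>((\<omega>, s), z). X (\<omega>, s) * w (s, z) * indicator {..<t} s)"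
  have W_meas: "W \<in> borel_measurable (predictable Q F \<Otimes>\<^sub>M Rplus)"
  proof -
    have s: "(\<lambda>x. snd (fst x)) \<in> borel_measurable (predictable Q F \<Otimes>\<^sub>M Rplus)"
      by (rule measurable_compose[OF measurable_fst time_predictable])
    have "(\<lambda>x. (snd (fst x), snd x)) \<in> measurable (predictable Q F \<Otimes>\<^sub>M Rplus) (borel \<Otimes>\<^sub>M Rplus)"
      by (intro measurable_Pair s measurable_snd)
    from measurable_compose[OF this w] have "(\<lambda>x. w (snd (fst x), snd x)) \<in> borel_measurable (predictable Q F \<Otimes>\<^sub>M Rplus)" .
    moreover have [measurable]: "(\<lambda>x. X (fst x)) \<in> borel_measurable (predictable Q F \<Otimes>\<^sub>M Rplus)"
      by (rule measurable_compose[OF measurable_fst X])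
    moreover have [measurable]: "(\<lambda>x. indicator {..<t} (snd (fst x)) :: ennreal) \<in> borel_measurable (predictable Q F \<Otimes>\<^sub>M Rplus)"
      by (rule measurable_compose[OF s]) measurable
    ultimately have "(\<lambda>x. X (fst x) * w (snd (fst x), snd x) * indicator {..<t} (snd (fst x)))
        \<in> borel_measurable (predictable Q F \<Otimes>\<^sub>M Rplus)" by (intro borel_measurable_times_ennreal)
    then show ?thesis by (simp add: W_def split_beta')
  qed
  have iff: "\<tau> i \<omega> < ennreal t \<longleftrightarrow> \<tau> i \<omega> < \<infinity> \<and> enn2real (\<tau> i \<omega>) < t" for i \<omega>
  proof (cases "\<tau> i \<omega>")
    case (real r)
    then show ?thesis by (cases "0 \<le> t") (auto simp: ennreal_less_iff ennreal_neg)
  qed simp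
  have "(\<E> \<omega>. jump_sum (\<lambda>(s, z). X (\<omega>, s) * w (s, z)) t \<omega>)
     = (\<E> \<omega>. (\<Sum>i. if \<tau> i \<omega> < \<infinity> then W ((\<omega>, enn2real (\<tau> i \<omega>)), Z i \<omega>) else 0))"
    by (intro nn_integral_cong, unfold jump_sum_def, intro suminf_cong, unfold iff) (simp add: W_def)
  also have "\<dots> = (\<integral>\<^sup>+ s. (\<E> \<omega>. intensity s \<omega> * (\<integral>\<^sup>+ z. W ((\<omega>, s), z) \<partial>\<Theta>)) \<partial>?R)"
    by (rule compensation_formula[OF W_meas])
  also have "\<dots> = (\<integral>\<^sup>+ s. (\<integral>\<^sup>+ z. w (s, z) \<partial>\<Theta>) * (\<E> \<omega>. intensity s \<omega> * X (\<omega>, s)) * indicator {..<t} s \<partial>?R)"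
  proof (rule nn_integral_cong)
    fix s assume "s \<in> space ?R"
    then have s: "0 \<le> s" by (simp add: space_restrict_space)
    have w_s: "(\<lambda>z. w (s, z)) \<in> borel_measurable \<Theta>"
      using measurable_compose[OF measurable_Pair1' w] by (simp add: measurable_cong_sets[OF sets_Theta refl])
    have X_s: "(\<lambda>\<omega>. X (\<omega>, s)) \<in> borel_measurable Q"
      using measurable_compose[OF measurable_Pair2' X'] s by (simp add: space_restrict_space)
    have i_s: "(\<lambda>\<omega>. intensity s \<omega>) \<in> borel_measurable Q"
      using measurable_compose[OF measurable_Pair2' intensity_measurable, of s] by simp
    have "(\<E> \<omega>. intensity s \<omega> * (\<integral>\<^sup>+ z. W ((\<omega>, s), z) \<partial>\<Theta>))
       = (\<E> \<omega>. ((\<integral>\<^sup>+ z. w (s, z) \<partial>\<Theta>) * indicator {..<t} s) * (intensity s \<omega> * X (\<omega>, s)))"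
    proof (intro nn_integral_cong)
      fix \<omega>
      have "(\<integral>\<^sup>+ z. W ((\<omega>, s), z) \<partial>\<Theta>) = (\<integral>\<^sup>+ z. (X (\<omega>, s) * indicator {..<t} s) * w (s, z) \<partial>\<Theta>)"
        by (auto simp: W_def mult_ac intro!: nn_integral_cong)
      also have "\<dots> = (X (\<omega>, s) * indicator {..<t} s) * (\<integral>\<^sup>+ z. w (s, z) \<partial>\<Theta>)"
        by (rule nn_integral_cmult[OF w_s])
      finally show "intensity s \<omega> * (\<integral>\<^sup>+ z. W ((\<omega>, s), z) \<partial>\<Theta>) = ((\<integral>\<^sup>+ z. w (s, z) \<partial>\<Theta>) * indicator {..<t} s) * (intensity s \<omega> * X (\<omega>, s))"
        by (simp add: mult_ac)
    qed
    also have "\<dots> = ((\<integral>\<^sup>+ z. w (s, z) \<partial>\<Theta>) * indicator {..<t} s) * (\<E> \<omega>. intensity s \<omega> * X (\<omega>, s))"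
      by (intro nn_integral_cmult borel_measurable_times_ennreal X_s i_s)
    finally show "(\<E> \<omega>. intensity s \<omega> * (\<integral>\<^sup>+ z. W ((\<omega>, s), z) \<partial>\<Theta>))
       = (\<integral>\<^sup>+ z. w (s, z) \<partial>\<Theta>) * (\<E> \<omega>. intensity s \<omega> * X (\<omega>, s)) * indicator {..<t} s"
      by (simp add: mult_ac)
  qed
  also have "\<dots> = (\<integral>\<^sup>+ s. (\<integral>\<^sup>+ z. w (s, z) \<partial>\<Theta>) * (\<E> \<omega>. intensity s \<omega> * X (\<omega>, s)) * indicator {..<t} s * indicator {0..} s \<partial>lborel)"
    by (rule nn_integral_restrict_space) simp
  also have "\<dots> = (\<integral>\<^sup>+ s\<in>{0..t}. (\<integral>\<^sup>+ z. w (s, z) \<partial>\<Theta>) * (\<E> \<omega>. intensity s \<omega> * X (\<omega>, s)) \<partial>lborel)"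
  proof (rule nn_integral_cong_AE)
    have "AE s in lborel. s \<noteq> t" by (rule AE_lborel_singleton)
    then show "AE s in lborel. (\<integral>\<^sup>+ z. w (s, z) \<partial>\<Theta>) * (\<E> \<omega>. intensity s \<omega> * X (\<omega>, s)) * indicator {..<t} s * indicator {0..} s
       = (\<integral>\<^sup>+ z. w (s, z) \<partial>\<Theta>) * (\<E> \<omega>. intensity s \<omega> * X (\<omega>, s)) * indicator {0..t} s"
      by eventually_elim (auto simp: indicator_def)
  qed
  finally show ?thesis .
qed

text \<open>
  Contracts are determined only almost everywhere; this lemma makes the wealth insensitive to the choice.
\<close>

lemma AE_marks_avoid_null_set:
  assumes N: "N \<in> null_sets \<Theta>"
  shows "AE \<omega> in Q. \<forall>i. \<tau> i \<omega> < \<infinity> \<longrightarrow> Z i \<omega> \<notin> N"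
proof -
  have N_sets [measurable]: "N \<in> sets Rplus" using N sets_Theta by auto
  have "(\<E> \<omega>. (\<Sum>i. if \<tau> i \<omega> < \<infinity> then indicator N (Z i \<omega>) else 0)) = 0"
    using compensation_formula[of "\<lambda>x. indicator N (snd x)"] N
    by (simp add: nn_integral_indicator null_sets_def cong: if_cong)
  then have "AE \<omega> in Q. (\<Sum>i. if \<tau> i \<omega> < \<infinity> then indicator N (Z i \<omega>) else 0 :: ennreal) = 0"
    by (subst (asm) nn_integral_0_iff_AE) measurable
  then show ?thesis
    by eventually_elim (auto simp: suminf_eq_zero_iff split: if_splits)
qed

text \<open>
  The compensator is absolutely continuous in time. The wealth counts the events up to and including the horizon,
  jump sums those strictly before it.
\<close>

lemma AE_no_event_at_time:
  assumes T: "0 \<le> T"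
  shows "AE \<omega> in Q. \<forall>i. \<tau> i \<omega> \<noteq> ennreal T"
proof -
  have "(\<lambda>x. indicator {T} (snd (fst x)) :: ennreal) \<in> borel_measurable (predictable Q F \<Otimes>\<^sub>M Rplus)"
    by (rule measurable_compose[OF measurable_compose[OF measurable_fst time_predictable]]) measurable
  from compensation_formula[OF this]
  have "(\<E> \<omega>. (\<Sum>i. if \<tau> i \<omega> < \<infinity> then indicator {T} (enn2real (\<tau> i \<omega>)) else 0))
     = (\<integral>\<^sup>+ s. (\<E> \<omega>. intensity s \<omega> * (indicator {T} s * emeasure \<Theta> {0..})) \<partial>restrict_space lborel {0..})"
    by (simp cong: if_cong)
  also have "\<dots> = (\<integral>\<^sup>+ s. (\<E> \<omega>. intensity s \<omega> * (indicator {T} s * emeasure \<Theta> {0..})) * indicator {0..} s \<partial>lborel)"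
    by (rule nn_integral_restrict_space) simp
  also have "\<dots> = (\<integral>\<^sup>+ s. 0 \<partial>(lborel :: real measure))"
  proof (rule nn_integral_cong_AE)
    have "AE s in lborel. s \<noteq> T" by (rule AE_lborel_singleton)
    then show "AE s in lborel. (\<E> \<omega>. intensity s \<omega> * (indicator {T} s * emeasure \<Theta> {0..})) * indicator {0..} s = 0"
      by eventually_elim simp
  qed
  finally have "(\<E> \<omega>. (\<Sum>i. if \<tau> i \<omega> < \<infinity> then indicator {T} (enn2real (\<tau> i \<omega>)) else 0)) = 0"
    by simp
  then have "AE \<omega> in Q. (\<Sum>i. if \<tau> i \<omega> < \<infinity> then indicator {T} (enn2real (\<tau> i \<omega>)) else 0 :: ennreal) = 0"
    by (subst (asm) nn_integral_0_iff_AE) measurable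
  then show ?thesis
  proof eventually_elim
    fix \<omega> assume *: "(\<Sum>i. if \<tau> i \<omega> < \<infinity> then indicator {T} (enn2real (\<tau> i \<omega>)) else 0 :: ennreal) = 0"
    show "\<forall>i. \<tau> i \<omega> \<noteq> ennreal T"
    proof (intro allI notI)
      fix i assume "\<tau> i \<omega> = ennreal T"
      moreover have "(if \<tau> i \<omega> < \<infinity> then indicator {T} (enn2real (\<tau> i \<omega>)) else 0 :: ennreal) = 0"
        using * by (simp add: suminf_eq_zero_iff)
      ultimately show False using T by simp
    qed
  qed
qed

end

section \<open>Uniform bounds for the moments of the intensity\<close>

lemma ennreal_power2_add_le: "(x + y)\<^sup>2 \<le> 2 * x\<^sup>2 + 2 * (y::ennreal)\<^sup>2"
proof (cases x; cases y)
  fix a b :: real assume *: "0 \<le> a" "0 \<le> b" "x = ennreal a" "y = ennreal b"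
  have "(a + b)\<^sup>2 \<le> 2 * a\<^sup>2 + 2 * b\<^sup>2" using sum_squares_bound[of a b] by (simp add: power2_sum)
  then have "ennreal ((a + b)\<^sup>2) \<le> ennreal (2 * a\<^sup>2 + 2 * b\<^sup>2)" by (rule ennreal_leI)
  then show ?thesis using * by (simp add: ennreal_plus ennreal_mult ennreal_power[symmetric] ennreal_numeral[symmetric] del: ennreal_numeral)
qed (simp_all add: power2_eq_square ennreal_mult_top ennreal_top_mult)

lemma nn_integral_exp_decay_le:
  fixes b :: real
  assumes "0 < b" "0 \<le> t"
  shows "(\<integral>\<^sup>+ s\<in>{0..t}. ennreal (exp (- b * (t - s))) \<partial>lborel) \<le> ennreal (1 / b)"
proof -
  have "(\<integral>\<^sup>+ s\<in>{0..t}. ennreal (exp (- b * (t - s))) \<partial>lborel)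
     = ennreal (exp (- b * (t - t)) / b - exp (- b * (t - 0)) / b)"
    by (rule nn_integral_FTC_Icc) (use assms in \<open>auto intro!: derivative_eq_intros\<close>)
  also have "\<dots> \<le> ennreal (1 / b)" using assms by (intro ennreal_leI) simp
  finally show ?thesis .
qed

text \<open>
  The kernel has mass at most \<open>q / b < 1\<close>. Hence the supremum \<open>S\<close> of \<open>x\<close>
  satisfies \<open>S \<le> C + (q / b) * S\<close>, which can be solved for \<open>S\<close> because the crude
  bound \<open>B\<close> makes it finite.
\<close>

lemma renewal_bound:
  fixes x :: "real \<Rightarrow> ennreal"
  assumes q: "0 \<le> q" "q < b" and C: "0 \<le> C"
    and bdd: "\<And>t. 0 \<le> t \<Longrightarrow> x t \<le> ennreal B"
    and ineq: "\<And>t. 0 \<le> t \<Longrightarrow> x t \<le> ennreal C + ennreal q * (\<integral>\<^sup>+ s\<in>{0..t}. ennreal (exp (- b * (t - s))) * x s \<partial>lborel)"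
    and t: "0 \<le> t"
  shows "x t \<le> ennreal (C * b / (b - q))"
proof -
  have b: "0 < b" using q by simp
  define S where "S = (SUP t\<in>{0..}. x t)"
  have "S \<le> ennreal B" unfolding S_def using bdd by (intro SUP_least) auto
  then have "S < \<infinity>" by (rule order_le_less_trans) simp
  then obtain s where s: "S = ennreal s" "0 \<le> s" by (cases S) auto
  have le_S: "x t \<le> S" if "0 \<le> t" for t unfolding S_def using that by (intro SUP_upper) auto
  have "x t \<le> ennreal C + ennreal q * (ennreal (1 / b) * S)" if t: "0 \<le> t" for t
  proof -
    have "(\<integral>\<^sup>+ s\<in>{0..t}. ennreal (exp (- b * (t - s))) * x s \<partial>lborel)
       \<le> (\<integral>\<^sup>+ s. ennreal (exp (- b * (t - s))) * indicator {0..t} s * S \<partial>lborel)"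
      by (intro nn_integral_mono) (auto simp: indicator_def intro!: mult_left_mono le_S)
    also have "\<dots> = (\<integral>\<^sup>+ s\<in>{0..t}. ennreal (exp (- b * (t - s))) \<partial>lborel) * S"
      by (rule nn_integral_multc) measurable
    also have "\<dots> \<le> ennreal (1 / b) * S"
      by (intro mult_right_mono nn_integral_exp_decay_le b t) simp
    finally show ?thesis using ineq[OF t] by (meson add_left_mono mult_left_mono order_trans zero_le)
  qed
  then have "S \<le> ennreal C + ennreal q * (ennreal (1 / b) * S)"
    unfolding S_def[symmetric] by (subst (1) S_def) (auto intro!: SUP_least)
  also have "\<dots> = ennreal (C + q * (1 / b * s))"
    using s q b C by (simp add: ennreal_mult'[symmetric] ennreal_plus[symmetric] del: ennreal_plus)
  finally have "ennreal s \<le> ennreal (C + q * (1 / b * s))" by (simp only: s(1))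
  then have "s \<le> C + q * (1 / b * s)"
    by (subst (asm) ennreal_le_iff) (use s q b C in \<open>auto intro!: add_nonneg_nonneg mult_nonneg_nonneg\<close>)
  then have "b * s \<le> b * (C + q * (1 / b * s))" using b by (intro mult_left_mono) auto
  then have "s \<le> C * b / (b - q)" using q b by (simp add: pos_le_divide_eq algebra_simps)
  then show ?thesis using le_S[OF t] s by (metis ennreal_leI order_trans)
qed

context marked_hawkes_model begin

lemma integrable_mark: "integrable \<Theta> (\<lambda>z. z)"
  by (rule integrable_Theta_bound[where C=1]) auto

lemma integrable_mark_power2: "integrable \<Theta> (\<lambda>z. z\<^sup>2)"
  by (rule integrable_Theta_bound[where C=1]) auto

text \<open>
  The first two moments of a jump of the intensity.
\<close>

definition branching :: real where "branching = H_int \<Theta> (\<lambda>z. \<Lambda> * z)"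
definition branching2 :: real where "branching2 = H_int \<Theta> (\<lambda>z. (\<Lambda> * z)\<^sup>2)"

lemma branching_nonneg: "0 \<le> branching"
  unfolding branching_def using Lambda_pos by (intro Bochner_Integration.integral_nonneg) auto

lemma branching2_nonneg: "0 \<le> branching2"
  unfolding branching2_def by (intro Bochner_Integration.integral_nonneg) auto

lemma branching_less: "branching < \<beta>" using stable by (simp add: branching_def)

lemma nn_integral_intensity_kernel:
  "(\<integral>\<^sup>+ z. intensity_kernel (s, z) \<partial>\<Theta>) = ennreal (exp (\<beta> * s) * branching)"
proof -
  have "(\<integral>\<^sup>+ z. ennreal (exp (\<beta> * s) * (\<Lambda> * z)) \<partial>\<Theta>) = ennreal (\<integral>z. exp (\<beta> * s) * (\<Lambda> * z) \<partial>\<Theta>)"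
    by (rule nn_integral_eq_integral) (use integrable_mark Lambda_pos in auto)
  then show ?thesis by (simp add: intensity_kernel_def branching_def)
qed

lemma nn_integral_intensity_kernel_power2:
  "(\<integral>\<^sup>+ z. intensity_kernel (s, z) * intensity_kernel (s, z) \<partial>\<Theta>) = ennreal (exp (2 * \<beta> * s) * branching2)"
proof -
  have "integrable \<Theta> (\<lambda>z. exp (2 * \<beta> * s) * (\<Lambda> * z)\<^sup>2)"
    using integrable_mark_power2 by (simp add: power_mult_distrib)
  then have "(\<integral>\<^sup>+ z. ennreal (exp (2 * \<beta> * s) * (\<Lambda> * z)\<^sup>2) \<partial>\<Theta>) = ennreal (exp (2 * \<beta> * s) * branching2)"
    unfolding branching2_def by (subst nn_integral_eq_integral) auto
  moreover have "(\<integral>\<^sup>+ z. intensity_kernel (s, z) * intensity_kernel (s, z) \<partial>\<Theta>) = (\<integral>\<^sup>+ z. ennreal (exp (2 * \<beta> * s) * (\<Lambda> * z)\<^sup>2) \<partial>\<Theta>)"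
    by (intro nn_integral_cong)
      (use Lambda_pos in \<open>auto simp: intensity_kernel_def ennreal_mult'[symmetric] power2_eq_square exp_add[symmetric] mult_exp_exp algebra_simps\<close>)
  ultimately show ?thesis by simp
qed

text \<open>
  The part of the intensity that is due to past events.
\<close>

definition excitation :: "real \<Rightarrow> 'a \<Rightarrow> ennreal" where
  "excitation t \<omega> = ennreal (exp (- \<beta> * t)) * jump_sum intensity_kernel t \<omega>"

lemma intensity_eq: "intensity t \<omega> = ennreal (base_intensity t) + excitation t \<omega>"
  by (simp add: intensity_def excitation_def)

lemma jump_sum_kernel_eq: "jump_sum intensity_kernel t \<omega> = ennreal (exp (\<beta> * t)) * excitation t \<omega>"
  by (simp add: excitation_def mult.assoc[symmetric] ennreal_mult'[symmetric] exp_add[symmetric])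

lemma base_intensity_le: "0 \<le> t \<Longrightarrow> base_intensity t \<le> lam0"
proof -
  assume "0 \<le> t"
  then have "(lam0 - lbar) * exp (- \<beta> * t) \<le> (lam0 - lbar) * 1"
    using lbar_less beta_pos by (intro mult_left_mono) auto
  then show ?thesis by (simp add: base_intensity_def)
qed

lemma measurable_jump_sum_compose [measurable (raw)]:
  assumes "w \<in> borel_measurable (borel \<Otimes>\<^sub>M Rplus)" "f \<in> borel_measurable M" "g \<in> measurable M Q"
  shows "(\<lambda>x. jump_sum w (f x) (g x)) \<in> borel_measurable M"
  using measurable_compose[OF measurable_Pair[OF assms(3,2)] jump_sum_measurable[OF assms(1)]] by simp

lemma measurable_jump_sum_at [measurable]:
  assumes "w \<in> borel_measurable (borel \<Otimes>\<^sub>M Rplus)"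
  shows "jump_sum w t \<in> borel_measurable Q"
  using measurable_compose[OF measurable_Pair2' jump_sum_measurable[OF assms], of t] by simp

lemma measurable_intensity_at [measurable]: "intensity t \<in> borel_measurable Q"
  unfolding intensity_def by measurable

lemma measurable_expected_predictable:
  assumes Y: "Y \<in> borel_measurable (predictable Q F)"
  shows "(\<lambda>s. (\<E> \<omega>. intensity s \<omega> * Y (\<omega>, s)) * indicator {0..} s) \<in> borel_measurable borel"
proof -
  have "(\<lambda>(s, \<omega>). intensity s \<omega> * Y (\<omega>, s)) \<in> borel_measurable (Rplus \<Otimes>\<^sub>M Q)"
    using measurable_compose[OF measurable_pair_swap' borel_measurable_times_ennreal[OF intensity_jointly_measurable predictable_imp_jointly_measurable[OF Y]]]
    by (simp add: split_beta')
  from borel_measurable_nn_integral_fst[OF this]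
  have "(\<lambda>s. \<E> \<omega>. intensity s \<omega> * Y (\<omega>, s)) \<in> borel_measurable Rplus" by simp
  then show ?thesis
    by (subst (asm) borel_measurable_restrict_space_iff_ennreal) auto
qed

lemma measurable_weighted_jump_sum:
  assumes X: "X \<in> borel_measurable (predictable Q F)" and w [measurable]: "w \<in> borel_measurable (borel \<Otimes>\<^sub>M Rplus)"
  shows "(\<lambda>\<omega>. jump_sum (\<lambda>(s, z). X (\<omega>, s) * w (s, z)) t \<omega>) \<in> borel_measurable Q"
proof -
  have "(\<lambda>\<omega>. (\<omega>, enn2real (\<tau> i \<omega>))) \<in> measurable Q (Q \<Otimes>\<^sub>M Rplus)" for i
    by (intro measurable_Pair measurable_restrict_space2) auto
  from measurable_compose[OF this predictable_imp_jointly_measurable[OF X]]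
  have [measurable]: "(\<lambda>\<omega>. X (\<omega>, enn2real (\<tau> i \<omega>))) \<in> borel_measurable Q" for i .
  show ?thesis unfolding jump_sum_def prod.case by measurable
qed

text \<open>
  Made for the sums produced by \<open>jump_sum_mult\<close>: the weights contain the running sums themselves,
  which are predictable.
\<close>

lemma campbell_product:
  assumes X: "X \<in> borel_measurable (predictable Q F)"
    and v: "v \<in> borel_measurable (borel \<Otimes>\<^sub>M Rplus)" and w: "w \<in> borel_measurable (borel \<Otimes>\<^sub>M Rplus)"
  shows "(\<E> \<omega>. jump_sum (\<lambda>(s, z). X (\<omega>, s) *
         (v (s, z) * w (s, z) + v (s, z) * jump_sum w s \<omega> + w (s, z) * jump_sum v s \<omega>)) t \<omega>) =
    (\<integral>\<^sup>+ s\<in>{0..t}. (\<integral>\<^sup>+ z. v (s, z) * w (s, z) \<partial>\<Theta>) * (\<E> \<omega>. intensity s \<omega> * X (\<omega>, s))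
       + (\<integral>\<^sup>+ z. v (s, z) \<partial>\<Theta>) * (\<E> \<omega>. intensity s \<omega> * (X (\<omega>, s) * jump_sum w s \<omega>))
       + (\<integral>\<^sup>+ z. w (s, z) \<partial>\<Theta>) * (\<E> \<omega>. intensity s \<omega> * (X (\<omega>, s) * jump_sum v s \<omega>)) \<partial>lborel)"
proof -
  let ?t = "\<lambda>Y u \<omega>. jump_sum (\<lambda>(s, z). Y (\<omega>, s) * u (s, z)) t \<omega>"
  let ?r = "\<lambda>Y u s. (\<integral>\<^sup>+ z. u (s, z) \<partial>\<Theta>) * (\<E> \<omega>. intensity s \<omega> * Y (\<omega>, s)) * indicator {0..t} s :: ennreal"
  let ?Xv = "\<lambda>(\<omega>, s). X (\<omega>, s) * jump_sum v s \<omega>" and ?Xw = "\<lambda>(\<omega>, s). X (\<omega>, s) * jump_sum w s \<omega>"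
  have Xu: "(\<lambda>(\<omega>, s). X (\<omega>, s) * jump_sum u s \<omega>) \<in> borel_measurable (predictable Q F)"
    if "u \<in> borel_measurable (borel \<Otimes>\<^sub>M Rplus)" for u
    using borel_measurable_times_ennreal[OF X jump_sum_predictable[OF that]] by (simp add: split_beta')
  have vw: "(\<lambda>p. v p * w p) \<in> borel_measurable (borel \<Otimes>\<^sub>M Rplus)"
    using v w by (rule borel_measurable_times_ennreal)
  have r_meas: "?r Y u \<in> borel_measurable lborel"
    if Y: "Y \<in> borel_measurable (predictable Q F)" and u: "u \<in> borel_measurable (borel \<Otimes>\<^sub>M Rplus)" for Y u
  proof -
    have u': "u \<in> borel_measurable (borel \<Otimes>\<^sub>M \<Theta>)" using u by measurable
    have 1: "(\<lambda>s. \<integral>\<^sup>+ z. u (s, z) \<partial>\<Theta>) \<in> borel_measurable borel"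
      using Theta.borel_measurable_nn_integral_fst[OF u'] .
    have "(\<lambda>s. (\<E> \<omega>. intensity s \<omega> * Y (\<omega>, s)) * indicator {0..} s) \<in> borel_measurable borel"
      by (rule measurable_expected_predictable[OF Y])
    then have "(\<lambda>s. (\<integral>\<^sup>+ z. u (s, z) \<partial>\<Theta>) * ((\<E> \<omega>. intensity s \<omega> * Y (\<omega>, s)) * indicator {0..} s) * indicator {0..t} s) \<in> borel_measurable borel"
      using 1 by measurable
    also have "(\<lambda>s. (\<integral>\<^sup>+ z. u (s, z) \<partial>\<Theta>) * ((\<E> \<omega>. intensity s \<omega> * Y (\<omega>, s)) * indicator {0..} s) * indicator {0..t} s) = ?r Y u"
      by (auto simp: fun_eq_iff split: split_indicator)
    finally show ?thesis by simp
  qed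
  have "jump_sum (\<lambda>(s, z). X (\<omega>, s) *
         (v (s, z) * w (s, z) + v (s, z) * jump_sum w s \<omega> + w (s, z) * jump_sum v s \<omega>)) t \<omega>
      = ?t X (\<lambda>p. v p * w p) \<omega> + ?t ?Xw v \<omega> + ?t ?Xv w \<omega>" for \<omega>
    unfolding jump_sum_add[symmetric] by (rule arg_cong[of _ _ "\<lambda>u. jump_sum u t \<omega>"]) (auto simp: fun_eq_iff algebra_simps)
  then have "(\<E> \<omega>. jump_sum (\<lambda>(s, z). X (\<omega>, s) *
         (v (s, z) * w (s, z) + v (s, z) * jump_sum w s \<omega> + w (s, z) * jump_sum v s \<omega>)) t \<omega>)
      = (\<E> \<omega>. ?t X (\<lambda>p. v p * w p) \<omega>) + (\<E> \<omega>. ?t ?Xw v \<omega>) + (\<E> \<omega>. ?t ?Xv w \<omega>)"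
    by (simp only: nn_integral_add borel_measurable_add measurable_weighted_jump_sum[OF X vw]
        measurable_weighted_jump_sum[OF Xu[OF w] v] measurable_weighted_jump_sum[OF Xu[OF v] w])
  also have "\<dots> = (\<integral>\<^sup>+ s. ?r X (\<lambda>p. v p * w p) s \<partial>lborel) + (\<integral>\<^sup>+ s. ?r ?Xw v s \<partial>lborel) + (\<integral>\<^sup>+ s. ?r ?Xv w s \<partial>lborel)"
    by (simp only: campbell_formula[OF X vw] campbell_formula[OF Xu[OF w] v] campbell_formula[OF Xu[OF v] w])
  also have "\<dots> = (\<integral>\<^sup>+ s. ?r X (\<lambda>p. v p * w p) s + ?r ?Xw v s + ?r ?Xv w s \<partial>lborel)"
    by (simp only: nn_integral_add borel_measurable_add r_meas[OF X vw] r_meas[OF Xu[OF w] v] r_meas[OF Xu[OF v] w])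
  finally show ?thesis by (simp add: distrib_right)
qed

text \<open>
  The localising process: \<open>1\<close> as long as the undiscounted jumps sum to at most \<open>n\<close>. The
  discounting is omitted so that the sum grows with time and a path, once inactive, stays inactive.
\<close>

definition active :: "nat \<Rightarrow> 'a \<times> real \<Rightarrow> ennreal" where
  "active n = (\<lambda>(\<omega>, t). if jump_sum intensity_kernel t \<omega> \<le> of_nat n then 1 else 0)"

lemma active_predictable: "active n \<in> borel_measurable (predictable Q F)"
proof -
  have [measurable]: "(\<lambda>x. jump_sum intensity_kernel (snd x) (fst x)) \<in> borel_measurable (predictable Q F)"
    using jump_sum_predictable[OF intensity_kernel_measurable] by (simp add: split_beta')
  show ?thesis unfolding active_def split_beta' by measurable
qed

lemma measurable_active_compose [measurable (raw)]:
  assumes [measurable]: "f \<in> borel_measurable M" "g \<in> measurable M Q"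
  shows "(\<lambda>x. active n (g x, f x)) \<in> borel_measurable M"
  unfolding active_def prod.case by measurable

text \<open>
  A path that is active at \<open>t\<close> was active at each earlier event.
\<close>

lemma active_jump_sum_le:
  "jump_sum v t \<omega> * active n (\<omega>, t) \<le> jump_sum (\<lambda>(s, z). active n (\<omega>, s) * v (s, z)) t \<omega>"
proof (cases "jump_sum intensity_kernel t \<omega> \<le> of_nat n")
  case True
  have "active n (\<omega>, enn2real (\<tau> i \<omega>)) = 1" if "\<tau> i \<omega> < ennreal t" for i
  proof -
    have "\<tau> i \<omega> < \<infinity>" using that by (rule order_less_trans) simp
    then have "enn2real (\<tau> i \<omega>) \<le> t"
      using that by (cases "\<tau> i \<omega>") (auto simp: ennreal_less_iff)
    then show ?thesis
      using True jump_sum_mono[of _ t intensity_kernel intensity_kernel \<omega>] by (auto simp: active_def intro: order_trans)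
  qed
  then have "jump_sum (\<lambda>(s, z). active n (\<omega>, s) * v (s, z)) t \<omega> = jump_sum v t \<omega>"
    unfolding jump_sum_def by (intro suminf_cong) simp
  then show ?thesis by (simp add: active_def)
qed (simp add: active_def)

lemma excitation_active_le: "0 \<le> t \<Longrightarrow> excitation t \<omega> * active n (\<omega>, t) \<le> of_nat n"
proof (cases "jump_sum intensity_kernel t \<omega> \<le> of_nat n")
  case True
  assume "0 \<le> t"
  then have "ennreal (exp (- \<beta> * t)) * jump_sum intensity_kernel t \<omega> \<le> 1 * of_nat n"
    using beta_pos True by (intro mult_mono) auto
  then show ?thesis by (simp add: excitation_def active_def)
qed (simp add: active_def)

lemma active_le_1: "active n (\<omega>, t) \<le> 1"
  by (auto simp: active_def)

text \<open>
  On a regular path the sum of the jumps before \<open>t\<close> is finite, so the path is active for large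
  \<open>n\<close>, and Fatou's lemma removes the localisation.
\<close>

lemma deactivated_limit:
  assumes [measurable]: "Y \<in> borel_measurable Q"
    and le: "\<And>n. (\<E> \<omega>. Y \<omega> * active n (\<omega>, t)) \<le> B"
  shows "(\<E> \<omega>. Y \<omega>) \<le> B"
proof -
  have "(\<E> \<omega>. Y \<omega>) = (\<E> \<omega>. liminf (\<lambda>n. Y \<omega> * active n (\<omega>, t)))"
  proof (rule nn_integral_cong_AE)
    show "AE \<omega> in Q. Y \<omega> = liminf (\<lambda>n. Y \<omega> * active n (\<omega>, t))"
      using AE_regular_path
    proof eventually_elim
      fix \<omega> assume "regular_path \<omega>"
      then have "jump_sum intensity_kernel t \<omega> < \<infinity>"
        by (rule jump_sum_finite_value) (simp add: intensity_kernel_def)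
      then obtain r where r: "jump_sum intensity_kernel t \<omega> = ennreal r" by (cases "jump_sum intensity_kernel t \<omega>") auto
      obtain N where "r \<le> real N" using real_arch_simple by blast
      then have "active n (\<omega>, t) = 1" if "n \<ge> N" for n
        using that by (simp add: active_def r ennreal_of_nat_eq_real_of_nat ennreal_leI)
      then have "\<forall>\<^sub>F n in sequentially. Y \<omega> * active n (\<omega>, t) = Y \<omega>"
        unfolding eventually_sequentially by (intro exI[of _ N]) simp
      then have "(\<lambda>n. Y \<omega> * active n (\<omega>, t)) \<longlonglongrightarrow> Y \<omega>" by (rule tendsto_eventually)
      then show "Y \<omega> = liminf (\<lambda>n. Y \<omega> * active n (\<omega>, t))"
        by (intro lim_imp_Liminf[symmetric]) auto
    qed
  qed
  also have "\<dots> \<le> liminf (\<lambda>n. \<E> \<omega>. Y \<omega> * active n (\<omega>, t))"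
    by (rule nn_integral_liminf) measurable
  also have "\<dots> \<le> B" using le by (intro Liminf_le) auto
  finally show ?thesis .
qed

lemma discounted_integral:
  fixes b :: real
  assumes [measurable]: "x \<in> borel_measurable borel" and c: "0 \<le> c"
  shows "ennreal (exp (- b * t)) * (\<integral>\<^sup>+ s\<in>{0..t}. ennreal (exp (b * s) * c) * x s \<partial>lborel)
     = ennreal c * (\<integral>\<^sup>+ s\<in>{0..t}. ennreal (exp (- b * (t - s))) * x s \<partial>lborel)"
proof -
  have "ennreal (exp (- b * t)) * (ennreal (exp (b * s) * c) * x s * i) = ennreal c * (ennreal (exp (- b * (t - s))) * x s * i)" for s i
  proof -
    have "exp (- b * t) * (exp (b * s) * c) = c * exp (- b * (t - s))"
      by (simp add: mult_exp_exp algebra_simps)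
    then have "ennreal (exp (- b * t)) * ennreal (exp (b * s) * c) = ennreal c * ennreal (exp (- b * (t - s)))"
      using c by (simp only: ennreal_mult'[symmetric] exp_ge_zero)
    then show ?thesis by (simp only: mult.assoc[symmetric])
  qed
  then show ?thesis
    by (subst (1 2) nn_integral_cmult[symmetric]) (auto intro!: nn_integral_cong)
qed

definition active_mean :: "nat \<Rightarrow> real \<Rightarrow> ennreal" where
  "active_mean n t = (\<E> \<omega>. intensity t \<omega> * active n (\<omega>, t))"

definition active_square :: "nat \<Rightarrow> real \<Rightarrow> ennreal" where
  "active_square n t = (\<E> \<omega>. (excitation t \<omega>)\<^sup>2 * active n (\<omega>, t))"

lemma measurable_excitation_at [measurable]: "excitation t \<in> borel_measurable Q"
  unfolding excitation_def by measurable

lemma measurable_active_moments [measurable]: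
  "active_mean n \<in> borel_measurable borel" "active_square n \<in> borel_measurable borel"
  unfolding active_mean_def active_square_def excitation_def intensity_def base_intensity_def by measurable

lemma lam0_pos: "0 < lam0" using lbar_nonneg lbar_less by simp

definition mean_bound :: real where "mean_bound = lam0 * \<beta> / (\<beta> - branching)"

lemma mean_bound_nonneg: "0 \<le> mean_bound"
  unfolding mean_bound_def using lam0_pos beta_pos branching_less by (intro divide_nonneg_nonneg mult_nonneg_nonneg) auto

text \<open>
  Campbell's formula turns the mean excitation into an integral of the mean intensity, against a kernel with mass
  at most \<open>branching / \<beta> < 1\<close>. The localisation supplies the crude bound
  \<open>lam0 + n\<close>.
\<close>

lemma active_mean_le: assumes t: "0 \<le> t" shows "active_mean n t \<le> ennreal mean_bound"
  unfolding mean_bound_def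
proof (rule renewal_bound[OF branching_nonneg branching_less _ _ _ t])
  fix t :: real assume t: "0 \<le> t"
  have "active_mean n t \<le> (\<E> \<omega>. ennreal (lam0 + real n))"
    unfolding active_mean_def
  proof (rule nn_integral_mono)
    fix \<omega>
    have "intensity t \<omega> * active n (\<omega>, t) \<le> ennreal lam0 * 1 + of_nat n"
      unfolding intensity_eq distrib_right
      by (intro add_mono mult_mono active_le_1 excitation_active_le[OF t] ennreal_leI base_intensity_le[OF t]) auto
    then show "intensity t \<omega> * active n (\<omega>, t) \<le> ennreal (lam0 + real n)"
      using lam0_pos by (simp add: ennreal_of_nat_eq_real_of_nat)
  qed
  then show "active_mean n t \<le> ennreal (lam0 + real n)" by (simp add: emeasure_space_1)
  let ?J = "\<lambda>\<omega>. jump_sum (\<lambda>(s, z). active n (\<omega>, s) * intensity_kernel (s, z)) t \<omega>"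
  have "active_mean n t \<le> (\<E> \<omega>. ennreal lam0 + ennreal (exp (- \<beta> * t)) * ?J \<omega>)"
    unfolding active_mean_def
  proof (rule nn_integral_mono)
    fix \<omega>
    have "intensity t \<omega> * active n (\<omega>, t)
       = ennreal (base_intensity t) * active n (\<omega>, t) + ennreal (exp (- \<beta> * t)) * (jump_sum intensity_kernel t \<omega> * active n (\<omega>, t))"
      by (simp only: intensity_def distrib_right mult.assoc)
    also have "\<dots> \<le> ennreal lam0 * 1 + ennreal (exp (- \<beta> * t)) * ?J \<omega>"
      by (intro add_mono mult_mono active_le_1 active_jump_sum_le ennreal_leI base_intensity_le[OF t]) auto
    finally show "intensity t \<omega> * active n (\<omega>, t) \<le> ennreal lam0 + ennreal (exp (- \<beta> * t)) * ?J \<omega>" by simp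
  qed
  also have "\<dots> = ennreal lam0 + ennreal (exp (- \<beta> * t)) *
      (\<integral>\<^sup>+ s\<in>{0..t}. ennreal (exp (\<beta> * s) * branching) * active_mean n s \<partial>lborel)"
    using measurable_weighted_jump_sum[OF active_predictable intensity_kernel_measurable]
    by (simp add: nn_integral_add nn_integral_cmult emeasure_space_1
        campbell_formula[OF active_predictable intensity_kernel_measurable]
        nn_integral_intensity_kernel active_mean_def[symmetric])
  finally show "active_mean n t \<le> ennreal lam0 + ennreal branching * (\<integral>\<^sup>+ s\<in>{0..t}. ennreal (exp (- \<beta> * (t - s))) * active_mean n s \<partial>lborel)"
    by (simp only: discounted_integral measurable_active_moments branching_nonneg)
qed (use lam0_pos in simp)

lemma nn_mean_intensity_le:
  assumes "0 \<le> t" shows "(\<E> \<omega>. intensity t \<omega>) \<le> ennreal mean_bound"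
  by (rule deactivated_limit[where t=t]) (use active_mean_le[OF assms] in \<open>simp_all add: active_mean_def\<close>)

lemma excitation_square_eq:
  "(excitation t \<omega>)\<^sup>2 = ennreal (exp (- (2 * \<beta>) * t)) * (jump_sum intensity_kernel t \<omega> * jump_sum intensity_kernel t \<omega>)"
proof -
  have "ennreal (exp (- (2 * \<beta>) * t)) = ennreal (exp (- \<beta> * t)) * ennreal (exp (- \<beta> * t))"
    by (subst ennreal_mult'[symmetric]) (auto simp: mult_exp_exp)
  then show ?thesis by (simp add: excitation_def power2_eq_square mult_ac)
qed

text \<open>
  The contribution of pairs of distinct events to the second moment of the excitation.
\<close>

lemma expected_feedback_le:
  assumes s: "0 \<le> s"
  shows "(\<E> \<omega>. intensity s \<omega> * (active n (\<omega>, s) * jump_sum intensity_kernel s \<omega>))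
     \<le> ennreal (exp (\<beta> * s)) * (ennreal (lam0 * mean_bound) + active_square n s)"
proof -
  have "(\<E> \<omega>. intensity s \<omega> * (active n (\<omega>, s) * jump_sum intensity_kernel s \<omega>))
      \<le> (\<E> \<omega>. ennreal (exp (\<beta> * s)) * (ennreal lam0 * (intensity s \<omega> * active n (\<omega>, s)) + (excitation s \<omega>)\<^sup>2 * active n (\<omega>, s)))"
  proof (rule nn_integral_mono)
    fix \<omega>
    have "intensity s \<omega> * (active n (\<omega>, s) * jump_sum intensity_kernel s \<omega>)
      = ennreal (exp (\<beta> * s)) * (ennreal (base_intensity s) * (excitation s \<omega> * active n (\<omega>, s)) + (excitation s \<omega>)\<^sup>2 * active n (\<omega>, s))"
      unfolding jump_sum_kernel_eq intensity_eq by (simp add: distrib_left distrib_right power2_eq_square mult_ac)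
    also have "\<dots> \<le> ennreal (exp (\<beta> * s)) * (ennreal lam0 * (intensity s \<omega> * active n (\<omega>, s)) + (excitation s \<omega>)\<^sup>2 * active n (\<omega>, s))"
      using base_intensity_le[OF s] by (intro mult_left_mono add_mono mult_mono) (auto simp: intensity_eq intro!: ennreal_leI)
    finally show "intensity s \<omega> * (active n (\<omega>, s) * jump_sum intensity_kernel s \<omega>) \<le> \<dots>" .
  qed
  also have "\<dots> = ennreal (exp (\<beta> * s)) * (ennreal lam0 * active_mean n s + active_square n s)"
    unfolding active_mean_def active_square_def by (simp add: nn_integral_cmult nn_integral_add)
  also have "\<dots> \<le> ennreal (exp (\<beta> * s)) * (ennreal (lam0 * mean_bound) + active_square n s)"
    using active_mean_le[OF s, of n] lam0_pos by (intro mult_left_mono add_mono) (auto simp: ennreal_mult' intro!: mult_left_mono)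
  finally show ?thesis .
qed

definition square_const :: real where
  "square_const = (branching2 + 2 * branching * lam0) * mean_bound"

lemma square_const_nonneg: "0 \<le> square_const"
  unfolding square_const_def
  using branching_nonneg branching2_nonneg lam0_pos mean_bound_nonneg by auto

text \<open>
  The square of the excitation is again a sum over events. Its expectation involves the square of the excitation
  at earlier times with the kernel \<open>2 * branching * exp (- 2 * \<beta> * (t - s))\<close>, whose mass is at
  most \<open>branching / \<beta> < 1\<close>.
\<close>

lemma active_square_ineq:
  assumes t: "0 \<le> t"
  shows "active_square n t \<le> ennreal (square_const / (2 * \<beta>))
     + ennreal (2 * branching) * (\<integral>\<^sup>+ s\<in>{0..t}. ennreal (exp (- (2 * \<beta>) * (t - s))) * active_square n s \<partial>lborel)"
proof -
  let ?k = "intensity_kernel" and ?a = "\<lambda>s \<omega>. active n (\<omega>, s)"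
  let ?w = "\<lambda>\<omega> s z. ?k (s, z) * ?k (s, z) + ?k (s, z) * jump_sum ?k s \<omega> + ?k (s, z) * jump_sum ?k s \<omega>"
  let ?S = "\<lambda>\<omega>. jump_sum (\<lambda>(s, z). ?a s \<omega> * ?w \<omega> s z) t \<omega>"
  let ?y = "\<lambda>s. ennreal square_const + ennreal (2 * branching) * active_square n s"
  have "AE \<omega> in Q. (excitation t \<omega>)\<^sup>2 * ?a t \<omega> \<le> ennreal (exp (- (2 * \<beta>) * t)) * ?S \<omega>"
    using AE_regular_path
  proof eventually_elim
    fix \<omega> assume reg: "regular_path \<omega>"
    have "jump_sum ?k t \<omega> * jump_sum ?k t \<omega> * ?a t \<omega> \<le> ?S \<omega>"
      unfolding jump_sum_mult[OF reg] by (rule order_trans[OF active_jump_sum_le]) simp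
    then show "(excitation t \<omega>)\<^sup>2 * ?a t \<omega> \<le> ennreal (exp (- (2 * \<beta>) * t)) * ?S \<omega>"
      unfolding excitation_square_eq mult.assoc by (intro mult_left_mono) auto
  qed
  then have "active_square n t \<le> (\<E> \<omega>. ennreal (exp (- (2 * \<beta>) * t)) * ?S \<omega>)"
    unfolding active_square_def by (rule nn_integral_mono_AE)
  also have "\<dots> = ennreal (exp (- (2 * \<beta>) * t)) * (\<E> \<omega>. ?S \<omega>)"
  proof (rule nn_integral_cmult)
    show "?S \<in> borel_measurable Q"
      unfolding jump_sum_def[of "\<lambda>(s, z). _ s z"] prod.case by measurable
  qed
  also have "\<dots> \<le> ennreal (exp (- (2 * \<beta>) * t)) * (\<integral>\<^sup>+ s\<in>{0..t}. ennreal (exp (2 * \<beta> * s) * 1) * ?y s \<partial>lborel)"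
    unfolding campbell_product[OF active_predictable intensity_kernel_measurable intensity_kernel_measurable]
      nn_integral_intensity_kernel nn_integral_intensity_kernel_power2 active_mean_def[symmetric]
  proof (intro mult_left_mono nn_integral_mono)
    fix s
    let ?F = "\<E> \<omega>. intensity s \<omega> * (?a s \<omega> * jump_sum ?k s \<omega>)"
    show "(ennreal (exp (2 * \<beta> * s) * branching2) * active_mean n s
         + ennreal (exp (\<beta> * s) * branching) * ?F + ennreal (exp (\<beta> * s) * branching) * ?F) * indicator {0..t} s
       \<le> ennreal (exp (2 * \<beta> * s) * 1) * ?y s * indicator {0..t} s"
    proof (cases "s \<in> {0..t}")
      case True
      then have s: "0 \<le> s" by simp
      define e where "e = ennreal (exp (\<beta> * s))"
      have split: "ennreal (exp (\<beta> * s) * c) = e * ennreal c" "ennreal (exp (2 * \<beta> * s) * c) = e * e * ennreal c" for c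
        by (simp_all add: e_def ennreal_mult'[symmetric] mult.assoc[symmetric] mult_exp_exp)
      have "e * e * ennreal branching2 * active_mean n s + e * ennreal branching * ?F + e * ennreal branching * ?F
        \<le> e * e * ennreal branching2 * ennreal mean_bound
          + e * ennreal branching * (e * (ennreal (lam0 * mean_bound) + active_square n s))
          + e * ennreal branching * (e * (ennreal (lam0 * mean_bound) + active_square n s))"
        unfolding e_def by (intro add_mono mult_left_mono active_mean_le expected_feedback_le s) auto
      also have "\<dots> = e * e * ((ennreal branching2 * ennreal mean_bound + 2 * (ennreal branching * ennreal (lam0 * mean_bound)))
          + 2 * ennreal branching * active_square n s)"
        by (simp only: distrib_left mult_2 mult_ac distrib_right add_ac)
      also have "ennreal branching2 * ennreal mean_bound + 2 * (ennreal branching * ennreal (lam0 * mean_bound)) = ennreal square_const"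
      proof -
        have "square_const = branching2 * mean_bound + 2 * (branching * (lam0 * mean_bound))"
          by (simp add: square_const_def algebra_simps)
        then show ?thesis
          using branching_nonneg branching2_nonneg lam0_pos mean_bound_nonneg
          by (simp add: ennreal_plus ennreal_mult)
      qed
      also have "2 * ennreal branching = ennreal (2 * branching)" by (simp add: ennreal_mult')
      finally show ?thesis using True unfolding split by simp
    qed simp
  qed auto
  also have "\<dots> = (\<integral>\<^sup>+ s\<in>{0..t}. ennreal (exp (- (2 * \<beta>) * (t - s))) * ?y s \<partial>lborel)"
    by (subst discounted_integral) simp_all
  also have "\<dots> = (\<integral>\<^sup>+ s. ennreal square_const * (ennreal (exp (- (2 * \<beta>) * (t - s))) * indicator {0..t} s)
      + ennreal (2 * branching) * (ennreal (exp (- (2 * \<beta>) * (t - s))) * active_square n s * indicator {0..t} s) \<partial>lborel)"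
    by (intro nn_integral_cong) (simp only: distrib_left distrib_right mult_ac)
  also have "\<dots> = ennreal square_const * (\<integral>\<^sup>+ s\<in>{0..t}. ennreal (exp (- (2 * \<beta>) * (t - s))) \<partial>lborel)
      + ennreal (2 * branching) * (\<integral>\<^sup>+ s\<in>{0..t}. ennreal (exp (- (2 * \<beta>) * (t - s))) * active_square n s \<partial>lborel)"
    by (simp add: nn_integral_add nn_integral_cmult)
  also have "\<dots> \<le> ennreal square_const * ennreal (1 / (2 * \<beta>))
      + ennreal (2 * branching) * (\<integral>\<^sup>+ s\<in>{0..t}. ennreal (exp (- (2 * \<beta>) * (t - s))) * active_square n s \<partial>lborel)"
    by (intro add_right_mono mult_left_mono nn_integral_exp_decay_le t) (use beta_pos in auto)
  also have "ennreal square_const * ennreal (1 / (2 * \<beta>)) = ennreal (square_const / (2 * \<beta>))"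
    using square_const_nonneg by (subst ennreal_mult'[symmetric]) auto
  finally show ?thesis .
qed

definition excitation_bound :: real where
  "excitation_bound = square_const / (2 * \<beta>) * (2 * \<beta>) / (2 * \<beta> - 2 * branching)"

lemma excitation_bound_nonneg: "0 \<le> excitation_bound"
  unfolding excitation_bound_def using square_const_nonneg beta_pos branching_less
  by (intro mult_nonneg_nonneg divide_nonneg_nonneg) auto

lemma nn_square_excitation_le:
  assumes t: "0 \<le> t"
  shows "(\<E> \<omega>. (excitation t \<omega>)\<^sup>2) \<le> ennreal excitation_bound"
proof (rule deactivated_limit[where t=t])
  fix n
  show "(\<E> \<omega>. (excitation t \<omega>)\<^sup>2 * active n (\<omega>, t)) \<le> ennreal excitation_bound"
    unfolding active_square_def[symmetric] excitation_bound_def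
  proof (rule renewal_bound[OF _ _ _ _ active_square_ineq t])
    fix t :: real assume t: "0 \<le> t"
    have "active_square n t \<le> (\<E> \<omega>. of_nat n * of_nat n)"
      unfolding active_square_def
    proof (rule nn_integral_mono)
      fix \<omega>
      have "(excitation t \<omega>)\<^sup>2 * active n (\<omega>, t) = (excitation t \<omega> * active n (\<omega>, t)) * (excitation t \<omega> * active n (\<omega>, t))"
        by (auto simp: active_def power2_eq_square)
      also have "\<dots> \<le> of_nat n * of_nat n" by (intro mult_mono excitation_active_le t) auto
      finally show "(excitation t \<omega>)\<^sup>2 * active n (\<omega>, t) \<le> of_nat n * of_nat n" .
    qed
    then show "active_square n t \<le> ennreal (real n * real n)"
      by (simp add: emeasure_space_1 ennreal_of_nat_eq_real_of_nat ennreal_mult')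
  qed (use branching_nonneg branching_less square_const_nonneg beta_pos in auto)
qed measurable

definition square_bound :: real where
  "square_bound = 2 * lam0\<^sup>2 + 2 * excitation_bound"

lemma square_bound_nonneg: "0 \<le> square_bound"
  unfolding square_bound_def using excitation_bound_nonneg by simp

lemma nn_square_intensity_le:
  assumes t: "0 \<le> t"
  shows "(\<E> \<omega>. (intensity t \<omega>)\<^sup>2) \<le> ennreal square_bound"
proof -
  have "(\<E> \<omega>. (intensity t \<omega>)\<^sup>2) \<le> (\<E> \<omega>. 2 * (ennreal lam0)\<^sup>2 + 2 * (excitation t \<omega>)\<^sup>2)"
  proof (rule nn_integral_mono)
    fix \<omega>
    have "intensity t \<omega> \<le> ennreal lam0 + excitation t \<omega>"
      unfolding intensity_eq using base_intensity_le[OF t] by (intro add_mono ennreal_leI) auto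
    then have "(intensity t \<omega>)\<^sup>2 \<le> (ennreal lam0 + excitation t \<omega>)\<^sup>2" by (intro power_mono) auto
    then show "(intensity t \<omega>)\<^sup>2 \<le> 2 * (ennreal lam0)\<^sup>2 + 2 * (excitation t \<omega>)\<^sup>2"
      using ennreal_power2_add_le order_trans by blast
  qed
  also have "\<dots> = 2 * (ennreal lam0)\<^sup>2 + 2 * (\<E> \<omega>. (excitation t \<omega>)\<^sup>2)"
    by (simp add: nn_integral_add nn_integral_cmult emeasure_space_1)
  also have "\<dots> \<le> 2 * (ennreal lam0)\<^sup>2 + 2 * ennreal excitation_bound"
    by (intro add_mono mult_left_mono nn_square_excitation_le t) auto
  also have "\<dots> = ennreal square_bound"
  proof -
    have "2 * (ennreal lam0)\<^sup>2 + 2 * ennreal x = ennreal (2 * lam0\<^sup>2 + 2 * x)" if "0 \<le> x" for x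
      using lam0_pos that by (simp add: ennreal_plus ennreal_mult ennreal_power)
    then show ?thesis unfolding square_bound_def using excitation_bound_nonneg by blast
  qed
  finally show ?thesis .
qed

end

section \<open>Integral equations for the moments of the intensity\<close>

text \<open>
  The functions for which the integral of nonnegative functions, the Lebesgue integral and the gauge integral over
  \<open>{0..t}\<close> exist and agree. Only their values on the half-line matter.
\<close>

definition tame :: "(real \<Rightarrow> real) \<Rightarrow> bool" where
  "tame g \<longleftrightarrow> (\<lambda>s. g s * indicator {0..} s) \<in> borel_measurable borel \<and>
     (\<forall>t\<ge>0. \<exists>C. \<forall>s\<in>{0..t}. 0 \<le> g s \<and> g s \<le> C)"

lemma tame_nonneg: "tame g \<Longrightarrow> 0 \<le> s \<Longrightarrow> 0 \<le> g s"
  unfolding tame_def by (metis atLeastAtMost_iff order_refl)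

lemma tame_measurable: "tame g \<Longrightarrow> (\<lambda>s. g s * indicator {0..} s) \<in> borel_measurable borel"
  by (simp add: tame_def)

lemma tame_add: assumes "tame f" "tame g" shows "tame (\<lambda>s. f s + g s)"
  unfolding tame_def
proof (intro conjI allI impI)
  show "(\<lambda>s. (f s + g s) * indicator {0..} s) \<in> borel_measurable borel"
    unfolding distrib_right by (rule borel_measurable_add[OF tame_measurable[OF assms(1)] tame_measurable[OF assms(2)]])
  fix t :: real assume "0 \<le> t"
  with assms obtain C D where "\<forall>s\<in>{0..t}. 0 \<le> f s \<and> f s \<le> C" "\<forall>s\<in>{0..t}. 0 \<le> g s \<and> g s \<le> D"
    unfolding tame_def by meson
  then show "\<exists>C. \<forall>s\<in>{0..t}. 0 \<le> f s + g s \<and> f s + g s \<le> C"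
    by (intro exI[of _ "C + D"]) (simp add: add_mono)
qed

lemma tame_mult: assumes "tame f" "tame g" shows "tame (\<lambda>s. f s * g s)"
  unfolding tame_def
proof (intro conjI allI impI)
  have "(\<lambda>s. (f s * indicator {0..} s) * (g s * indicator {0..} s)) \<in> borel_measurable borel"
    by (rule borel_measurable_times[OF tame_measurable[OF assms(1)] tame_measurable[OF assms(2)]])
  also have "(\<lambda>s. (f s * indicator {0..} s) * (g s * indicator {0..} s)) = (\<lambda>s. (f s * g s) * indicator {0..} s)"
    by (auto split: split_indicator)
  finally show "(\<lambda>s. (f s * g s) * indicator {0..} s) \<in> borel_measurable borel" .
  fix t :: real assume "0 \<le> t"
  with assms obtain C D where "\<forall>s\<in>{0..t}. 0 \<le> f s \<and> f s \<le> C" "\<forall>s\<in>{0..t}. 0 \<le> g s \<and> g s \<le> D"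
    unfolding tame_def by meson
  then show "\<exists>C. \<forall>s\<in>{0..t}. 0 \<le> f s * g s \<and> f s * g s \<le> C"
    by (intro exI[of _ "C * D"] ballI conjI mult_nonneg_nonneg mult_mono) (auto intro: order_trans)
qed

lemma tame_continuous:
  assumes "continuous_on UNIV f" and nn: "\<And>s. 0 \<le> s \<Longrightarrow> 0 \<le> f s" shows "tame f"
  unfolding tame_def
proof (intro conjI allI impI)
  have "f \<in> borel_measurable borel" using assms(1) by (rule borel_measurable_continuous_onI)
  then show "(\<lambda>s. f s * indicator {0..} s) \<in> borel_measurable borel" by measurable
  fix t :: real
  have "compact (f ` {0..t})" using continuous_on_subset[OF assms(1)] by (intro compact_continuous_image) auto
  then obtain C where "\<forall>y\<in>f ` {0..t}. norm y \<le> C" using compact_imp_bounded bounded_iff by metis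
  then show "\<exists>C. \<forall>s\<in>{0..t}. 0 \<le> f s \<and> f s \<le> C" using nn by (intro exI[of _ C]) (auto simp: abs_le_iff)
qed

lemma tame_const: "0 \<le> c \<Longrightarrow> tame (\<lambda>_. c)"
  by (rule tame_continuous) auto

lemma tame_exp: "tame (\<lambda>s. exp (b * s))"
  by (rule tame_continuous) (auto intro!: continuous_intros)

lemma tame_set_integrable:
  assumes "tame g" "0 \<le> t" shows "set_integrable lborel {0..t} g"
proof -
  from assms obtain C where C: "\<And>s. s \<in> {0..t} \<Longrightarrow> 0 \<le> g s \<and> g s \<le> C" unfolding tame_def by meson
  have "(\<lambda>s. (g s * indicator {0..} s) * indicator {0..t} s) \<in> borel_measurable borel"
    by (rule borel_measurable_times[OF tame_measurable[OF assms(1)]]) simp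
  also have "(\<lambda>s. (g s * indicator {0..} s) * indicator {0..t} s) = (\<lambda>s. indicator {0..t} s *\<^sub>R g s)"
    by (auto split: split_indicator)
  finally have m: "(\<lambda>s. indicator {0..t} s *\<^sub>R g s) \<in> borel_measurable lborel" by simp
  show ?thesis
    unfolding set_integrable_def
  proof (rule Bochner_Integration.integrable_bound[OF _ m])
    show "integrable lborel (\<lambda>s. indicator {0..t} s *\<^sub>R C)"
      using borel_integrable_atLeastAtMost'[of 0 t "\<lambda>_. C"] by (simp add: set_integrable_def)
    show "AE s in lborel. norm (indicator {0..t} s *\<^sub>R g s) \<le> norm (indicator {0..t} s *\<^sub>R C)"
      using C by (intro AE_I2) (use abs_ge_self[of C] in \<open>auto simp: indicator_def intro: order_trans\<close>)
  qed
qed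

lemma tame_integrable_on: "tame g \<Longrightarrow> 0 \<le> t \<Longrightarrow> g integrable_on {0..t}"
  by (rule set_borel_integral_eq_integral) (rule tame_set_integrable)

lemma tame_set_integral: "tame g \<Longrightarrow> 0 \<le> t \<Longrightarrow> (LINT s:{0..t}|lborel. g s) = integral {0..t} g"
  by (rule set_borel_integral_eq_integral) (rule tame_set_integrable)

lemma tame_nn_integral:
  assumes "tame g" "0 \<le> t" shows "(\<integral>\<^sup>+ s\<in>{0..t}. ennreal (g s) \<partial>lborel) = ennreal (integral {0..t} g)"
  using tame_nonneg[OF assms(1)] integrable_integral[OF tame_integrable_on[OF assms]]
  by (intro nn_integral_has_integral_lebesgue') auto

lemma tame_nn_integral_eq:
  assumes "tame g" "0 \<le> t" "\<And>s. s \<in> {0..t} \<Longrightarrow> f s = ennreal (g s)"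
  shows "(\<integral>\<^sup>+ s\<in>{0..t}. f s \<partial>lborel) = ennreal (integral {0..t} g)"
  unfolding tame_nn_integral[OF assms(1,2), symmetric]
  by (intro nn_integral_cong) (auto simp: assms(3) split: split_indicator)

lemma tame_integral_nonneg: "tame g \<Longrightarrow> 0 \<le> t \<Longrightarrow> 0 \<le> integral {0..t} g"
  using tame_nonneg by (intro integral_nonneg tame_integrable_on) auto

lemma tame_of_nn:
  assumes J: "(\<lambda>s. J s * indicator {0..} s) \<in> borel_measurable borel"
    and eq: "\<And>s. 0 \<le> s \<Longrightarrow> J s = ennreal (g s)" and nn: "\<And>s. 0 \<le> s \<Longrightarrow> 0 \<le> g s"
    and bd: "\<And>t. 0 \<le> t \<Longrightarrow> \<exists>C. \<forall>s\<in>{0..t}. g s \<le> C"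
  shows "tame g"
  unfolding tame_def
proof (intro conjI allI impI)
  have "(\<lambda>s. enn2real (J s * indicator {0..} s)) \<in> borel_measurable borel" using J by measurable
  also have "(\<lambda>s. enn2real (J s * indicator {0..} s)) = (\<lambda>s. g s * indicator {0..} s)"
    by (rule ext, case_tac "0 \<le> s") (simp_all add: eq nn)
  finally show "(\<lambda>s. g s * indicator {0..} s) \<in> borel_measurable borel" .
  fix t :: real assume "0 \<le> t"
  from bd[OF this] obtain C where "\<forall>s\<in>{0..t}. g s \<le> C" by blast
  then show "\<exists>C. \<forall>s\<in>{0..t}. 0 \<le> g s \<and> g s \<le> C"
    using nn by (intro exI[of _ C]) simp
qed

context marked_hawkes_model begin

text \<open>
  The probability space is complete.
\<close>

lemma measurable_AE_eq:
  fixes f g :: "'a \<Rightarrow> real"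
  assumes g: "g \<in> borel_measurable Q" and ae: "AE \<omega> in Q. f \<omega> = g \<omega>"
  shows "f \<in> borel_measurable Q"
proof (rule measurableI)
  have "complete_measure Q" using usual[unfolded usual_conditions_def] by blast
  then interpret complete_measure Q .
  fix B :: "real set" assume "B \<in> sets borel"
  then have "g -` B \<inter> space Q \<in> sets Q" using g by (rule measurable_sets[rotated])
  then show "f -` B \<inter> space Q \<in> sets Q"
    by (rule in_sets_AE[rotated]) (use ae AE_space in \<open>auto elim!: eventually_mono\<close>)
qed simp

abbreviation "mn \<equiv> mean_intensity Q lam"
abbreviation "m2 \<equiv> second_moment Q lam"

lemma AE_lam_eq: "0 \<le> t \<Longrightarrow> AE \<omega> in Q. 0 \<le> lam t \<omega> \<and> ennreal (lam t \<omega>) = intensity t \<omega>"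
  using AE_lam_eq_intensity by eventually_elim auto

lemma measurable_lam: assumes t: "0 \<le> t" shows "lam t \<in> borel_measurable Q"
proof (rule measurable_AE_eq)
  show "AE \<omega> in Q. lam t \<omega> = enn2real (intensity t \<omega>)"
    using AE_lam_eq[OF t] by eventually_elim (metis enn2real_ennreal)
qed measurable

lemma nn_integral_intensity: assumes t: "0 \<le> t" shows "(\<E> \<omega>. intensity t \<omega>) = ennreal (mn t)"
proof -
  have eq: "(\<E> \<omega>. intensity t \<omega>) = (\<E> \<omega>. ennreal (lam t \<omega>))"
    using AE_lam_eq[OF t] by (intro nn_integral_cong_AE) (auto elim: eventually_mono)
  moreover have "(\<E> \<omega>. intensity t \<omega>) < \<infinity>" using nn_mean_intensity_le[OF t] by (rule order_le_less_trans) simp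
  ultimately have "integrable Q (lam t)"
    using measurable_lam[OF t] AE_lam_eq[OF t] by (intro integrableI_nonneg) (auto elim: eventually_mono)
  with eq show ?thesis
    using AE_lam_eq[OF t] by (simp add: mean_intensity_def) (intro nn_integral_eq_integral; auto elim: eventually_mono)
qed

lemma nn_integral_intensity_power2: assumes t: "0 \<le> t" shows "(\<E> \<omega>. (intensity t \<omega>)\<^sup>2) = ennreal (m2 t)"
proof -
  have eq: "(\<E> \<omega>. (intensity t \<omega>)\<^sup>2) = (\<E> \<omega>. ennreal ((lam t \<omega>)\<^sup>2))"
  proof (rule nn_integral_cong_AE)
    show "AE \<omega> in Q. (intensity t \<omega>)\<^sup>2 = ennreal ((lam t \<omega>)\<^sup>2)"
      using AE_lam_eq[OF t] by eventually_elim (metis ennreal_power)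
  qed
  moreover have "(\<E> \<omega>. (intensity t \<omega>)\<^sup>2) < \<infinity>" using nn_square_intensity_le[OF t] by (rule order_le_less_trans) simp
  ultimately have "integrable Q (\<lambda>\<omega>. (lam t \<omega>)\<^sup>2)"
    using measurable_lam[OF t] by (intro integrableI_nonneg) auto
  with eq show ?thesis
    by (simp add: second_moment_def) (intro nn_integral_eq_integral; auto)
qed

lemma mn_bounds: assumes "0 \<le> t" shows "0 \<le> mn t" "mn t \<le> mean_bound"
proof -
  show "0 \<le> mn t" unfolding mean_intensity_def
    using AE_lam_eq[OF assms] by (intro integral_nonneg_AE) (auto elim: eventually_mono)
  show "mn t \<le> mean_bound" using nn_mean_intensity_le[OF assms] mean_bound_nonneg
    unfolding nn_integral_intensity[OF assms] by (simp add: ennreal_le_iff)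
qed

lemma measurable_nn_expectation:
  assumes "(\<lambda>(\<omega>, s). Y \<omega> s) \<in> borel_measurable (Q \<Otimes>\<^sub>M borel)"
  shows "(\<lambda>s. (\<E> \<omega>. Y \<omega> s)) \<in> borel_measurable (borel :: real measure)"
proof -
  have "(\<lambda>(s, \<omega>). Y \<omega> s) \<in> borel_measurable (borel \<Otimes>\<^sub>M Q)"
    using measurable_compose[OF measurable_pair_swap' assms] by (simp add: split_beta')
  from borel_measurable_nn_integral_fst[OF this] show ?thesis by simp
qed

lemma measurable_intensity_compose [measurable (raw)]:
  assumes "f \<in> borel_measurable M" "g \<in> measurable M Q"
  shows "(\<lambda>x. intensity (f x) (g x)) \<in> borel_measurable M"
  using measurable_compose[OF measurable_Pair[OF assms(2,1)] intensity_measurable] by simp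

lemma measurable_excitation_compose [measurable (raw)]:
  assumes [measurable]: "f \<in> borel_measurable M" "g \<in> measurable M Q"
  shows "(\<lambda>x. excitation (f x) (g x)) \<in> borel_measurable M"
  unfolding excitation_def by measurable

lemma tame_mn: "tame mn"
proof (rule tame_of_nn[where J="\<lambda>t. \<E> \<omega>. intensity t \<omega>"])
  show "(\<lambda>t. (\<E> \<omega>. intensity t \<omega>) * indicator {0..} t) \<in> borel_measurable borel"
    using measurable_nn_expectation[of "\<lambda>\<omega> s. intensity s \<omega>"] by measurable
  show "\<exists>C. \<forall>s\<in>{0..t}. mn s \<le> C" for t
    using mn_bounds(2) by (intro exI[of _ mean_bound]) auto
qed (use nn_integral_intensity mn_bounds(1) in auto)

definition cross :: "real \<Rightarrow> real" where "cross t = enn2real (\<E> \<omega>. intensity t \<omega> * excitation t \<omega>)"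

lemma nn_integral_cross: assumes t: "0 \<le> t"
  shows "(\<E> \<omega>. intensity t \<omega> * excitation t \<omega>) = ennreal (cross t)" "cross t \<le> square_bound"
    "m2 t = base_intensity t * mn t + cross t"
proof -
  have le: "(\<E> \<omega>. intensity t \<omega> * excitation t \<omega>) \<le> (\<E> \<omega>. (intensity t \<omega>)\<^sup>2)"
    by (intro nn_integral_mono) (auto simp: power2_eq_square intensity_eq intro!: mult_left_mono)
  also note nn_square_intensity_le[OF t]
  finally have b: "(\<E> \<omega>. intensity t \<omega> * excitation t \<omega>) \<le> ennreal square_bound" .
  then have "(\<E> \<omega>. intensity t \<omega> * excitation t \<omega>) < \<infinity>" by (rule order_le_less_trans) simp
  then show eq: "(\<E> \<omega>. intensity t \<omega> * excitation t \<omega>) = ennreal (cross t)"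
    by (simp add: cross_def less_top)
  show "cross t \<le> square_bound" using b square_bound_nonneg unfolding eq by (simp add: ennreal_le_iff)
  have c0: "0 \<le> cross t" by (simp add: cross_def)
  have "ennreal (m2 t) = (\<E> \<omega>. ennreal (base_intensity t) * intensity t \<omega> + intensity t \<omega> * excitation t \<omega>)"
    unfolding nn_integral_intensity_power2[OF t, symmetric]
  proof (rule nn_integral_cong)
    fix \<omega>
    have "(intensity t \<omega>)\<^sup>2 = intensity t \<omega> * (ennreal (base_intensity t) + excitation t \<omega>)"
      by (simp only: power2_eq_square intensity_eq)
    then show "(intensity t \<omega>)\<^sup>2 = ennreal (base_intensity t) * intensity t \<omega> + intensity t \<omega> * excitation t \<omega>"
      by (simp only: distrib_left mult.commute)
  qed
  also have "\<dots> = ennreal (base_intensity t) * ennreal (mn t) + ennreal (cross t)"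
    unfolding eq[symmetric] nn_integral_intensity[OF t, symmetric] by (simp add: nn_integral_add nn_integral_cmult)
  also have "\<dots> = ennreal (base_intensity t * mn t + cross t)"
    using base_intensity_nonneg c0 mn_bounds[OF t] by (simp add: ennreal_mult'[symmetric] ennreal_plus[symmetric] del: ennreal_plus)
  finally show "m2 t = base_intensity t * mn t + cross t"
    using base_intensity_nonneg c0 mn_bounds[OF t] by (subst (asm) ennreal_inj) (auto simp: second_moment_def)
qed

lemma tame_cross: "tame cross"
proof (rule tame_of_nn[where J="\<lambda>t. \<E> \<omega>. intensity t \<omega> * excitation t \<omega>"])
  have "(\<lambda>(\<omega>, s). intensity s \<omega> * excitation s \<omega>) \<in> borel_measurable (Q \<Otimes>\<^sub>M borel)" by measurable
  from measurable_nn_expectation[OF this]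
  show "(\<lambda>t. (\<E> \<omega>. intensity t \<omega> * excitation t \<omega>) * indicator {0..} t) \<in> borel_measurable borel" by measurable
  show "\<exists>C. \<forall>s\<in>{0..t}. cross s \<le> C" for t
    using nn_integral_cross(2) by (intro exI[of _ square_bound]) auto
  show "0 \<le> cross s" for s by (simp add: cross_def)
qed (rule nn_integral_cross(1))

lemma tame_base: "tame base_intensity"
proof (rule tame_continuous)
  show "continuous_on UNIV base_intensity" unfolding base_intensity_def by (intro continuous_intros)
qed (rule base_intensity_nonneg)

lemmas tame_intros = tame_add tame_mult tame_mn tame_cross tame_base tame_exp tame_const

lemma measurable_mark_kernel [measurable]:
  "g \<in> borel_measurable Rplus \<Longrightarrow> (\<lambda>(s, z). ennreal (g z)) \<in> borel_measurable (borel \<Otimes>\<^sub>M Rplus)"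
  by (simp add: split_beta')

lemma mult_exp_integral:
  fixes b t :: real and g :: "real \<Rightarrow> real"
  shows "exp (- b * t) * integral {0..t} (\<lambda>s. exp (b * s) * g s) = integral {0..t} (\<lambda>s. exp (- b * (t - s)) * g s)"
proof -
  have "exp (- b * (t - s)) = exp (- b * t) * exp (b * s)" for s
    by (subst exp_add[symmetric]) (simp add: algebra_simps)
  then have "(\<lambda>s. exp (- b * (t - s)) * g s) = (\<lambda>s. exp (- b * t) * (exp (b * s) * g s))"
    by (simp add: mult.assoc fun_eq_iff)
  then show ?thesis by simp
qed

lemma intensity_split_expectation:
  assumes [measurable]: "Y \<in> borel_measurable Q"
  shows "(\<E> \<omega>. intensity t \<omega> * Y \<omega>) = ennreal (base_intensity t) * (\<E> \<omega>. Y \<omega>) + (\<E> \<omega>. excitation t \<omega> * Y \<omega>)"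
  unfolding intensity_eq distrib_right by (simp add: nn_integral_add nn_integral_cmult)

text \<open>
  Campbell's formula for the sum of the undiscounted jumps.
\<close>

lemma mean_equation:
  assumes t: "0 \<le> t"
  shows "mn t = base_intensity t + exp (- \<beta> * t) * integral {0..t} (\<lambda>s. exp (\<beta> * s) * (branching * mn s))"
proof -
  have tm: "tame (\<lambda>s. exp (\<beta> * s) * (branching * mn s))"
    by (intro tame_intros branching_nonneg)
  have "(\<E> \<omega>. jump_sum intensity_kernel t \<omega>)
      = (\<integral>\<^sup>+ s\<in>{0..t}. (\<integral>\<^sup>+ z. intensity_kernel (s, z) \<partial>\<Theta>) * (\<E> \<omega>. intensity s \<omega> * 1) \<partial>lborel)"
    using campbell_formula[of "\<lambda>_. 1" intensity_kernel t] by simp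
  also have "\<dots> = ennreal (integral {0..t} (\<lambda>s. exp (\<beta> * s) * (branching * mn s)))"
  proof (rule tame_nn_integral_eq[OF tm t])
    fix s assume "s \<in> {0..t}"
    then show "(\<integral>\<^sup>+ z. intensity_kernel (s, z) \<partial>\<Theta>) * (\<E> \<omega>. intensity s \<omega> * 1) = ennreal (exp (\<beta> * s) * (branching * mn s))"
      using branching_nonneg by (simp add: nn_integral_intensity_kernel nn_integral_intensity ennreal_mult'[symmetric] mult.assoc)
  qed
  finally have J: "(\<E> \<omega>. jump_sum intensity_kernel t \<omega>) = ennreal (integral {0..t} (\<lambda>s. exp (\<beta> * s) * (branching * mn s)))" .
  have "ennreal (mn t) = (\<E> \<omega>. ennreal (base_intensity t) + ennreal (exp (- \<beta> * t)) * jump_sum intensity_kernel t \<omega>)"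
    unfolding nn_integral_intensity[OF t, symmetric] intensity_def ..
  also have "\<dots> = ennreal (base_intensity t) + ennreal (exp (- \<beta> * t)) * (\<E> \<omega>. jump_sum intensity_kernel t \<omega>)"
    by (simp add: nn_integral_add nn_integral_cmult emeasure_space_1)
  also have "\<dots> = ennreal (base_intensity t + exp (- \<beta> * t) * integral {0..t} (\<lambda>s. exp (\<beta> * s) * (branching * mn s)))"
    unfolding J using base_intensity_nonneg tame_integral_nonneg[OF tm t]
    by (simp add: ennreal_mult'[symmetric] ennreal_plus[symmetric] del: ennreal_plus)
  finally show ?thesis
    using base_intensity_nonneg tame_integral_nonneg[OF tm t] mn_bounds[OF t] by (subst (asm) ennreal_inj) auto
qed

lemma jump_sum_product_expectation:
  assumes v: "v \<in> borel_measurable (borel \<Otimes>\<^sub>M Rplus)" and w: "w \<in> borel_measurable (borel \<Otimes>\<^sub>M Rplus)"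
  shows "(\<E> \<omega>. jump_sum v t \<omega> * jump_sum w t \<omega>) =
    (\<integral>\<^sup>+ s\<in>{0..t}. (\<integral>\<^sup>+ z. v (s, z) * w (s, z) \<partial>\<Theta>) * (\<E> \<omega>. intensity s \<omega>)
       + (\<integral>\<^sup>+ z. v (s, z) \<partial>\<Theta>) * (\<E> \<omega>. intensity s \<omega> * jump_sum w s \<omega>)
       + (\<integral>\<^sup>+ z. w (s, z) \<partial>\<Theta>) * (\<E> \<omega>. intensity s \<omega> * jump_sum v s \<omega>) \<partial>lborel)"
proof -
  have "(\<E> \<omega>. jump_sum v t \<omega> * jump_sum w t \<omega>) = (\<E> \<omega>. jump_sum (\<lambda>(s, z). 1 *
         (v (s, z) * w (s, z) + v (s, z) * jump_sum w s \<omega> + w (s, z) * jump_sum v s \<omega>)) t \<omega>)"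
    by (rule nn_integral_cong_AE) (use AE_regular_path in \<open>auto elim!: eventually_mono simp: jump_sum_mult\<close>)
  also note campbell_product[of "\<lambda>_. 1", OF _ v w]
  finally show ?thesis by simp
qed

text \<open>
  The left-hand side is the second moment of the excitation, which \<open>jump_sum_product_expectation\<close>
  expresses through the moments at earlier times.
\<close>

lemma second_moment_equation:
  assumes t: "0 \<le> t"
  shows "m2 t - 2 * base_intensity t * mn t + (base_intensity t)\<^sup>2
     = exp (- (2 * \<beta>) * t) * integral {0..t} (\<lambda>s. exp (2 * \<beta> * s) * (branching2 * mn s + 2 * branching * cross s))"
proof -
  have tm: "tame (\<lambda>s. exp (2 * \<beta> * s) * (branching2 * mn s + 2 * branching * cross s))"
    by (intro tame_intros branching2_nonneg) (use branching_nonneg in auto)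
  have "(\<E> \<omega>. jump_sum intensity_kernel t \<omega> * jump_sum intensity_kernel t \<omega>)
      = ennreal (integral {0..t} (\<lambda>s. exp (2 * \<beta> * s) * (branching2 * mn s + 2 * branching * cross s)))"
    unfolding jump_sum_product_expectation[OF intensity_kernel_measurable intensity_kernel_measurable]
  proof (rule tame_nn_integral_eq[OF tm t])
    fix s assume s: "s \<in> {0..t}"
    then have "(\<E> \<omega>. intensity s \<omega> * jump_sum intensity_kernel s \<omega>) = ennreal (exp (\<beta> * s)) * ennreal (cross s)"
      unfolding jump_sum_kernel_eq by (simp add: mult.left_commute nn_integral_cmult nn_integral_cross)
    moreover have "exp (2 * \<beta> * s) = exp (\<beta> * s) * exp (\<beta> * s)" by (simp add: mult_exp_exp)
    moreover have "0 \<le> cross s" "0 \<le> mn s" using s mn_bounds by (auto simp: cross_def)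
    ultimately show "(\<integral>\<^sup>+ z. intensity_kernel (s, z) * intensity_kernel (s, z) \<partial>\<Theta>) * (\<E> \<omega>. intensity s \<omega>)
       + (\<integral>\<^sup>+ z. intensity_kernel (s, z) \<partial>\<Theta>) * (\<E> \<omega>. intensity s \<omega> * jump_sum intensity_kernel s \<omega>)
       + (\<integral>\<^sup>+ z. intensity_kernel (s, z) \<partial>\<Theta>) * (\<E> \<omega>. intensity s \<omega> * jump_sum intensity_kernel s \<omega>)
       = ennreal (exp (2 * \<beta> * s) * (branching2 * mn s + 2 * branching * cross s))"
      using branching_nonneg branching2_nonneg s
      by (simp add: nn_integral_intensity_kernel nn_integral_intensity_kernel_power2 nn_integral_intensity
          ennreal_mult'[symmetric] ennreal_plus[symmetric] algebra_simps del: ennreal_plus)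
  qed
  then have E2: "(\<E> \<omega>. (excitation t \<omega>)\<^sup>2) = ennreal (exp (- (2 * \<beta>) * t) * integral {0..t} (\<lambda>s. exp (2 * \<beta> * s) * (branching2 * mn s + 2 * branching * cross s)))"
    unfolding excitation_square_eq by (simp add: nn_integral_cmult ennreal_mult'[symmetric])
  have E1: "ennreal (mn t) = ennreal (base_intensity t) + (\<E> \<omega>. excitation t \<omega>)"
    unfolding nn_integral_intensity[OF t, symmetric] intensity_eq by (simp add: nn_integral_add emeasure_space_1)
  have E12: "ennreal (cross t) = ennreal (base_intensity t) * (\<E> \<omega>. excitation t \<omega>) + (\<E> \<omega>. (excitation t \<omega>)\<^sup>2)"
    using intensity_split_expectation[of "excitation t" t] nn_integral_cross(1)[OF t] by (simp add: power2_eq_square)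
  obtain e where e: "(\<E> \<omega>. excitation t \<omega>) = ennreal e" "0 \<le> e"
    using E1 by (cases "\<E> \<omega>. excitation t \<omega>") auto
  note nn = base_intensity_nonneg[of t] mn_bounds(1)[OF t] e(2) tame_integral_nonneg[OF tm t]
  have "mn t = base_intensity t + e"
    using E1 nn unfolding e by (simp add: ennreal_plus[symmetric] del: ennreal_plus)
  moreover have "cross t = base_intensity t * e + exp (- (2 * \<beta>) * t) * integral {0..t} (\<lambda>s. exp (2 * \<beta> * s) * (branching2 * mn s + 2 * branching * cross s))"
  proof -
    have "ennreal (cross t) = ennreal (base_intensity t * e + exp (- (2 * \<beta>) * t) * integral {0..t} (\<lambda>s. exp (2 * \<beta> * s) * (branching2 * mn s + 2 * branching * cross s)))"
      unfolding E12 e E2 using nn by (simp add: ennreal_mult'[symmetric] ennreal_plus[symmetric] del: ennreal_plus)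
    then show ?thesis using nn by (subst (asm) ennreal_inj) (auto simp: cross_def)
  qed
  ultimately show ?thesis
    using nn_integral_cross(3)[OF t] by (simp add: power2_eq_square algebra_simps)
qed

end

section \<open>Moments of the retained claims\<close>

context marked_hawkes_model begin

text \<open>
  The parts of a claim that an insurer may keep. The bounds hold at every mark, not only almost everywhere, so
  that they can be used on each path.
\<close>

definition claim_functions :: "(real \<Rightarrow> real) set" where
  "claim_functions = {\<eta> \<in> borel_measurable Rplus. \<forall>z\<ge>0. 0 \<le> \<eta> z \<and> \<eta> z \<le> z}"

lemma claim_measurable: "\<eta> \<in> claim_functions \<Longrightarrow> \<eta> \<in> borel_measurable Rplus"
  and claim_nonneg: "\<eta> \<in> claim_functions \<Longrightarrow> 0 \<le> z \<Longrightarrow> 0 \<le> \<eta> z"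
  and claim_le: "\<eta> \<in> claim_functions \<Longrightarrow> 0 \<le> z \<Longrightarrow> \<eta> z \<le> z"
  by (auto simp: claim_functions_def)

lemma integrable_claim:
  assumes \<eta>: "\<eta> \<in> claim_functions"
  shows "integrable \<Theta> \<eta>" "integrable \<Theta> (\<lambda>z. z * \<eta> z)" "integrable \<Theta> (\<lambda>z. (\<eta> z)\<^sup>2)"
proof -
  note [measurable] = claim_measurable[OF \<eta>]
  note b = claim_nonneg[OF \<eta>] claim_le[OF \<eta>]
  have "\<bar>\<eta> z\<bar> \<le> 1 * (1 + z + z\<^sup>2)" if "0 \<le> z" for z
    using b[OF that] zero_le_power2[of z] by (simp only: abs_of_nonneg mult_1)
  then show "integrable \<Theta> \<eta>" by (intro integrable_Theta_bound[where C=1]) simp_all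
  have sq: "z * \<eta> z \<le> z\<^sup>2" "(\<eta> z)\<^sup>2 \<le> z\<^sup>2" if "0 \<le> z" for z
    using b[OF that] that by (auto simp: power2_eq_square intro!: mult_mono)
  have "\<bar>z * \<eta> z\<bar> \<le> 1 * (1 + z + z\<^sup>2)" "\<bar>(\<eta> z)\<^sup>2\<bar> \<le> 1 * (1 + z + z\<^sup>2)" if "0 \<le> z" for z
    using sq[OF that] b[OF that] that by (simp_all add: abs_mult add_increasing)
  then show "integrable \<Theta> (\<lambda>z. z * \<eta> z)" "integrable \<Theta> (\<lambda>z. (\<eta> z)\<^sup>2)"
    by (intro integrable_Theta_bound[where C=1]; simp)+
qed

definition claims :: "(real \<Rightarrow> real) \<Rightarrow> real \<Rightarrow> 'a \<Rightarrow> ennreal" where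
  "claims \<eta> = jump_sum (\<lambda>(s, z). ennreal (\<eta> z))"

lemma measurable_claims_compose [measurable (raw)]:
  assumes [measurable]: "\<eta> \<in> borel_measurable Rplus" "f \<in> borel_measurable M" "g \<in> measurable M Q"
  shows "(\<lambda>x. claims \<eta> (f x) (g x)) \<in> borel_measurable M"
  unfolding claims_def by measurable

lemma nn_integral_claim:
  assumes \<eta>: "\<eta> \<in> claim_functions"
  shows "(\<integral>\<^sup>+ z. ennreal (\<eta> z) \<partial>\<Theta>) = ennreal (H_int \<Theta> \<eta>)" "0 \<le> H_int \<Theta> \<eta>"
    "(\<integral>\<^sup>+ z. ennreal (\<eta> z) * ennreal (\<eta> z) \<partial>\<Theta>) = ennreal (H_int \<Theta> (\<lambda>z. (\<eta> z)\<^sup>2))" "0 \<le> H_int \<Theta> (\<lambda>z. (\<eta> z)\<^sup>2)"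
    "(\<integral>\<^sup>+ z. ennreal (\<eta> z) * intensity_kernel (s, z) \<partial>\<Theta>) = ennreal (exp (\<beta> * s) * (\<Lambda> * H_int \<Theta> (\<lambda>z. z * \<eta> z)))"
    "0 \<le> H_int \<Theta> (\<lambda>z. z * \<eta> z)"
proof -
  note b = claim_nonneg[OF \<eta>] and int = integrable_claim[OF \<eta>]
  show "0 \<le> H_int \<Theta> \<eta>" "0 \<le> H_int \<Theta> (\<lambda>z. (\<eta> z)\<^sup>2)" "0 \<le> H_int \<Theta> (\<lambda>z. z * \<eta> z)"
    by (rule Bochner_Integration.integral_nonneg; simp add: b)+
  show "(\<integral>\<^sup>+ z. ennreal (\<eta> z) \<partial>\<Theta>) = ennreal (H_int \<Theta> \<eta>)"
    by (rule nn_integral_eq_integral[OF int(1)], rule AE_I2) (simp add: b)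
  have "(\<integral>\<^sup>+ z. ennreal (\<eta> z) * ennreal (\<eta> z) \<partial>\<Theta>) = (\<integral>\<^sup>+ z. ennreal ((\<eta> z)\<^sup>2) \<partial>\<Theta>)"
    using b by (intro nn_integral_cong) (simp add: ennreal_mult'[symmetric] power2_eq_square)
  also have "\<dots> = ennreal (H_int \<Theta> (\<lambda>z. (\<eta> z)\<^sup>2))"
    by (rule nn_integral_eq_integral[OF int(3)]) simp
  finally show "(\<integral>\<^sup>+ z. ennreal (\<eta> z) * ennreal (\<eta> z) \<partial>\<Theta>) = ennreal (H_int \<Theta> (\<lambda>z. (\<eta> z)\<^sup>2))" .
  have "(\<integral>\<^sup>+ z. ennreal (\<eta> z) * intensity_kernel (s, z) \<partial>\<Theta>) = (\<integral>\<^sup>+ z. ennreal (exp (\<beta> * s) * (\<Lambda> * (z * \<eta> z))) \<partial>\<Theta>)"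
    using b by (intro nn_integral_cong) (simp add: intensity_kernel_def ennreal_mult'[symmetric] mult_ac)
  also have "\<dots> = ennreal (\<integral>z. exp (\<beta> * s) * (\<Lambda> * (z * \<eta> z)) \<partial>\<Theta>)"
    by (rule nn_integral_eq_integral, use int in simp, rule AE_I2) (use Lambda_pos in \<open>simp add: b\<close>)
  finally show "(\<integral>\<^sup>+ z. ennreal (\<eta> z) * intensity_kernel (s, z) \<partial>\<Theta>) = ennreal (exp (\<beta> * s) * (\<Lambda> * H_int \<Theta> (\<lambda>z. z * \<eta> z)))"
    by simp
qed

lemma nn_expected_claims:
  assumes \<eta>: "\<eta> \<in> claim_functions" and t: "0 \<le> t"
  shows "(\<E> \<omega>. claims \<eta> t \<omega>) = ennreal (H_int \<Theta> \<eta> * integral {0..t} mn)"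
proof -
  note [measurable] = claim_measurable[OF \<eta>]
  have tm: "tame (\<lambda>s. H_int \<Theta> \<eta> * mn s)"
    by (intro tame_intros nn_integral_claim(2)[OF \<eta>])
  have "(\<E> \<omega>. claims \<eta> t \<omega>)
      = (\<integral>\<^sup>+ s\<in>{0..t}. (\<integral>\<^sup>+ z. ennreal (\<eta> z) \<partial>\<Theta>) * (\<E> \<omega>. intensity s \<omega> * 1) \<partial>lborel)"
    using campbell_formula[of "\<lambda>_. 1" "\<lambda>(s, z). ennreal (\<eta> z)" t] by (simp add: claims_def)
  also have "\<dots> = ennreal (integral {0..t} (\<lambda>s. H_int \<Theta> \<eta> * mn s))"
  proof (rule tame_nn_integral_eq[OF tm t])
    fix s assume "s \<in> {0..t}"
    then show "(\<integral>\<^sup>+ z. ennreal (\<eta> z) \<partial>\<Theta>) * (\<E> \<omega>. intensity s \<omega> * 1) = ennreal (H_int \<Theta> \<eta> * mn s)"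
      by (simp add: nn_integral_claim[OF \<eta>] nn_integral_intensity ennreal_mult'[symmetric])
  qed
  finally show ?thesis by simp
qed

definition claims_cross :: "(real \<Rightarrow> real) \<Rightarrow> real \<Rightarrow> real" where
  "claims_cross \<eta> t = enn2real (\<E> \<omega>. intensity t \<omega> * claims \<eta> t \<omega>)"

text \<open>
  A retained claim is at most its mark, and up to time \<open>t\<close> the excitation has discounted that mark by
  at most \<open>exp (- \<beta> * t)\<close>. So the mixed moment of intensity and claims is finite.
\<close>

lemma claims_le_excitation:
  assumes \<eta>: "\<eta> \<in> claim_functions" and \<omega>: "\<omega> \<in> space Q"
  shows "claims \<eta> t \<omega> \<le> ennreal (exp (\<beta> * t) / \<Lambda>) * excitation t \<omega>"
proof -
  have "claims \<eta> t \<omega> \<le> (\<Sum>i. ennreal (1 / \<Lambda>) * (if \<tau> i \<omega> < ennreal t then intensity_kernel (enn2real (\<tau> i \<omega>), Z i \<omega>) else 0))"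
    unfolding claims_def jump_sum_def
  proof (intro suminf_le summableI)
    fix i
    have "\<eta> (Z i \<omega>) \<le> 1 / \<Lambda> * (exp (\<beta> * enn2real (\<tau> i \<omega>)) * (\<Lambda> * Z i \<omega>))"
    proof -
      have "\<eta> (Z i \<omega>) \<le> 1 * Z i \<omega>" using claim_le[OF \<eta> Z_nonneg[OF \<omega>]] by simp
      also have "\<dots> \<le> exp (\<beta> * enn2real (\<tau> i \<omega>)) * Z i \<omega>"
        using beta_pos Z_nonneg[OF \<omega>] by (intro mult_right_mono) auto
      finally show ?thesis using Lambda_pos by simp
    qed
    then have "ennreal (\<eta> (Z i \<omega>)) \<le> ennreal (1 / \<Lambda>) * ennreal (exp (\<beta> * enn2real (\<tau> i \<omega>)) * (\<Lambda> * Z i \<omega>))"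
      using Lambda_pos by (subst ennreal_mult'[symmetric]) (auto intro: ennreal_leI)
    then show "(if \<tau> i \<omega> < ennreal t then case (enn2real (\<tau> i \<omega>), Z i \<omega>) of (s, z) \<Rightarrow> ennreal (\<eta> z) else 0)
      \<le> ennreal (1 / \<Lambda>) * (if \<tau> i \<omega> < ennreal t then intensity_kernel (enn2real (\<tau> i \<omega>), Z i \<omega>) else 0)"
      by (simp add: intensity_kernel_def)
  qed
  also have "\<dots> = ennreal (1 / \<Lambda>) * jump_sum intensity_kernel t \<omega>"
    unfolding jump_sum_def by (rule ennreal_suminf_cmult)
  also have "\<dots> = ennreal (exp (\<beta> * t) / \<Lambda>) * excitation t \<omega>"
    unfolding jump_sum_kernel_eq using Lambda_pos
    by (simp add: mult.assoc[symmetric] ennreal_mult'[symmetric])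
  finally show ?thesis .
qed

lemma nn_claims_cross:
  assumes \<eta>: "\<eta> \<in> claim_functions" and t: "0 \<le> t"
  shows "(\<E> \<omega>. intensity t \<omega> * claims \<eta> t \<omega>) = ennreal (claims_cross \<eta> t)"
    "claims_cross \<eta> t \<le> exp (\<beta> * t) / \<Lambda> * square_bound"
proof -
  have "(\<E> \<omega>. intensity t \<omega> * claims \<eta> t \<omega>) \<le> (\<E> \<omega>. ennreal (exp (\<beta> * t) / \<Lambda>) * (intensity t \<omega> * excitation t \<omega>))"
    by (intro nn_integral_mono, subst mult.left_commute, rule mult_left_mono)
      (use claims_le_excitation[OF \<eta>] in simp_all)
  also have "\<dots> = ennreal (exp (\<beta> * t) / \<Lambda>) * ennreal (cross t)"
    by (simp add: nn_integral_cmult nn_integral_cross[OF t])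
  also have "\<dots> = ennreal (exp (\<beta> * t) / \<Lambda> * cross t)"
    using Lambda_pos by (intro ennreal_mult'[symmetric]) auto
  finally have le: "(\<E> \<omega>. intensity t \<omega> * claims \<eta> t \<omega>) \<le> ennreal (exp (\<beta> * t) / \<Lambda> * cross t)" .
  then have "(\<E> \<omega>. intensity t \<omega> * claims \<eta> t \<omega>) < \<infinity>" by (rule order_le_less_trans) simp
  then show eq: "(\<E> \<omega>. intensity t \<omega> * claims \<eta> t \<omega>) = ennreal (claims_cross \<eta> t)"
    by (simp add: claims_cross_def less_top)
  have "0 \<le> exp (\<beta> * t) / \<Lambda> * cross t" using Lambda_pos by (simp add: cross_def)
  then have "claims_cross \<eta> t \<le> exp (\<beta> * t) / \<Lambda> * cross t" using le unfolding eq by (simp add: ennreal_le_iff)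
  also have "\<dots> \<le> exp (\<beta> * t) / \<Lambda> * square_bound"
    using Lambda_pos nn_integral_cross[OF t] by (intro mult_left_mono) auto
  finally show "claims_cross \<eta> t \<le> exp (\<beta> * t) / \<Lambda> * square_bound" .
qed

lemma tame_claims_cross:
  assumes \<eta>: "\<eta> \<in> claim_functions" shows "tame (claims_cross \<eta>)"
proof (rule tame_of_nn[where J="\<lambda>t. \<E> \<omega>. intensity t \<omega> * claims \<eta> t \<omega>"])
  note [measurable] = claim_measurable[OF \<eta>]
  have "(\<lambda>(\<omega>, s). intensity s \<omega> * claims \<eta> s \<omega>) \<in> borel_measurable (Q \<Otimes>\<^sub>M borel)" by measurable
  from measurable_nn_expectation[OF this]
  show "(\<lambda>t. (\<E> \<omega>. intensity t \<omega> * claims \<eta> t \<omega>) * indicator {0..} t) \<in> borel_measurable borel" by measurable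
  show "0 \<le> claims_cross \<eta> s" for s by (simp add: claims_cross_def)
  show "\<exists>C. \<forall>s\<in>{0..t}. claims_cross \<eta> s \<le> C" for t
  proof (intro exI ballI)
    fix s assume s: "s \<in> {0..t}"
    then have "claims_cross \<eta> s \<le> exp (\<beta> * s) / \<Lambda> * square_bound" using nn_claims_cross(2)[OF \<eta>] by simp
    also have "\<dots> \<le> exp (\<beta> * t) / \<Lambda> * square_bound"
    proof (intro mult_right_mono divide_right_mono)
      show "0 \<le> square_bound" by (rule square_bound_nonneg)
    qed (use s beta_pos Lambda_pos in auto)
    finally show "claims_cross \<eta> s \<le> exp (\<beta> * t) / \<Lambda> * square_bound" .
  qed
qed (rule nn_claims_cross(1)[OF \<eta>])

text \<open>
  The product formula for the claims and the undiscounted excitation.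
\<close>

lemma claims_cross_equation:
  assumes \<eta>: "\<eta> \<in> claim_functions" and t: "0 \<le> t"
  shows "claims_cross \<eta> t = base_intensity t * (H_int \<Theta> \<eta> * integral {0..t} mn)
     + exp (- \<beta> * t) * integral {0..t} (\<lambda>s. exp (\<beta> * s) *
         (\<Lambda> * H_int \<Theta> (\<lambda>z. z * \<eta> z) * mn s + H_int \<Theta> \<eta> * cross s + branching * claims_cross \<eta> s))"
proof -
  note [measurable] = claim_measurable[OF \<eta>]
  have tm: "tame (\<lambda>s. exp (\<beta> * s) *
         (\<Lambda> * H_int \<Theta> (\<lambda>z. z * \<eta> z) * mn s + H_int \<Theta> \<eta> * cross s + branching * claims_cross \<eta> s))"
    by (intro tame_intros tame_claims_cross \<eta> branching_nonneg nn_integral_claim(2)[OF \<eta>] mult_nonneg_nonneg nn_integral_claim(6)[OF \<eta>])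
       (use Lambda_pos in simp)
  let ?I = "integral {0..t} (\<lambda>s. exp (\<beta> * s) *
         (\<Lambda> * H_int \<Theta> (\<lambda>z. z * \<eta> z) * mn s + H_int \<Theta> \<eta> * cross s + branching * claims_cross \<eta> s))"
  have "(\<E> \<omega>. claims \<eta> t \<omega> * jump_sum intensity_kernel t \<omega>) = ennreal ?I"
    unfolding claims_def
    unfolding jump_sum_product_expectation[OF measurable_mark_kernel[OF claim_measurable[OF \<eta>]] intensity_kernel_measurable]
    unfolding claims_def[symmetric]
  proof (rule tame_nn_integral_eq[OF tm t])
    fix s assume s: "s \<in> {0..t}"
    then have s0: "0 \<le> s" by simp
    from s have c: "(\<E> \<omega>. intensity s \<omega> * jump_sum intensity_kernel s \<omega>) = ennreal (exp (\<beta> * s)) * ennreal (cross s)"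
      unfolding jump_sum_kernel_eq by (simp add: mult.left_commute nn_integral_cmult nn_integral_cross)
    have nn: "0 \<le> cross s" "0 \<le> mn s" "0 \<le> claims_cross \<eta> s" using s mn_bounds by (auto simp: cross_def claims_cross_def)
    show "(\<integral>\<^sup>+ z. (case (s, z) of (s, z) \<Rightarrow> ennreal (\<eta> z)) * intensity_kernel (s, z) \<partial>\<Theta>) * (\<E> \<omega>. intensity s \<omega>)
       + (\<integral>\<^sup>+ z. (case (s, z) of (s, z) \<Rightarrow> ennreal (\<eta> z)) \<partial>\<Theta>) * (\<E> \<omega>. intensity s \<omega> * jump_sum intensity_kernel s \<omega>)
       + (\<integral>\<^sup>+ z. intensity_kernel (s, z) \<partial>\<Theta>) * (\<E> \<omega>. intensity s \<omega> * claims \<eta> s \<omega>)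
       = ennreal (exp (\<beta> * s) * (\<Lambda> * H_int \<Theta> (\<lambda>z. z * \<eta> z) * mn s + H_int \<Theta> \<eta> * cross s + branching * claims_cross \<eta> s))"
      unfolding prod.case nn_integral_claim(1,5)[OF \<eta>] c nn_integral_intensity_kernel
        nn_integral_intensity[OF s0] nn_claims_cross(1)[OF \<eta> s0]
      using nn branching_nonneg nn_integral_claim(2,6)[OF \<eta>] Lambda_pos
      by (simp add: ennreal_mult'[symmetric] ennreal_plus[symmetric] distrib_left mult_ac del: ennreal_plus)
  qed
  then have E: "(\<E> \<omega>. excitation t \<omega> * claims \<eta> t \<omega>) = ennreal (exp (- \<beta> * t) * ?I)"
    unfolding excitation_def by (simp add: mult.assoc mult.commute[of "jump_sum _ _ _"] nn_integral_cmult ennreal_mult'[symmetric])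
  have nn: "0 \<le> integral {0..t} mn" "0 \<le> ?I" "0 \<le> claims_cross \<eta> t"
    using tame_integral_nonneg[OF tame_mn t] tame_integral_nonneg[OF tm t] by (auto simp: claims_cross_def)
  have "ennreal (claims_cross \<eta> t) = ennreal (base_intensity t * (H_int \<Theta> \<eta> * integral {0..t} mn) + exp (- \<beta> * t) * ?I)"
    using intensity_split_expectation[of "claims \<eta> t" t] nn_claims_cross(1)[OF \<eta> t] nn base_intensity_nonneg nn_integral_claim(2)[OF \<eta>]
    unfolding E nn_expected_claims[OF \<eta> t]
    by (simp add: ennreal_mult'[symmetric] ennreal_plus[symmetric] del: ennreal_plus)
  then show ?thesis
    using nn base_intensity_nonneg nn_integral_claim(2)[OF \<eta>] by (subst (asm) ennreal_inj) auto
qed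

lemma nn_expected_claims_square:
  assumes \<eta>: "\<eta> \<in> claim_functions" and t: "0 \<le> t"
  shows "(\<E> \<omega>. (claims \<eta> t \<omega>)\<^sup>2) = ennreal (H_int \<Theta> (\<lambda>z. (\<eta> z)\<^sup>2) * integral {0..t} mn
      + 2 * H_int \<Theta> \<eta> * integral {0..t} (claims_cross \<eta>))"
proof -
  have tm: "tame (\<lambda>s. H_int \<Theta> (\<lambda>z. (\<eta> z)\<^sup>2) * mn s + 2 * H_int \<Theta> \<eta> * claims_cross \<eta> s)"
    by (intro tame_intros tame_claims_cross \<eta> nn_integral_claim(4)[OF \<eta>] mult_nonneg_nonneg nn_integral_claim(2)[OF \<eta>]) simp
  have "(\<E> \<omega>. claims \<eta> t \<omega> * claims \<eta> t \<omega>) = ennreal (integral {0..t} (\<lambda>s. H_int \<Theta> (\<lambda>z. (\<eta> z)\<^sup>2) * mn s + 2 * H_int \<Theta> \<eta> * claims_cross \<eta> s))"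
    unfolding claims_def
    unfolding jump_sum_product_expectation[OF measurable_mark_kernel[OF claim_measurable[OF \<eta>]] measurable_mark_kernel[OF claim_measurable[OF \<eta>]]]
    unfolding claims_def[symmetric]
  proof (rule tame_nn_integral_eq[OF tm t])
    fix s assume s: "s \<in> {0..t}"
    then have s0: "0 \<le> s" by simp
    have nn: "0 \<le> mn s" "0 \<le> claims_cross \<eta> s" using s mn_bounds by (auto simp: claims_cross_def)
    show "(\<integral>\<^sup>+ z. (case (s, z) of (s, z) \<Rightarrow> ennreal (\<eta> z)) * (case (s, z) of (s, z) \<Rightarrow> ennreal (\<eta> z)) \<partial>\<Theta>) * (\<E> \<omega>. intensity s \<omega>)
       + (\<integral>\<^sup>+ z. (case (s, z) of (s, z) \<Rightarrow> ennreal (\<eta> z)) \<partial>\<Theta>) * (\<E> \<omega>. intensity s \<omega> * claims \<eta> s \<omega>)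
       + (\<integral>\<^sup>+ z. (case (s, z) of (s, z) \<Rightarrow> ennreal (\<eta> z)) \<partial>\<Theta>) * (\<E> \<omega>. intensity s \<omega> * claims \<eta> s \<omega>)
       = ennreal (H_int \<Theta> (\<lambda>z. (\<eta> z)\<^sup>2) * mn s + 2 * H_int \<Theta> \<eta> * claims_cross \<eta> s)"
      unfolding prod.case nn_integral_claim(1,3)[OF \<eta>] nn_integral_intensity[OF s0] nn_claims_cross(1)[OF \<eta> s0]
      using nn nn_integral_claim(2,4)[OF \<eta>]
      by (simp add: ennreal_mult'[symmetric] ennreal_plus[symmetric] distrib_left mult_ac del: ennreal_plus)
  qed
  also have "integral {0..t} (\<lambda>s. H_int \<Theta> (\<lambda>z. (\<eta> z)\<^sup>2) * mn s + 2 * H_int \<Theta> \<eta> * claims_cross \<eta> s)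
     = H_int \<Theta> (\<lambda>z. (\<eta> z)\<^sup>2) * integral {0..t} mn + 2 * H_int \<Theta> \<eta> * integral {0..t} (claims_cross \<eta>)"
    using tame_integrable_on[OF tame_mn t] tame_integrable_on[OF tame_claims_cross[OF \<eta>] t]
    by (subst integral_add) (auto intro!: integrable_on_mult_right)
  finally show ?thesis by (simp add: power2_eq_square)
qed

end

section \<open>The coefficients of the variance\<close>

text \<open>
  The solution of \<open>x' = g - b * x\<close> that starts at \<open>0\<close>.
\<close>

definition exp_conv :: "real \<Rightarrow> (real \<Rightarrow> real) \<Rightarrow> real \<Rightarrow> real" where
  "exp_conv b g t = exp (- b * t) * integral {0..t} (\<lambda>s. exp (b * s) * g s)"

lemma exp_conv_0 [simp]: "exp_conv b g 0 = 0"
  by (simp add: exp_conv_def)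

lemma continuous_on_exp_conv:
  assumes "tame g" "0 \<le> T" shows "continuous_on {0..T} (exp_conv b g)"
  unfolding exp_conv_def
  by (intro continuous_intros indefinite_integral_continuous_1 tame_integrable_on tame_mult tame_exp assms)

lemma DERIV_exp_conv:
  assumes g: "continuous_on {0..T} g" and t: "t \<in> {0..T}"
  shows "(exp_conv b g has_real_derivative g t - b * exp_conv b g t) (at t within {0..T})"
proof -
  have "((\<lambda>t. integral {0..t} (\<lambda>s. exp (b * s) * g s)) has_real_derivative exp (b * t) * g t) (at t within {0..T})"
    using t by (intro integral_has_real_derivative continuous_intros g) auto
  moreover have "exp (b * t) * exp (- (b * t)) = 1" by (simp add: exp_minus)
  ultimately show ?thesis
    unfolding exp_conv_def
    by (auto intro!: derivative_eq_intros simp: algebra_simps)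
qed

lemma zero_of_zero_derivative:
  fixes x :: "real \<Rightarrow> real"
  assumes "\<And>t. t \<in> {0..T} \<Longrightarrow> (x has_real_derivative 0) (at t within {0..T})" "x 0 = 0" "t \<in> {0..T}"
  shows "x t = 0"
  using ode_zero[of T x 0 t] assms by simp

lemma integral_pos_continuous:
  fixes g :: "real \<Rightarrow> real"
  assumes g: "continuous_on {0..T} g" "\<And>s. s \<in> {0..T} \<Longrightarrow> 0 \<le> g s"
    and s: "s \<in> {0..T}" "g s \<noteq> 0" and T: "0 < T"
  shows "0 < integral {0..T} g"
proof -
  have nn: "0 \<le> integral {0..T} g" by (intro integral_nonneg integrable_continuous_real g)
  have "integral {0..T} g \<noteq> 0"
  proof
    assume "integral {0..T} g = 0"
    then have "(g has_integral 0) (cbox 0 T)"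
      using integrable_integral[OF integrable_continuous_real[OF g(1)]] by simp
    then have "g s = 0"
      using has_integral_0_cbox_imp_0[of 0 T g s] g s T by auto
    with s show False by simp
  qed
  with nn show ?thesis by simp
qed

context marked_hawkes_model begin

context
  fixes T :: real assumes T: "0 < T"
begin

private lemma T0: "0 \<le> T" using T by simp

private abbreviation "\<delta> \<equiv> \<beta> - branching"
private abbreviation "cm t \<equiv> integral {0..t} mn"

private lemma delta_pos: "0 < \<delta>" using branching_less by simp

lemma mean_intensity_eq: "0 \<le> t \<Longrightarrow> mn t = base_intensity t + exp_conv \<beta> (\<lambda>s. branching * mn s) t"
  using mean_equation unfolding exp_conv_def by simp

lemma mean_intensity_0: "mn 0 = lam0"
  using mean_intensity_eq[of 0] by (simp add: base_intensity_def)

lemma mean_intensity_pos: "0 \<le> t \<Longrightarrow> 0 < mn t"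
proof -
  assume t: "0 \<le> t"
  have "tame (\<lambda>s. exp (\<beta> * s) * (branching * mn s))" by (intro tame_intros branching_nonneg)
  then have "0 \<le> exp_conv \<beta> (\<lambda>s. branching * mn s) t"
    unfolding exp_conv_def using t by (intro mult_nonneg_nonneg tame_integral_nonneg) auto
  then show "0 < mn t" using mean_intensity_eq[OF t] base_intensity_pos[of t] by simp
qed

lemma DERIV_base: "(base_intensity has_real_derivative \<beta> * (lbar - base_intensity t)) (at t within S)"
  unfolding base_intensity_def[abs_def] by (auto intro!: derivative_eq_intros simp: algebra_simps)

lemma continuous_on_base: "continuous_on S base_intensity"
  unfolding base_intensity_def[abs_def] by (intro continuous_intros)

private lemma continuous_mn: "continuous_on {0..T} mn"
proof -
  have "continuous_on {0..T} (\<lambda>t. base_intensity t + exp_conv \<beta> (\<lambda>s. branching * mn s) t)"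
    by (intro continuous_intros continuous_on_base continuous_on_exp_conv tame_intros branching_nonneg T0)
  then show ?thesis
    by (rule continuous_on_cong[THEN iffD1, rotated -1]) (auto simp: mean_intensity_eq)
qed

text \<open>
  Here the relaxation rate \<open>\<beta>\<close> is reduced to \<open>\<delta>\<close>: on average, the jumps
  counteract the decay.
\<close>

private lemma DERIV_mn:
  assumes t: "t \<in> {0..T}" shows "(mn has_real_derivative \<beta> * lbar - \<delta> * mn t) (at t within {0..T})"
proof -
  have "((\<lambda>t. base_intensity t + exp_conv \<beta> (\<lambda>s. branching * mn s) t) has_real_derivative
      \<beta> * (lbar - base_intensity t) + (branching * mn t - \<beta> * exp_conv \<beta> (\<lambda>s. branching * mn s) t)) (at t within {0..T})"
    by (intro DERIV_add DERIV_base DERIV_exp_conv continuous_intros continuous_mn t)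
  moreover have "\<beta> * (lbar - base_intensity t) + (branching * mn t - \<beta> * exp_conv \<beta> (\<lambda>s. branching * mn s) t) = \<beta> * lbar - \<delta> * mn t"
    using mean_intensity_eq[of t] t by (simp add: algebra_simps)
  ultimately show ?thesis
    using t by (auto simp: mean_intensity_eq intro: has_field_derivative_transform_within[where d=1 and f="\<lambda>t. base_intensity t + exp_conv \<beta> (\<lambda>s. branching * mn s) t"])
qed

private lemma DERIV_cm: "t \<in> {0..T} \<Longrightarrow> (cm has_real_derivative mn t) (at t within {0..T})"
  by (rule integral_has_real_derivative[OF continuous_mn])

private lemma continuous_cm: "continuous_on {0..T} cm"
  by (rule indefinite_integral_continuous_1[OF tame_integrable_on[OF tame_mn T0]])

private lemma m2_eq: "0 \<le> t \<Longrightarrow> m2 t = exp_conv (2 * \<beta>) (\<lambda>s. branching2 * mn s + 2 * branching * cross s) t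
    + 2 * base_intensity t * mn t - (base_intensity t)\<^sup>2"
  using second_moment_equation[of t] unfolding exp_conv_def by simp

lemma second_moment_0: "m2 0 = lam0\<^sup>2"
  using second_moment_equation[of 0] by (simp add: mean_intensity_0 base_intensity_def power2_eq_square)

private lemma tame_q: "tame (\<lambda>s. branching2 * mn s + 2 * branching * cross s)"
  by (intro tame_intros branching2_nonneg) (use branching_nonneg in auto)

private lemma continuous_m2: "continuous_on {0..T} m2"
proof -
  have "continuous_on {0..T} (\<lambda>t. exp_conv (2 * \<beta>) (\<lambda>s. branching2 * mn s + 2 * branching * cross s) t
    + 2 * base_intensity t * mn t - (base_intensity t)\<^sup>2)"
    by (intro continuous_intros continuous_on_base continuous_mn continuous_on_exp_conv tame_q T0)
  then show ?thesis
    by (rule continuous_on_cong[THEN iffD1, rotated -1]) (auto simp: m2_eq)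
qed

private lemma continuous_cross: "continuous_on {0..T} cross"
proof -
  have "continuous_on {0..T} (\<lambda>t. m2 t - base_intensity t * mn t)"
    by (intro continuous_intros continuous_on_base continuous_mn continuous_m2)
  then show ?thesis
    by (rule continuous_on_cong[THEN iffD1, rotated -1]) (auto simp: nn_integral_cross(3))
qed

private lemma DERIV_m2:
  assumes t: "t \<in> {0..T}"
  shows "(m2 has_real_derivative (branching2 + 2 * \<beta> * lbar) * mn t - 2 * \<delta> * m2 t) (at t within {0..T})"
proof -
  let ?q = "exp_conv (2 * \<beta>) (\<lambda>s. branching2 * mn s + 2 * branching * cross s)"
  let ?a = base_intensity
  have "((\<lambda>t. ?q t + 2 * ?a t * mn t - (?a t)\<^sup>2) has_real_derivative
      (branching2 * mn t + 2 * branching * cross t - 2 * \<beta> * ?q t)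
      + (2 * (\<beta> * (lbar - ?a t)) * mn t + (\<beta> * lbar - \<delta> * mn t) * (2 * ?a t))
      - 2 * ?a t * (\<beta> * (lbar - ?a t))) (at t within {0..T})"
    by (rule derivative_eq_intros DERIV_exp_conv DERIV_base DERIV_mn continuous_intros continuous_mn continuous_cross t refl)+
      (simp add: algebra_simps)
  also have "(branching2 * mn t + 2 * branching * cross t - 2 * \<beta> * ?q t)
      + (2 * (\<beta> * (lbar - ?a t)) * mn t + (\<beta> * lbar - \<delta> * mn t) * (2 * ?a t))
      - 2 * ?a t * (\<beta> * (lbar - ?a t)) = (branching2 + 2 * \<beta> * lbar) * mn t - 2 * \<delta> * m2 t"
  proof -
    have "?q t = m2 t - 2 * ?a t * mn t + (?a t)\<^sup>2" "cross t = m2 t - ?a t * mn t"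
      using m2_eq[of t] nn_integral_cross(3)[of t] t by auto
    then show ?thesis by (simp only:) (simp add: power2_eq_square algebra_simps)
  qed
  finally have "((\<lambda>t. ?q t + 2 * ?a t * mn t - (?a t)\<^sup>2) has_real_derivative
      (branching2 + 2 * \<beta> * lbar) * mn t - 2 * \<delta> * m2 t) (at t within {0..T})" .
  then show ?thesis
    using t by (auto simp: m2_eq intro: has_field_derivative_transform_within[where d=1 and f="\<lambda>t. ?q t + 2 * ?a t * mn t - (?a t)\<^sup>2"])
qed

private abbreviation "kap \<equiv> exp_conv \<delta> (\<lambda>s. \<beta> * lbar * cm s + m2 s)"
private abbreviation "E1 \<equiv> exp_conv \<delta> mn"
private abbreviation "E2 \<equiv> exp_conv (2 * \<delta>) mn"

private lemma DERIV_kap: "t \<in> {0..T} \<Longrightarrow> (kap has_real_derivative \<beta> * lbar * cm t + m2 t - \<delta> * kap t) (at t within {0..T})"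
  by (intro DERIV_exp_conv continuous_intros continuous_cm continuous_m2)

private lemma DERIV_E1: "t \<in> {0..T} \<Longrightarrow> (E1 has_real_derivative mn t - \<delta> * E1 t) (at t within {0..T})"
  by (intro DERIV_exp_conv continuous_mn)

private lemma DERIV_E2: "t \<in> {0..T} \<Longrightarrow> (E2 has_real_derivative mn t - 2 * \<delta> * E2 t) (at t within {0..T})"
  by (intro DERIV_exp_conv continuous_mn)

text \<open>
  Both sides solve \<open>x' = branching2 * mn - 2 * \<delta> * x\<close> with initial value \<open>0\<close>.
\<close>

private lemma variance_intensity: assumes t: "t \<in> {0..T}" shows "m2 t - (mn t)\<^sup>2 = branching2 * E2 t"
proof -
  have "(\<lambda>t. m2 t - (mn t)\<^sup>2 - branching2 * E2 t) t = 0"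
  proof (rule ode_zero[where c="- 2 * \<delta>", OF _ _ t])
    fix t assume t: "t \<in> {0..T}"
    show "((\<lambda>t. m2 t - (mn t)\<^sup>2 - branching2 * E2 t) has_real_derivative - 2 * \<delta> * (m2 t - (mn t)\<^sup>2 - branching2 * E2 t)) (at t within {0..T})"
      by (rule derivative_eq_intros DERIV_m2 DERIV_mn DERIV_E2 t refl)+ (simp add: power2_eq_square algebra_simps)
  qed (simp add: second_moment_0 mean_intensity_0)
  then show ?thesis by simp
qed

text \<open>
  The left-hand side is half the derivative of the coefficient \<open>A\<close> in the horizon. By
  \<open>variance_intensity\<close> both sides solve \<open>x' = branching2 * E2 - \<delta> * x\<close>.
\<close>

private lemma kap_eq: assumes t: "t \<in> {0..T}" shows "kap t - mn t * cm t = branching2 * (E1 t - E2 t) / \<delta>"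
proof -
  have "(\<lambda>t. kap t - mn t * cm t - branching2 * (E1 t - E2 t) / \<delta>) t = 0"
  proof (rule ode_zero[where c="- \<delta>", OF _ _ t])
    fix t assume t: "t \<in> {0..T}"
    have alg: "(b * c + (m * m + \<sigma> * e2) - d * k) - ((b - d * m) * c + m * m) - (\<sigma> * ((m - d * e1) - (m - 2 * d * e2))) / d
        = - d * (k - m * c - \<sigma> * (e1 - e2) / d)" if "0 < d" for b c d k m \<sigma> e1 e2 :: real
      using that by (simp add: field_simps)
    have v: "m2 t = (mn t)\<^sup>2 + branching2 * E2 t" using variance_intensity[OF t] by simp
    have "((\<lambda>t. kap t - mn t * cm t - branching2 * (E1 t - E2 t) / \<delta>) has_real_derivative
       (\<beta> * lbar * cm t + m2 t - \<delta> * kap t) - ((\<beta> * lbar - \<delta> * mn t) * cm t + mn t * mn t)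
        - (branching2 * ((mn t - \<delta> * E1 t) - (mn t - 2 * \<delta> * E2 t))) / \<delta>) (at t within {0..T})"
      by (intro DERIV_diff DERIV_mult DERIV_cdivide DERIV_cmult DERIV_kap DERIV_mn DERIV_cm DERIV_E1 DERIV_E2 t)
    also have "(\<beta> * lbar * cm t + m2 t - \<delta> * kap t) - ((\<beta> * lbar - \<delta> * mn t) * cm t + mn t * mn t)
        - (branching2 * ((mn t - \<delta> * E1 t) - (mn t - 2 * \<delta> * E2 t))) / \<delta>
       = - \<delta> * (kap t - mn t * cm t - branching2 * (E1 t - E2 t) / \<delta>)"
      unfolding v power2_eq_square by (rule alg[OF delta_pos])
    finally show "((\<lambda>t. kap t - mn t * cm t - branching2 * (E1 t - E2 t) / \<delta>) has_real_derivative
       - \<delta> * (kap t - mn t * cm t - branching2 * (E1 t - E2 t) / \<delta>)) (at t within {0..T})"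
      .
  qed simp
  then show ?thesis by simp
qed

private lemma continuous_kap: "continuous_on {0..T} kap"
  by (rule DERIV_continuous_on[OF DERIV_kap])

private lemma continuous_E1: "continuous_on {0..T} E1"
  by (rule DERIV_continuous_on[OF DERIV_E1])

lemma cum_mean_eq: "0 \<le> t \<Longrightarrow> cum_mean Q lam t = integral {0..t} mn"
  unfolding cum_mean_def by (rule tame_set_integral[OF tame_mn])

private lemma A_eq1: "A_coeff Q \<Theta> (\<lambda>z. \<Lambda> * z) \<beta> lbar lam T = 2 * integral {0..T} kap - (cm T)\<^sup>2"
proof -
  have inner: "(LINT s:{0..t}|lborel. exp (- (\<beta> - H_int \<Theta> (\<lambda>z. \<Lambda> * z)) * (t - s)) * (\<beta> * lbar * cum_mean Q lam s + m2 s)) = kap t"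
    if t: "t \<in> {0..T}" for t
  proof -
    have sub: "{0..t} \<subseteq> {0..T}" using t by auto
    have "(LINT s:{0..t}|lborel. exp (- (\<beta> - H_int \<Theta> (\<lambda>z. \<Lambda> * z)) * (t - s)) * (\<beta> * lbar * cum_mean Q lam s + m2 s))
       = (LINT s:{0..t}|lborel. exp (- \<delta> * (t - s)) * (\<beta> * lbar * cm s + m2 s))"
      by (intro set_lebesgue_integral_cong) (auto simp: branching_def cum_mean_eq)
    also have "\<dots> = integral {0..t} (\<lambda>s. exp (- \<delta> * (t - s)) * (\<beta> * lbar * cm s + m2 s))"
      by (intro set_borel_integral_eq_integral borel_integrable_atLeastAtMost' continuous_intros
          continuous_on_subset[OF continuous_cm sub] continuous_on_subset[OF continuous_m2 sub])
    also have "\<dots> = kap t" unfolding exp_conv_def by (rule mult_exp_integral[symmetric])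
    finally show ?thesis .
  qed
  have "(LINT t:{0..T}|lborel. (LINT s:{0..t}|lborel. exp (- (\<beta> - H_int \<Theta> (\<lambda>z. \<Lambda> * z)) * (t - s)) * (\<beta> * lbar * cum_mean Q lam s + m2 s)))
     = (LINT t:{0..T}|lborel. kap t)"
    by (rule set_lebesgue_integral_cong, simp, intro allI impI, rule inner)
  also have "\<dots> = integral {0..T} kap"
    by (intro set_borel_integral_eq_integral borel_integrable_atLeastAtMost' continuous_kap)
  finally show ?thesis unfolding A_coeff_def by (simp add: cum_mean_eq[OF T0])
qed

private lemma B_eq1: "B_coeff Q \<Theta> (\<lambda>z. \<Lambda> * z) \<beta> lam T = 2 * integral {0..T} E1"
proof -
  have inner: "(LINT s:{0..t}|lborel. exp (- (\<beta> - H_int \<Theta> (\<lambda>z. \<Lambda> * z)) * (t - s)) * mn s) = E1 t"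
    if t: "t \<in> {0..T}" for t
  proof -
    have sub: "{0..t} \<subseteq> {0..T}" using t by auto
    have "(LINT s:{0..t}|lborel. exp (- (\<beta> - H_int \<Theta> (\<lambda>z. \<Lambda> * z)) * (t - s)) * mn s)
       = integral {0..t} (\<lambda>s. exp (- \<delta> * (t - s)) * mn s)"
      unfolding branching_def[symmetric]
      by (intro set_borel_integral_eq_integral borel_integrable_atLeastAtMost' continuous_intros
          continuous_on_subset[OF continuous_mn sub])
    also have "\<dots> = E1 t" unfolding exp_conv_def by (rule mult_exp_integral[symmetric])
    finally show ?thesis .
  qed
  have "(LINT t:{0..T}|lborel. (LINT s:{0..t}|lborel. exp (- (\<beta> - H_int \<Theta> (\<lambda>z. \<Lambda> * z)) * (t - s)) * mn s))
     = (LINT t:{0..T}|lborel. E1 t)"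
    by (rule set_lebesgue_integral_cong, simp, intro allI impI, rule inner)
  also have "\<dots> = integral {0..T} E1"
    by (intro set_borel_integral_eq_integral borel_integrable_atLeastAtMost' continuous_E1)
  finally show ?thesis unfolding B_coeff_def by simp
qed

text \<open>
  After expanding the square, this is \<open>branching2\<close> times the integral of
  \<open>mn * w\<^sup>2\<close>, where \<open>w s = (1 - exp (- \<delta> * (T - s))) / \<delta>\<close>.
\<close>

private lemma A_eq: "A_coeff Q \<Theta> (\<lambda>z. \<Lambda> * z) \<beta> lbar lam T = branching2 * (cm T - 2 * E1 T + E2 T) / \<delta>\<^sup>2"
proof -
  have "(\<lambda>t. 2 * integral {0..t} kap - cm t * cm t - branching2 * (cm t - 2 * E1 t + E2 t) / \<delta>\<^sup>2) T = 0"
  proof (rule zero_of_zero_derivative[where T=T and x="\<lambda>t. 2 * integral {0..t} kap - cm t * cm t - branching2 * (cm t - 2 * E1 t + E2 t) / \<delta>\<^sup>2"])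
    fix t assume t: "t \<in> {0..T}"
    have "((\<lambda>t. 2 * integral {0..t} kap - cm t * cm t - branching2 * (cm t - 2 * E1 t + E2 t) / \<delta>\<^sup>2) has_real_derivative
       2 * kap t - (mn t * cm t + mn t * cm t) - branching2 * (mn t - 2 * (mn t - \<delta> * E1 t) + (mn t - 2 * \<delta> * E2 t)) / \<delta>\<^sup>2) (at t within {0..T})"
      by (intro DERIV_diff DERIV_add DERIV_mult DERIV_cdivide DERIV_cmult DERIV_cm DERIV_E1 DERIV_E2
          integral_has_real_derivative continuous_kap t)
    also have "branching2 * (mn t - 2 * (mn t - \<delta> * E1 t) + (mn t - 2 * \<delta> * E2 t)) / \<delta>\<^sup>2 = 2 * (branching2 * (E1 t - E2 t) / \<delta>)"
    proof -
      have "mn t - 2 * (mn t - \<delta> * E1 t) + (mn t - 2 * \<delta> * E2 t) = \<delta> * (2 * (E1 t - E2 t))" by (simp add: algebra_simps)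
      then show ?thesis using delta_pos by (simp only: power2_eq_square) simp
    qed
    also have "2 * kap t - (mn t * cm t + mn t * cm t) - 2 * (branching2 * (E1 t - E2 t) / \<delta>) = 0"
      using kap_eq[OF t] by simp
    finally show "((\<lambda>t. 2 * integral {0..t} kap - cm t * cm t - branching2 * (cm t - 2 * E1 t + E2 t) / \<delta>\<^sup>2) has_real_derivative 0) (at t within {0..T})" .
  qed (use T0 in auto)
  then show ?thesis unfolding A_eq1 by (simp add: power2_eq_square)
qed

text \<open>
  This is twice the integral of \<open>mn * w\<close> for the same \<open>w\<close>.
\<close>

private lemma B_eq: "B_coeff Q \<Theta> (\<lambda>z. \<Lambda> * z) \<beta> lam T = 2 * (cm T - E1 T) / \<delta>"
proof -
  have "(\<lambda>t. integral {0..t} E1 - (cm t - E1 t) / \<delta>) T = 0"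
  proof (rule zero_of_zero_derivative[where T=T and x="\<lambda>t. integral {0..t} E1 - (cm t - E1 t) / \<delta>"])
    fix t assume t: "t \<in> {0..T}"
    have "((\<lambda>t. integral {0..t} E1 - (cm t - E1 t) / \<delta>) has_real_derivative
        E1 t - (mn t - (mn t - \<delta> * E1 t)) / \<delta>) (at t within {0..T})"
      by (intro DERIV_diff DERIV_cdivide DERIV_cm DERIV_E1 integral_has_real_derivative continuous_E1 t)
    then show "((\<lambda>t. integral {0..t} E1 - (cm t - E1 t) / \<delta>) has_real_derivative 0) (at t within {0..T})"
      using delta_pos by simp
  qed (use T0 in auto)
  then show ?thesis unfolding B_eq1 by simp
qed

lemma cum_mean_pos: "0 < cum_mean Q lam T"
  unfolding cum_mean_eq[OF T0]
  by (rule integral_pos_continuous[OF continuous_mn, of T]) (use mean_intensity_pos T in \<open>auto intro: less_imp_le simp: less_imp_neq[symmetric]\<close>)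

text \<open>
  The integral of \<open>mn * (x - c)\<^sup>2\<close> for \<open>x s = exp (- \<delta> * (T - s))\<close>, which
  is not constant.
\<close>

private lemma quadratic_pos: "0 < E2 T - 2 * c * E1 T + c\<^sup>2 * cm T"
proof -
  let ?x = "\<lambda>s. exp (- \<delta> * (T - s))"
  have cont: "continuous_on {0..T} (\<lambda>s. mn s * (?x s - c)\<^sup>2)" by (intro continuous_intros continuous_mn)
  have "\<exists>s\<in>{0..T}. ?x s \<noteq> c"
  proof (rule ccontr)
    assume "\<not> ?thesis"
    then have "?x 0 = ?x T" using T by (metis atLeastAtMost_iff less_imp_le order_refl)
    then show False using T delta_pos by simp
  qed
  then obtain s where s: "s \<in> {0..T}" "?x s \<noteq> c" by blast
  have "0 < integral {0..T} (\<lambda>s. mn s * (?x s - c)\<^sup>2)"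
  proof (rule integral_pos_continuous[OF cont _ s(1) _ T])
    have "0 < mn s" using s by (intro mean_intensity_pos) simp
    then show "mn s * (?x s - c)\<^sup>2 \<noteq> 0" using s(2) by simp
    show "0 \<le> mn r * (?x r - c)\<^sup>2" if "r \<in> {0..T}" for r
      using that mn_bounds(1)[of r] by simp
  qed
  also have "(\<lambda>s. mn s * (?x s - c)\<^sup>2) = (\<lambda>s. (exp (- (2 * \<delta>) * (T - s)) * mn s - 2 * c * (?x s * mn s)) + c\<^sup>2 * mn s)"
  proof (rule ext)
    fix s
    have "exp (- (2 * \<delta>) * (T - s)) = ?x s * ?x s" unfolding exp_add[symmetric] by (rule arg_cong[of _ _ exp]) (simp add: algebra_simps)
    then show "mn s * (?x s - c)\<^sup>2 = (exp (- (2 * \<delta>) * (T - s)) * mn s - 2 * c * (?x s * mn s)) + c\<^sup>2 * mn s"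
      by (simp add: power2_eq_square algebra_simps)
  qed
  also have "integral {0..T} \<dots> = E2 T - 2 * c * E1 T + c\<^sup>2 * cm T"
  proof -
    have 1: "(\<lambda>s. exp (- (2 * \<delta>) * (T - s)) * mn s) integrable_on {0..T}" "(\<lambda>s. 2 * c * (?x s * mn s)) integrable_on {0..T}"
      "(\<lambda>s. c\<^sup>2 * mn s) integrable_on {0..T}"
      by (intro integrable_continuous_real continuous_intros continuous_mn)+
    show ?thesis
      unfolding exp_conv_def mult_exp_integral
      by (subst integral_add, intro integrable_diff 1, rule 1, subst integral_diff, rule 1, rule 1) simp
  qed
  finally show ?thesis .
qed

lemma B_coeff_pos: "0 < B_coeff Q \<Theta> (\<lambda>z. \<Lambda> * z) \<beta> lam T"
proof -
  have "0 < cm T - E1 T"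
  proof -
    have "0 < integral {0..T} (\<lambda>s. mn s * (1 - exp (- \<delta> * (T - s))))"
    proof (rule integral_pos_continuous[where s=0])
      show "continuous_on {0..T} (\<lambda>s. mn s * (1 - exp (- \<delta> * (T - s))))"
        by (intro continuous_intros continuous_mn)
      show "mn 0 * (1 - exp (- \<delta> * (T - 0))) \<noteq> 0"
        using T delta_pos lam0_pos by (simp add: mean_intensity_0)
      show "0 \<le> mn s * (1 - exp (- \<delta> * (T - s)))" if "s \<in> {0..T}" for s
        using that delta_pos mn_bounds(1)[of s] by (intro mult_nonneg_nonneg) (auto simp: mult_nonpos_nonneg)
    qed (use T in auto)
    also have "(\<lambda>s. mn s * (1 - exp (- \<delta> * (T - s)))) = (\<lambda>s. mn s - exp (- \<delta> * (T - s)) * mn s)"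
      by (simp add: algebra_simps)
    also have "integral {0..T} \<dots> = cm T - E1 T"
      unfolding exp_conv_def mult_exp_integral
      by (intro integral_diff integrable_continuous_real continuous_intros continuous_mn)
    finally show ?thesis .
  qed
  then show ?thesis unfolding B_eq using delta_pos by simp
qed

lemma branching2_pos: "0 < branching2"
proof (rule ccontr)
  assume "\<not> 0 < branching2"
  moreover have "0 \<le> H_int \<Theta> (\<lambda>z. z\<^sup>2)" by (intro Bochner_Integration.integral_nonneg) simp
  moreover have "branching2 = \<Lambda>\<^sup>2 * H_int \<Theta> (\<lambda>z. z\<^sup>2)"
    by (simp add: branching2_def power_mult_distrib)
  ultimately have "H_int \<Theta> (\<lambda>z. z\<^sup>2) = 0"
    using Lambda_pos by (simp add: zero_less_mult_iff not_less)
  then have "AE z in \<Theta>. z\<^sup>2 = 0"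
    by (subst (asm) integral_nonneg_eq_0_iff_AE) (auto intro: integrable_mark_power2)
  then have "H_int \<Theta> (\<lambda>z. z) = H_int \<Theta> (\<lambda>z. 0)"
    by (intro integral_cong_AE) (auto elim: eventually_mono)
  with mean_mark_pos show False by simp
qed

text \<open>
  The strict Cauchy-Schwarz inequality between the integrals of \<open>mn\<close>, \<open>mn * w\<close> and
  \<open>mn * w\<^sup>2\<close>. It amounts to \<open>(E1 T)\<^sup>2 < cm T * E2 T\<close>, which is
  \<open>quadratic_pos\<close> at the minimising \<open>c = E1 T / cm T\<close>.
\<close>

lemma coeff_strict_ineq:
  "branching2 * (B_coeff Q \<Theta> (\<lambda>z. \<Lambda> * z) \<beta> lam T)\<^sup>2 < 4 * cum_mean Q lam T * A_coeff Q \<Theta> (\<lambda>z. \<Lambda> * z) \<beta> lbar lam T"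
proof -
  define M where "M = cm T"
  have M: "0 < M" using cum_mean_pos by (simp add: M_def cum_mean_eq[OF T0])
  have "0 < M * (E2 T - 2 * (E1 T / M) * E1 T + (E1 T / M)\<^sup>2 * M)"
    using quadratic_pos[of "E1 T / M"] M by (simp add: M_def)
  also have "\<dots> = M * E2 T - (E1 T)\<^sup>2"
    using M by (simp add: power2_eq_square field_simps)
  finally have "(E1 T)\<^sup>2 < M * E2 T" by simp
  then have "(M - E1 T)\<^sup>2 < M * (M - 2 * E1 T + E2 T)"
    by (simp add: power2_eq_square algebra_simps)
  moreover have "c * (4 * x / d) < 4 * M * (c * y / d)" if "x < M * y" "0 < c" "0 < d" for x y c d :: real
    using that by (simp add: divide_simps mult_ac)
  ultimately have "branching2 * (4 * (M - E1 T)\<^sup>2 / \<delta>\<^sup>2) < 4 * M * (branching2 * (M - 2 * E1 T + E2 T) / \<delta>\<^sup>2)"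
    using branching2_pos delta_pos by simp
  then show ?thesis
    unfolding A_eq B_eq cum_mean_eq[OF T0] M_def[symmetric]
    by (simp only: power_divide power_mult_distrib) simp
qed

text \<open>
  The mixed moment of intensity and claims solves a linear equation whose source is a combination of the sources
  of \<open>kap\<close> and \<open>E1\<close>. So it is the same combination of \<open>kap\<close> and
  \<open>E1\<close>, and these two integrate to the coefficients \<open>A\<close> and \<open>B\<close>.
\<close>

lemma nn_expected_claims_square_coeff:
  assumes \<eta>: "\<eta> \<in> claim_functions"
  defines "p \<equiv> H_int \<Theta> \<eta>" and "M \<equiv> cum_mean Q lam T"
  shows "(\<E> \<omega>. (claims \<eta> T \<omega>)\<^sup>2) = ennreal (M * H_int \<Theta> (\<lambda>z. (\<eta> z)\<^sup>2)
     + A_coeff Q \<Theta> (\<lambda>z. \<Lambda> * z) \<beta> lbar lam T * p\<^sup>2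
     + B_coeff Q \<Theta> (\<lambda>z. \<Lambda> * z) \<beta> lam T * p * (\<Lambda> * H_int \<Theta> (\<lambda>z. z * \<eta> z)) + (p * M)\<^sup>2)"
proof -
  define r where "r = \<Lambda> * H_int \<Theta> (\<lambda>z. z * \<eta> z)"
  let ?a = base_intensity and ?K = "claims_cross \<eta>"
  let ?g = "\<lambda>s. r * mn s + p * cross s + branching * ?K s"
  have K_eq: "?K t = ?a t * (p * cm t) + exp_conv \<beta> ?g t" if "t \<in> {0..T}" for t
    using claims_cross_equation[OF \<eta>, of t] that unfolding exp_conv_def r_def p_def by simp
  have r0: "0 \<le> r" and p0: "0 \<le> p"
    using nn_integral_claim(2,6)[OF \<eta>] Lambda_pos by (auto simp: r_def p_def)
  have "continuous_on {0..T} (\<lambda>t. ?a t * (p * cm t) + exp_conv \<beta> ?g t)"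
    by (intro continuous_intros continuous_on_base continuous_cm continuous_on_exp_conv T0 tame_intros
        tame_claims_cross \<eta> r0 p0 branching_nonneg)
  then have K_cont: "continuous_on {0..T} ?K"
    by (rule continuous_on_cong[THEN iffD1, rotated -1]) (auto simp: K_eq)
  have K_deriv: "(?K has_real_derivative p * (\<beta> * lbar * cm t + m2 t) + r * mn t - \<delta> * ?K t) (at t within {0..T})"
    if t: "t \<in> {0..T}" for t
  proof -
    have "((\<lambda>t. ?a t * (p * cm t) + exp_conv \<beta> ?g t) has_real_derivative
       (\<beta> * (lbar - ?a t)) * (p * cm t) + (p * mn t) * ?a t + (?g t - \<beta> * exp_conv \<beta> ?g t)) (at t within {0..T})"
      by (intro DERIV_add DERIV_mult DERIV_base DERIV_cmult DERIV_cm DERIV_exp_conv continuous_intros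
          continuous_mn continuous_cross K_cont t)
    also have "(\<beta> * (lbar - ?a t)) * (p * cm t) + (p * mn t) * ?a t + (?g t - \<beta> * exp_conv \<beta> ?g t)
       = p * (\<beta> * lbar * cm t + m2 t) + r * mn t - \<delta> * ?K t"
    proof -
      have *: "exp_conv \<beta> ?g t = ?K t - ?a t * (p * cm t)" using K_eq[OF t] by simp
      have **: "cross t = m2 t - ?a t * mn t" using nn_integral_cross(3)[of t] t by simp
      show ?thesis unfolding * unfolding ** by (simp add: algebra_simps)
    qed
    finally show ?thesis
      using t by (auto simp: K_eq intro: has_field_derivative_transform_within[where d=1 and f="\<lambda>t. ?a t * (p * cm t) + exp_conv \<beta> ?g t"])
  qed
  have K_sol: "?K t = p * kap t + r * E1 t" if t: "t \<in> {0..T}" for t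
  proof -
    have "(\<lambda>t. ?K t - (p * kap t + r * E1 t)) t = 0"
    proof (rule ode_zero[where c="- \<delta>", OF _ _ t])
      fix t assume t: "t \<in> {0..T}"
      have "((\<lambda>t. ?K t - (p * kap t + r * E1 t)) has_real_derivative
          (p * (\<beta> * lbar * cm t + m2 t) + r * mn t - \<delta> * ?K t)
          - (p * (\<beta> * lbar * cm t + m2 t - \<delta> * kap t) + r * (mn t - \<delta> * E1 t))) (at t within {0..T})"
        by (intro DERIV_diff DERIV_add DERIV_cmult K_deriv DERIV_kap DERIV_E1 t)
      then show "((\<lambda>t. ?K t - (p * kap t + r * E1 t)) has_real_derivative - \<delta> * (?K t - (p * kap t + r * E1 t))) (at t within {0..T})"
        by (simp add: algebra_simps)
    qed (use K_eq[of 0] T0 in auto)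
    then show ?thesis by simp
  qed
  have "integral {0..T} ?K = integral {0..T} (\<lambda>t. p * kap t + r * E1 t)"
    by (rule integral_cong) (rule K_sol)
  also have "\<dots> = p * integral {0..T} kap + r * integral {0..T} E1"
    by (subst integral_add) (auto intro!: integrable_continuous_real continuous_intros continuous_kap continuous_E1)
  finally have "2 * p * integral {0..T} ?K = A_coeff Q \<Theta> (\<lambda>z. \<Lambda> * z) \<beta> lbar lam T * p\<^sup>2
     + B_coeff Q \<Theta> (\<lambda>z. \<Lambda> * z) \<beta> lam T * p * r + (p * M)\<^sup>2"
    unfolding A_eq1 B_eq1 M_def cum_mean_eq[OF T0] by (simp add: power2_eq_square algebra_simps)
  then show ?thesis
    unfolding nn_expected_claims_square[OF \<eta> T0] p_def[symmetric] r_def[symmetric] M_def cum_mean_eq[OF T0]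
    by (simp add: algebra_simps)
qed

end

end

section \<open>The criterion as a quadratic functional\<close>

context marked_hawkes_model begin

definition claims_real :: "(real \<Rightarrow> real) \<Rightarrow> real \<Rightarrow> 'a \<Rightarrow> real" where
  "claims_real \<eta> t \<omega> = enn2real (claims \<eta> t \<omega>)"

lemma claims_real_moments:
  assumes \<eta>: "\<eta> \<in> claim_functions" and T: "0 < T"
  defines "p \<equiv> H_int \<Theta> \<eta>" and "M \<equiv> cum_mean Q lam T"
  shows "integrable Q (claims_real \<eta> T)" "expectation (claims_real \<eta> T) = p * M"
    "integrable Q (\<lambda>\<omega>. (claims_real \<eta> T \<omega>)\<^sup>2)"
    "variance (claims_real \<eta> T) = M * H_int \<Theta> (\<lambda>z. (\<eta> z)\<^sup>2)
     + A_coeff Q \<Theta> (\<lambda>z. \<Lambda> * z) \<beta> lbar lam T * p\<^sup>2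
     + B_coeff Q \<Theta> (\<lambda>z. \<Lambda> * z) \<beta> lam T * p * (\<Lambda> * H_int \<Theta> (\<lambda>z. z * \<eta> z))"
proof -
  note [measurable] = claim_measurable[OF \<eta>]
  have meas [measurable]: "claims_real \<eta> T \<in> borel_measurable Q"
    unfolding claims_real_def by measurable
  define V where "V = M * H_int \<Theta> (\<lambda>z. (\<eta> z)\<^sup>2)
     + A_coeff Q \<Theta> (\<lambda>z. \<Lambda> * z) \<beta> lbar lam T * p\<^sup>2
     + B_coeff Q \<Theta> (\<lambda>z. \<Lambda> * z) \<beta> lam T * p * (\<Lambda> * H_int \<Theta> (\<lambda>z. z * \<eta> z))"
  have E1: "(\<E> \<omega>. claims \<eta> T \<omega>) = ennreal (p * M)"
    using nn_expected_claims[OF \<eta>, of T] T by (simp add: p_def M_def cum_mean_eq)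
  have E2: "(\<E> \<omega>. (claims \<eta> T \<omega>)\<^sup>2) = ennreal (V + (p * M)\<^sup>2)"
    using nn_expected_claims_square_coeff[OF T \<eta>] by (simp add: p_def M_def V_def)
  have "AE \<omega> in Q. claims \<eta> T \<omega> \<noteq> \<infinity>"
    by (rule nn_integral_PInf_AE) (use E1 in auto)
  then have fin: "AE \<omega> in Q. ennreal (claims_real \<eta> T \<omega>) = claims \<eta> T \<omega>"
    by eventually_elim (simp add: claims_real_def less_top)
  have N1: "(\<E> \<omega>. ennreal (claims_real \<eta> T \<omega>)) = ennreal (p * M)"
    unfolding E1[symmetric] by (rule nn_integral_cong_AE) (rule fin)
  have N2: "(\<E> \<omega>. ennreal ((claims_real \<eta> T \<omega>)\<^sup>2)) = ennreal (V + (p * M)\<^sup>2)"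
    unfolding E2[symmetric]
  proof (rule nn_integral_cong_AE)
    show "AE \<omega> in Q. ennreal ((claims_real \<eta> T \<omega>)\<^sup>2) = (claims \<eta> T \<omega>)\<^sup>2"
      using fin by eventually_elim (metis claims_real_def enn2real_nonneg ennreal_power)
  qed
  have nn: "0 \<le> claims_real \<eta> T \<omega>" for \<omega> by (simp add: claims_real_def)
  show int1: "integrable Q (claims_real \<eta> T)"
    by (rule integrableI_nonneg) (use nn N1 in auto)
  show int2: "integrable Q (\<lambda>\<omega>. (claims_real \<eta> T \<omega>)\<^sup>2)"
    by (rule integrableI_nonneg) (use N2 in auto)
  have "0 \<le> p * M"
    using nn_integral_claim(2)[OF \<eta>] cum_mean_pos[OF T] by (simp add: p_def M_def)
  then show e1: "expectation (claims_real \<eta> T) = p * M"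
    using nn N1 by (subst integral_eq_nn_integral) auto
  have pos: "0 \<le> V + (p * M)\<^sup>2"
  proof -
    have "0 \<le> branching2 * (B_coeff Q \<Theta> (\<lambda>z. \<Lambda> * z) \<beta> lam T)\<^sup>2" using branching2_nonneg by simp
    also note coeff_strict_ineq[OF T]
    finally have "0 < A_coeff Q \<Theta> (\<lambda>z. \<Lambda> * z) \<beta> lbar lam T"
      using cum_mean_pos[OF T] by (simp add: zero_less_mult_iff)
    then show ?thesis
      using nn_integral_claim(2,4,6)[OF \<eta>] Lambda_pos cum_mean_pos[OF T] B_coeff_pos[OF T]
      unfolding V_def p_def M_def by (intro add_nonneg_nonneg mult_nonneg_nonneg) auto
  qed
  have "expectation (\<lambda>\<omega>. (claims_real \<eta> T \<omega>)\<^sup>2) = V + (p * M)\<^sup>2"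
    using N2 pos by (subst integral_eq_nn_integral) auto
  then show "variance (claims_real \<eta> T) = V"
    by (subst variance_eq[OF int1 int2]) (simp add: e1)
qed

lemma AE_wealth_eq:
  assumes h: "h \<in> borel_measurable \<Theta>" and \<eta>: "\<eta> \<in> claim_functions" and ae: "AE z in \<Theta>. h z = z - \<eta> z"
    and T: "0 < T"
  shows "AE \<omega> in Q. wealth \<Theta> \<tau> Z R0 \<rho> c h T \<omega>
     = R0 + \<rho> * H_int \<Theta> (\<lambda>z. z) * T - c * T * H_int \<Theta> h - claims_real \<eta> T \<omega>"
proof -
  have h' [measurable]: "h \<in> borel_measurable Rplus" using h by (simp add: measurable_cong_sets[OF sets_Theta refl])
  from ae obtain N where N: "N \<in> null_sets \<Theta>" "{z \<in> space \<Theta>. h z \<noteq> z - \<eta> z} \<subseteq> N"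
    by (auto simp: eventually_ae_filter)
  have T0: "0 \<le> T" using T by simp
  show ?thesis
    using AE_regular_path AE_no_event_at_time[OF T0] AE_marks_avoid_null_set[OF N(1)]
  proof eventually_elim
    fix \<omega> assume reg: "regular_path \<omega>" and no: "\<forall>i. \<tau> i \<omega> \<noteq> ennreal T" and av: "\<forall>i. \<tau> i \<omega> < \<infinity> \<longrightarrow> Z i \<omega> \<notin> N"
    have \<omega>: "\<omega> \<in> space Q" using reg by (simp add: regular_path_def)
    obtain n where n: "\<And>i. i \<ge> n \<Longrightarrow> ennreal T < \<tau> i \<omega>" using regular_path_bound[OF reg] by blast
    have iff: "\<tau> i \<omega> < \<infinity> \<and> enn2real (\<tau> i \<omega>) \<in> {0..T} \<longleftrightarrow> \<tau> i \<omega> < ennreal T" for i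
    proof (cases "\<tau> i \<omega>")
      case (real r)
      with no have "r \<noteq> T" by auto
      then show ?thesis using real by (auto simp: ennreal_less_iff)
    qed simp
    have "(LINT p:{0..T} \<times> {0..}|counting_measure \<tau> Z \<omega>. h (snd p) - snd p)
      = (\<Sum>i<n. if \<tau> i \<omega> < \<infinity> \<and> enn2real (\<tau> i \<omega>) \<in> {0..T} then h (Z i \<omega>) - Z i \<omega> else 0)"
    proof (rule set_integral_counting_measure[OF \<omega>, where g="\<lambda>z. h z - z"])
      show "{0..T} \<in> sets Rplus" by (auto simp: sets_restrict_space_iff)
      fix i assume "n \<le> i" "\<tau> i \<omega> < \<infinity>"
      then show "enn2real (\<tau> i \<omega>) \<notin> {0..T}" using n[of i] iff[of i] by auto
    qed measurable
    also have "\<dots> = (\<Sum>i<n. - (if \<tau> i \<omega> < ennreal T then \<eta> (Z i \<omega>) else 0))"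
    proof (intro sum.cong refl, unfold iff)
      fix i
      have "h (Z i \<omega>) = Z i \<omega> - \<eta> (Z i \<omega>)" if "\<tau> i \<omega> < ennreal T"
        using av iff[of i] that N(2) Z_nonneg[OF \<omega>, of i] by auto
      then show "(if \<tau> i \<omega> < ennreal T then h (Z i \<omega>) - Z i \<omega> else 0) = - (if \<tau> i \<omega> < ennreal T then \<eta> (Z i \<omega>) else 0)"
        by auto
    qed
    also have "\<dots> = - claims_real \<eta> T \<omega>"
    proof -
      have "claims \<eta> T \<omega> = (\<Sum>i<n. if \<tau> i \<omega> < ennreal T then ennreal (\<eta> (Z i \<omega>)) else 0)"
        unfolding claims_def by (subst jump_sum_finite[of n]) (use n less_imp_le in auto)
      also have "\<dots> = (\<Sum>i<n. ennreal (if \<tau> i \<omega> < ennreal T then \<eta> (Z i \<omega>) else 0))"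
        by (intro sum.cong) auto
      also have "\<dots> = ennreal (\<Sum>i<n. if \<tau> i \<omega> < ennreal T then \<eta> (Z i \<omega>) else 0)"
        using claim_nonneg[OF \<eta> Z_nonneg[OF \<omega>]] by (intro sum_ennreal) auto
      finally have "claims_real \<eta> T \<omega> = (\<Sum>i<n. if \<tau> i \<omega> < ennreal T then \<eta> (Z i \<omega>) else 0)"
        using claim_nonneg[OF \<eta> Z_nonneg[OF \<omega>]] by (simp add: claims_real_def sum_nonneg)
      then show ?thesis by (simp add: sum_negf)
    qed
    finally show "wealth \<Theta> \<tau> Z R0 \<rho> c h T \<omega>
     = R0 + \<rho> * H_int \<Theta> (\<lambda>z. z) * T - c * T * H_int \<Theta> h - claims_real \<eta> T \<omega>"
      by (simp add: wealth_def)
  qed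
qed

text \<open>
  The criterion without the terms that are common to all contracts, as a function of the retained claims.
\<close>

definition retention_value :: "real \<Rightarrow> real \<Rightarrow> real \<Rightarrow> (real \<Rightarrow> real) \<Rightarrow> real" where
  "retention_value c \<gamma> T \<eta> = (c * T - cum_mean Q lam T) * H_int \<Theta> \<eta> - \<gamma> *
     (cum_mean Q lam T * H_int \<Theta> (\<lambda>z. (\<eta> z)\<^sup>2)
      + A_coeff Q \<Theta> (\<lambda>z. \<Lambda> * z) \<beta> lbar lam T * (H_int \<Theta> \<eta>)\<^sup>2
      + B_coeff Q \<Theta> (\<lambda>z. \<Lambda> * z) \<beta> lam T * H_int \<Theta> \<eta> * (\<Lambda> * H_int \<Theta> (\<lambda>z. z * \<eta> z)))"

lemma criterion_eq:
  assumes h: "h \<in> borel_measurable \<Theta>" and \<eta>: "\<eta> \<in> claim_functions" and ae: "AE z in \<Theta>. h z = z - \<eta> z"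
    and T: "0 < T"
  shows "criterion Q \<Theta> \<tau> Z R0 \<rho> c \<gamma> T h
    = R0 + \<rho> * H_int \<Theta> (\<lambda>z. z) * T - c * T * H_int \<Theta> (\<lambda>z. z) + retention_value c \<gamma> T \<eta>"
proof -
  note [measurable] = claim_measurable[OF \<eta>]
  define k where "k = R0 + \<rho> * H_int \<Theta> (\<lambda>z. z) * T - c * T * H_int \<Theta> h"
  have [measurable]: "claims_real \<eta> T \<in> borel_measurable Q"
    unfolding claims_real_def by measurable
  note mom = claims_real_moments[OF \<eta> T]
  have eq: "AE \<omega> in Q. wealth \<Theta> \<tau> Z R0 \<rho> c h T \<omega> = k - claims_real \<eta> T \<omega>"
    unfolding k_def by (rule AE_wealth_eq[OF h \<eta> ae T])
  have meas [measurable]: "wealth \<Theta> \<tau> Z R0 \<rho> c h T \<in> borel_measurable Q"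
    by (rule measurable_AE_eq[OF _ eq]) measurable
  have "expectation (wealth \<Theta> \<tau> Z R0 \<rho> c h T) = expectation (\<lambda>\<omega>. k - claims_real \<eta> T \<omega>)"
    by (rule integral_cong_AE[OF _ _ eq]) measurable
  also have "\<dots> = k - expectation (claims_real \<eta> T)"
    using mom(1) by (simp add: prob_space)
  finally have E: "expectation (wealth \<Theta> \<tau> Z R0 \<rho> c h T) = k - expectation (claims_real \<eta> T)" .
  have Var: "variance (wealth \<Theta> \<tau> Z R0 \<rho> c h T) = variance (claims_real \<eta> T)"
    unfolding E
  proof (rule integral_cong_AE)
    show "AE \<omega> in Q. (wealth \<Theta> \<tau> Z R0 \<rho> c h T \<omega> - (k - expectation (claims_real \<eta> T)))\<^sup>2
        = (claims_real \<eta> T \<omega> - expectation (claims_real \<eta> T))\<^sup>2"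
      using eq by eventually_elim (simp add: power2_commute)
  qed measurable
  have H: "H_int \<Theta> h = H_int \<Theta> (\<lambda>z. z) - H_int \<Theta> \<eta>"
  proof -
    have "H_int \<Theta> h = H_int \<Theta> (\<lambda>z. z - \<eta> z)"
    proof (rule integral_cong_AE[OF h _ ae])
      show "(\<lambda>z. z - \<eta> z) \<in> borel_measurable \<Theta>" by measurable
    qed
    then show ?thesis using integrable_mark integrable_claim(1)[OF \<eta>] by simp
  qed
  show ?thesis
    unfolding criterion_def Var unfolding E mom(4) unfolding mom(2) retention_value_def k_def H
    by (simp add: algebra_simps)
qed

text \<open>
  Clamping \<open>z - h z\<close> to \<open>[0, z]\<close> changes it on a null set only.
\<close>

lemma contract_imp_claim_function:
  assumes "h \<in> contracts \<Theta>"
  obtains \<eta> where "\<eta> \<in> claim_functions" "AE z in \<Theta>. h z = z - \<eta> z"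
proof
  have h: "h \<in> borel_measurable \<Theta>" and ae: "AE z in \<Theta>. 0 \<le> h z \<and> h z \<le> z"
    using assms by (auto simp: contracts_def)
  have [measurable]: "h \<in> borel_measurable Rplus" using h by (simp add: measurable_cong_sets[OF sets_Theta refl])
  show "(\<lambda>z. max 0 (min z (z - h z))) \<in> claim_functions"
    unfolding claim_functions_def by auto
  show "AE z in \<Theta>. h z = z - max 0 (min z (z - h z))"
    using ae by eventually_elim auto
qed

end

section \<open>The optimal contract\<close>

context marked_hawkes_model begin

definition coeff_A :: "real \<Rightarrow> real" where
  "coeff_A T = A_coeff Q \<Theta> (\<lambda>z. \<Lambda> * z) \<beta> lbar lam T"

definition coeff_B :: "real \<Rightarrow> real" where
  "coeff_B T = B_coeff Q \<Theta> (\<lambda>z. \<Lambda> * z) \<beta> lam T"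

text \<open>
  The variance of the retained claims, extended to functions of either sign.
\<close>

definition claim_quadratic :: "real \<Rightarrow> (real \<Rightarrow> real) \<Rightarrow> real" where
  "claim_quadratic T d = cum_mean Q lam T * H_int \<Theta> (\<lambda>z. (d z)\<^sup>2) + coeff_A T * (H_int \<Theta> d)\<^sup>2
     + coeff_B T * H_int \<Theta> d * (\<Lambda> * H_int \<Theta> (\<lambda>z. z * d z))"

text \<open>
  The retention at which the derivative of the criterion at mark \<open>z\<close> vanishes, when \<open>x\<close>
  holds the moments \<open>H[\<eta>]\<close> and \<open>H[z \<eta>]\<close> of the current retention.
\<close>

definition target_line :: "real \<Rightarrow> real \<Rightarrow> real \<Rightarrow> real \<times> real \<Rightarrow> real \<Rightarrow> real" where
  "target_line c \<gamma> T x z = (c * T - cum_mean Q lam T - 2 * \<gamma> * coeff_A T * fst x - \<gamma> * coeff_B T * \<Lambda> * snd x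
     - \<gamma> * coeff_B T * \<Lambda> * fst x * z) / (2 * \<gamma> * cum_mean Q lam T)"

definition claim_moments :: "(real \<Rightarrow> real) \<Rightarrow> real \<times> real" where
  "claim_moments \<eta> = (H_int \<Theta> \<eta>, H_int \<Theta> (\<lambda>z. z * \<eta> z))"

definition first_order :: "real \<Rightarrow> real \<Rightarrow> real \<Rightarrow> (real \<Rightarrow> real) \<Rightarrow> bool" where
  "first_order c \<gamma> T \<eta> \<longleftrightarrow> \<eta> \<in> claim_functions \<and>
     (\<forall>z. \<eta> z = min z (max 0 (target_line c \<gamma> T (claim_moments \<eta>) z)))"

context
  fixes c \<gamma> T :: real
  assumes T: "0 < T" and \<gamma>: "0 < \<gamma>" and safety: "0 < c * T - cum_mean Q lam T"
begin

private abbreviation "M \<equiv> cum_mean Q lam T"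
private abbreviation "A \<equiv> coeff_A T"
private abbreviation "B \<equiv> coeff_B T"
private abbreviation "m1 \<equiv> H_int \<Theta> (\<lambda>z. z)"
private abbreviation "mm2 \<equiv> H_int \<Theta> (\<lambda>z. z\<^sup>2)"

private lemma M_pos: "0 < M" by (rule cum_mean_pos[OF T])
private lemma B_pos: "0 < B" unfolding coeff_B_def by (rule B_coeff_pos[OF T])

text \<open>
  Completing the square in \<open>d\<close> leaves \<open>(H[d])\<^sup>2\<close> times a factor that is positive
  by \<open>coeff_strict_ineq\<close>. If the form vanishes, then so does \<open>H[d]\<close>, and only the term
  \<open>M * H[d\<^sup>2]\<close> is left.
\<close>

lemma claim_quadratic_pos_def:
  assumes d: "integrable \<Theta> d" "integrable \<Theta> (\<lambda>z. (d z)\<^sup>2)" "integrable \<Theta> (\<lambda>z. z * d z)"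
  shows "0 \<le> claim_quadratic T d" "claim_quadratic T d = 0 \<Longrightarrow> H_int \<Theta> (\<lambda>z. (d z)\<^sup>2) = 0"
proof -
  define p q s where "p = H_int \<Theta> d" and "q = H_int \<Theta> (\<lambda>z. z * d z)" and "s = H_int \<Theta> (\<lambda>z. (d z)\<^sup>2)"
  \<comment> \<open>the choice of \<open>b\<close> for which \<open>M * H[(d + b z)\<^sup>2]\<close> contains the mixed term of the quadratic form\<close>
  define b where "b = p * B * \<Lambda> / (2 * M)"
  have "0 \<le> H_int \<Theta> (\<lambda>z. (d z + b * z)\<^sup>2)" by (intro Bochner_Integration.integral_nonneg) simp
  also have "H_int \<Theta> (\<lambda>z. (d z + b * z)\<^sup>2) = H_int \<Theta> (\<lambda>z. (d z)\<^sup>2 + 2 * b * (z * d z) + b\<^sup>2 * z\<^sup>2)"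
    by (simp add: power2_sum power_mult_distrib algebra_simps)
  also have "\<dots> = s + 2 * b * q + b\<^sup>2 * mm2"
    unfolding s_def q_def using d integrable_mark_power2 by simp
  finally have "0 \<le> M * (s + 2 * b * q + b\<^sup>2 * mm2)" using M_pos by simp
  also have "\<dots> = claim_quadratic T d - p\<^sup>2 * (A - branching2 * B\<^sup>2 / (4 * M))"
  proof -
    have "branching2 = \<Lambda>\<^sup>2 * mm2" by (simp add: branching2_def power_mult_distrib)
    then show ?thesis
      unfolding claim_quadratic_def p_def[symmetric] q_def[symmetric] s_def[symmetric] b_def
      using M_pos by (simp add: field_simps power2_eq_square)
  qed
  finally have ge: "p\<^sup>2 * (A - branching2 * B\<^sup>2 / (4 * M)) \<le> claim_quadratic T d" by simp
  have pos: "0 < A - branching2 * B\<^sup>2 / (4 * M)"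
    using coeff_strict_ineq[OF T] M_pos unfolding coeff_A_def[symmetric] coeff_B_def[symmetric]
    by (simp add: field_simps)
  show "0 \<le> claim_quadratic T d" by (rule order_trans[OF _ ge]) (use pos in simp)
  assume z: "claim_quadratic T d = 0"
  with ge pos have "p = 0" by (simp add: mult_le_0_iff)
  then show "H_int \<Theta> (\<lambda>z. (d z)\<^sup>2) = 0"
    using z M_pos unfolding claim_quadratic_def p_def[symmetric] by simp
qed

private abbreviation "line \<equiv> target_line c \<gamma> T"

private definition clamped :: "real \<times> real \<Rightarrow> real \<Rightarrow> real" where
  "clamped x z = min z (max 0 (line x z))"

private lemma clamped_claim: "clamped x \<in> claim_functions"
proof -
  have "clamped x \<in> borel_measurable Rplus" unfolding clamped_def[abs_def] target_line_def by measurable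
  then show ?thesis by (auto simp: claim_functions_def clamped_def)
qed

text \<open>
  The line depends on the retention through two moments only, so it suffices to find a fixed point of the map that
  sends a pair of moments to the moments of the clamped line. It is continuous by dominated convergence and maps
  the rectangle with corner \<open>(H[z], H[z\<^sup>2])\<close> into itself.
\<close>

lemma first_order_solvable: obtains \<eta> where "first_order c \<gamma> T \<eta>"
proof -
  let ?\<Phi> = "\<lambda>x. (H_int \<Theta> (clamped x), H_int \<Theta> (\<lambda>z. z * clamped x z))"
  let ?S = "cbox (0, 0) (m1, mm2)"
  have lim: "(\<lambda>n. clamped (x n) z) \<longlonglongrightarrow> clamped a z" if "x \<longlonglongrightarrow> a" for x a z
    unfolding clamped_def target_line_def using M_pos \<gamma> by (intro tendsto_intros that) auto
  have meas: "clamped x \<in> borel_measurable \<Theta>" for x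
    using claim_measurable[OF clamped_claim] by measurable
  have meas': "(\<lambda>z. z * clamped x z) \<in> borel_measurable \<Theta>" for x
    using integrable_claim(2)[OF clamped_claim] by (rule borel_measurable_integrable)
  have bd: "\<bar>clamped x z\<bar> \<le> z" "\<bar>z * clamped x z\<bar> \<le> z\<^sup>2" if "0 \<le> z" for x z
    using claim_nonneg[OF clamped_claim that, of x] claim_le[OF clamped_claim that, of x] that
    by (auto simp: abs_mult power2_eq_square intro!: mult_left_mono)
  have cont: "continuous_on ?S ?\<Phi>"
  proof (rule continuous_on_Pair)
    show "continuous_on ?S (\<lambda>x. H_int \<Theta> (clamped x))"
      unfolding continuous_on_sequentially o_def
      by (intro allI ballI impI integral_dominated_convergence[where w="\<lambda>z. z"] meas integrable_mark AE_I2)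
        (use lim bd in auto)
    show "continuous_on ?S (\<lambda>x. H_int \<Theta> (\<lambda>z. z * clamped x z))"
      unfolding continuous_on_sequentially o_def
      by (intro allI ballI impI integral_dominated_convergence[where w="\<lambda>z. z\<^sup>2"] meas' integrable_mark_power2 AE_I2)
        (use lim bd in \<open>auto intro: tendsto_mult_left\<close>)
  qed
  have maps: "?\<Phi> ` ?S \<subseteq> ?S"
  proof
    fix y assume "y \<in> ?\<Phi> ` ?S"
    then obtain x where y: "y = ?\<Phi> x" by blast
    have "H_int \<Theta> (clamped x) \<le> m1" "H_int \<Theta> (\<lambda>z. z * clamped x z) \<le> mm2"
      by (intro integral_mono integrable_claim[OF clamped_claim] integrable_mark integrable_mark_power2;
          use bd[of _ x] in \<open>simp add: abs_le_iff\<close>)+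
    then show "y \<in> ?S"
      using nn_integral_claim(2,6)[OF clamped_claim, of x] unfolding y by (simp add: cbox_Pair_eq)
  qed
  have ne: "?S \<noteq> {}"
  proof -
    have "0 \<le> mm2" by (rule Bochner_Integration.integral_nonneg) simp
    then have "(0, 0) \<in> ?S" using mean_mark_pos by (simp add: cbox_Pair_eq)
    then show ?thesis by blast
  qed
  from maps have "?\<Phi> \<in> ?S \<rightarrow> ?S" by (simp only: image_subset_iff_funcset)
  then obtain x where "x \<in> ?S" "?\<Phi> x = x"
    by (rule brouwer[OF compact_cbox convex_box(1) ne cont])
  then have "first_order c \<gamma> T (clamped x)"
    using clamped_claim by (simp add: first_order_def claim_moments_def clamped_def)
  then show ?thesis by (rule that)
qed

text \<open>
  The value at \<open>\<xi>\<close> is the one at \<open>\<eta>\<close>, plus a multiple of the integral of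
  \<open>(l - \<eta>) * (\<xi> - \<eta>)\<close>, minus a positive definite form in \<open>\<xi> - \<eta>\<close>.
  The integrand is nowhere positive, since \<open>\<eta> z\<close> is the point of \<open>{0..z}\<close> closest
  to \<open>l z\<close>.
\<close>

lemma retention_value_le:
  assumes fo: "first_order c \<gamma> T \<eta>" and \<xi>: "\<xi> \<in> claim_functions"
  shows "retention_value c \<gamma> T \<xi> \<le> retention_value c \<gamma> T \<eta>"
    "retention_value c \<gamma> T \<xi> = retention_value c \<gamma> T \<eta> \<Longrightarrow> AE z in \<Theta>. \<xi> z = \<eta> z"
proof -
  define p q where "p = H_int \<Theta> \<eta>" and "q = H_int \<Theta> (\<lambda>z. z * \<eta> z)"
  define a where "a = c * T - M - 2 * \<gamma> * A * p - \<gamma> * B * \<Lambda> * q"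
  define l where "l = line (claim_moments \<eta>)"
  define d where "d z = \<xi> z - \<eta> z" for z
  have \<eta>: "\<eta> \<in> claim_functions" and sol': "\<And>z. \<eta> z = min z (max 0 (l z))"
    using fo by (simp_all add: first_order_def l_def)
  have l_eq: "l z = (a - \<gamma> * B * \<Lambda> * p * z) / (2 * \<gamma> * M)" for z
    by (simp add: l_def target_line_def claim_moments_def a_def p_def q_def)
  note ie = integrable_claim[OF \<eta>] and ix = integrable_claim[OF \<xi>]
  have prod: "integrable \<Theta> (\<lambda>z. \<eta> z * \<xi> z)"
  proof (rule Bochner_Integration.integrable_bound[OF integrable_mark_power2])
    show "(\<lambda>z. \<eta> z * \<xi> z) \<in> borel_measurable \<Theta>"
      using ie(1) ix(1) by (intro borel_measurable_times) auto
    show "AE z in \<Theta>. norm (\<eta> z * \<xi> z) \<le> norm (z\<^sup>2)"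
      by (rule AE_I2) (use claim_nonneg[OF \<eta>] claim_nonneg[OF \<xi>] claim_le[OF \<eta>] claim_le[OF \<xi>]
        in \<open>simp add: abs_mult power2_eq_square mult_mono\<close>)
  qed
  have d1: "integrable \<Theta> d" unfolding d_def using ie ix by auto
  have d2: "integrable \<Theta> (\<lambda>z. (d z)\<^sup>2)"
    unfolding d_def power2_diff using ie ix prod by (auto simp: mult.assoc mult.commute[of "\<xi> _"])
  have d3: "integrable \<Theta> (\<lambda>z. z * d z)" unfolding d_def right_diff_distrib using ie ix by auto
  have ed: "integrable \<Theta> (\<lambda>z. \<eta> z * d z)"
    unfolding d_def right_diff_distrib using prod ie(3) by (simp add: power2_eq_square)
  have xi: "\<xi> z = \<eta> z + d z" for z by (simp add: d_def)
  have X1: "H_int \<Theta> \<xi> = p + H_int \<Theta> d"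
    unfolding p_def xi[abs_def] using ie d1 by simp
  have X2: "H_int \<Theta> (\<lambda>z. z * \<xi> z) = q + H_int \<Theta> (\<lambda>z. z * d z)"
    unfolding q_def xi distrib_left using ie d3 by simp
  have X3: "H_int \<Theta> (\<lambda>z. (\<xi> z)\<^sup>2) = H_int \<Theta> (\<lambda>z. (\<eta> z)\<^sup>2) + 2 * H_int \<Theta> (\<lambda>z. \<eta> z * d z) + H_int \<Theta> (\<lambda>z. (d z)\<^sup>2)"
  proof -
    have "(\<xi> z)\<^sup>2 = (\<eta> z)\<^sup>2 + 2 * (\<eta> z * d z) + (d z)\<^sup>2" for z
      unfolding xi power2_sum by simp
    then show ?thesis using ie ed d2 by simp
  qed
  have lin: "H_int \<Theta> (\<lambda>z. (l z - \<eta> z) * d z) * (2 * \<gamma> * M)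
     = a * H_int \<Theta> d - \<gamma> * B * \<Lambda> * p * H_int \<Theta> (\<lambda>z. z * d z) - 2 * \<gamma> * M * H_int \<Theta> (\<lambda>z. \<eta> z * d z)"
  proof -
    have "(l z - \<eta> z) * d z = (a * d z - \<gamma> * B * \<Lambda> * p * (z * d z)) / (2 * \<gamma> * M) - \<eta> z * d z" for z
      unfolding l_eq by (simp only: left_diff_distrib times_divide_eq_left mult.assoc)
    then have "H_int \<Theta> (\<lambda>z. (l z - \<eta> z) * d z)
       = (a * H_int \<Theta> d - \<gamma> * B * \<Lambda> * p * H_int \<Theta> (\<lambda>z. z * d z)) / (2 * \<gamma> * M) - H_int \<Theta> (\<lambda>z. \<eta> z * d z)"
      using d1 d3 ed by simp
    then show ?thesis using \<gamma> M_pos by (simp add: field_simps)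
  qed
  have exp: "retention_value c \<gamma> T \<xi> = retention_value c \<gamma> T \<eta> + H_int \<Theta> (\<lambda>z. (l z - \<eta> z) * d z) * (2 * \<gamma> * M) - \<gamma> * claim_quadratic T d"
    unfolding lin retention_value_def coeff_A_def[symmetric] coeff_B_def[symmetric]
      claim_quadratic_def X1 X2 X3 p_def[symmetric] q_def[symmetric] a_def
    by (simp add: power2_eq_square algebra_simps)
  have "H_int \<Theta> (\<lambda>z. (l z - \<eta> z) * d z) \<le> 0"
  proof -
    have "0 \<le> - ((l z - \<eta> z) * d z)" if "0 \<le> z" for z
    proof -
      consider "l z < 0" | "0 \<le> l z" "l z \<le> z" | "z < l z" by linarith
      then show ?thesis
      proof cases
        case 1
        then have "\<eta> z = 0" using sol'[of z] that by simp
        then show ?thesis using 1 claim_nonneg[OF \<xi> that] by (simp add: d_def mult_nonpos_nonneg)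
      next
        case 2
        then have "\<eta> z = l z" using sol'[of z] by simp
        then show ?thesis by simp
      next
        case 3
        then have "\<eta> z = z" using sol'[of z] that by simp
        then show ?thesis using 3 claim_le[OF \<xi> that] by (simp add: d_def mult_nonneg_nonpos)
      qed
    qed
    then have "0 \<le> H_int \<Theta> (\<lambda>z. - ((l z - \<eta> z) * d z))"
      by (intro Bochner_Integration.integral_nonneg) simp
    then show ?thesis by simp
  qed
  then have neg: "H_int \<Theta> (\<lambda>z. (l z - \<eta> z) * d z) * (2 * \<gamma> * M) \<le> 0"
    using \<gamma> M_pos by (intro mult_nonpos_nonneg) auto
  note V = claim_quadratic_pos_def[OF d1 d2 d3]
  show "retention_value c \<gamma> T \<xi> \<le> retention_value c \<gamma> T \<eta>"
    using exp neg V(1) \<gamma> mult_nonneg_nonneg[of \<gamma> "claim_quadratic T d"] by linarith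
  assume "retention_value c \<gamma> T \<xi> = retention_value c \<gamma> T \<eta>"
  then have "\<gamma> * claim_quadratic T d \<le> 0" using exp neg by linarith
  then have "claim_quadratic T d = 0" using V(1) \<gamma> by (simp add: mult_le_0_iff)
  then have "AE z in \<Theta>. (d z)\<^sup>2 = 0"
    using V(2) d2 by (subst integral_nonneg_eq_0_iff_AE[symmetric]) auto
  then show "AE z in \<Theta>. \<xi> z = \<eta> z" by eventually_elim (simp add: d_def)
qed

text \<open>
  If nothing were retained, the line would be a positive constant by the assumption on the premium, and its
  clamped version positive at every positive mark. If the intercept were not positive, the decreasing line would
  be nowhere positive and nothing would be retained.
\<close>

lemma first_order_positive:
  assumes fo: "first_order c \<gamma> T \<eta>"
  shows "0 < H_int \<Theta> \<eta>" "0 < line (claim_moments \<eta>) 0"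
proof -
  have \<eta>: "\<eta> \<in> claim_functions" and sol: "\<And>z. \<eta> z = min z (max 0 (line (claim_moments \<eta>) z))"
    using fo by (simp_all add: first_order_def)
  show pos: "0 < H_int \<Theta> \<eta>"
  proof (rule ccontr)
    assume "\<not> ?thesis"
    then have p: "H_int \<Theta> \<eta> = 0" using nn_integral_claim(2)[OF \<eta>] by simp
    have "AE z in \<Theta>. 0 \<le> \<eta> z" by (rule AE_I2) (simp add: claim_nonneg[OF \<eta>])
    then have ae: "AE z in \<Theta>. \<eta> z = 0"
      using p integral_nonneg_eq_0_iff_AE[OF integrable_claim(1)[OF \<eta>]] by blast
    then have q: "H_int \<Theta> (\<lambda>z. z * \<eta> z) = H_int \<Theta> (\<lambda>z. 0)"
      using integrable_claim(2)[OF \<eta>] by (intro integral_cong_AE) (auto elim!: eventually_mono)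
    then have min_eq: "\<eta> z = min z ((c * T - M) / (2 * \<gamma> * M))" for z
      using safety \<gamma> M_pos by (subst sol) (simp add: target_line_def claim_moments_def p)
    have k: "0 < (c * T - M) / (2 * \<gamma> * M)" using safety \<gamma> M_pos by simp
    from ae have "AE z in \<Theta>. z = 0"
    proof eventually_elim
      fix z assume "\<eta> z = 0"
      then show "z = 0" using min_eq[of z] k by (simp add: min_def split: if_splits)
    qed
    then have "m1 = H_int \<Theta> (\<lambda>z. 0)" by (intro integral_cong_AE) auto
    with mean_mark_pos show False by simp
  qed
  show "0 < line (claim_moments \<eta>) 0"
  proof (rule ccontr)
    assume *: "\<not> 0 < line (claim_moments \<eta>) 0"
    have "line (claim_moments \<eta>) z \<le> line (claim_moments \<eta>) 0" if "0 \<le> z" for z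
      using that \<gamma> B_pos Lambda_pos pos M_pos
      unfolding target_line_def claim_moments_def by (intro divide_right_mono diff_left_mono) auto
    with * have "\<eta> z = 0" if "0 \<le> z" for z
      using that by (subst sol) (force simp: max_def min_def)
    then have "H_int \<Theta> \<eta> = H_int \<Theta> (\<lambda>z. 0)" by (intro Bochner_Integration.integral_cong) auto
    with pos show False by simp
  qed
qed

end

end

theorem theorem2:
  fixes Q :: "'a measure" and F :: "real \<Rightarrow> 'a measure" and \<Theta> :: "real measure"
    and \<tau> :: "nat \<Rightarrow> 'a \<Rightarrow> ennreal" and Z :: "nat \<Rightarrow> 'a \<Rightarrow> real" and lam :: "real \<Rightarrow> 'a \<Rightarrow> real"
    and f :: "real \<Rightarrow> real" and \<Lambda> \<beta> lbar lam0 R0 \<rho> c \<gamma> T :: real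
  assumes "prob_space Q" and "usual_conditions Q F"
    and "sets \<Theta> = sets Rplus" and "integrable \<Theta> (\<lambda>z. 1 + z + z\<^sup>2)"
    and "f = (\<lambda>z. \<Lambda> * z)" and "\<Lambda> > 0" and "H_int \<Theta> f < \<beta>"
    and "0 \<le> lbar" and "lbar < lam0"
    and "marked_hawkes Q F \<Theta> f \<beta> lbar lam0 \<tau> Z lam"
    and "\<gamma> > 0" and "T > 0"
    and "\<not> bounded (measure_support \<Theta>)"
    and "c * T - cum_mean Q lam T > 0"
  shows "\<exists>\<phi>. optimal_contract Q \<Theta> \<tau> Z R0 \<rho> c \<gamma> T \<phi> \<and>
    (\<forall>h. optimal_contract Q \<Theta> \<tau> Z R0 \<rho> c \<gamma> T h \<longrightarrow> (AE z in \<Theta>. h z = \<phi> z)) \<and>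
    (\<forall>z\<ge>0. 0 \<le> \<phi> z \<and> \<phi> z \<le> z) \<and>
    (let g = G_fun Q \<Theta> f \<beta> lbar lam c \<gamma> T \<phi>;
         A0 = {z \<in> {0..}. g z < 0};
         A1 = {z \<in> {0..}. g z = 0};
         A2 = {z \<in> {0..}. g z > 0};
         slope = 1 - \<Lambda> * (B_coeff Q \<Theta> f \<beta> lam T / (2 * cum_mean Q lam T)) * H_int \<Theta> (\<lambda>x. \<phi> x - x);
         C = (c * T - cum_mean Q lam T + 2 * \<gamma> * A_coeff Q \<Theta> f \<beta> lbar lam T * H_int \<Theta> (\<lambda>x. \<phi> x - x)
                + \<gamma> * B_coeff Q \<Theta> f \<beta> lam T * H_int \<Theta> (\<lambda>x. \<Lambda> * x * (\<phi> x - x)))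
             / (2 * \<gamma> * cum_mean Q lam T)
     in (A0 \<noteq> {} \<and> (\<forall>z\<in>A0. \<phi> z = 0)) \<and>
        (A1 \<noteq> {} \<and> slope > 1 \<and> (\<forall>z\<in>A1. \<phi> z = slope * z - C)) \<and>
        (A2 \<noteq> {} \<and> (\<forall>z\<in>A2. \<phi> z = z)))"
proof -
  have f: "f = (\<lambda>z. \<Lambda> * z)" by fact
  \<comment> \<open>With mean mark zero, \<open>\<Theta>\<close> would be concentrated at \<open>0\<close> and its support bounded.\<close>
  have mark_pos: "0 < H_int \<Theta> (\<lambda>z. z)"
  proof (rule ccontr)
    have sp: "space \<Theta> = {0..}" using sets_eq_imp_space_eq[OF assms(3)] by (simp add: space_restrict_space)
    have id: "(\<lambda>z. z) \<in> borel_measurable \<Theta>"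
      unfolding measurable_cong_sets[OF assms(3) refl] by (rule measurable_restrict_space1) simp
    have int: "integrable \<Theta> (\<lambda>z. z)"
      by (rule Bochner_Integration.integrable_bound[OF assms(4) id]) (auto simp: sp intro!: AE_I2)
    assume "\<not> ?thesis"
    moreover have "0 \<le> H_int \<Theta> (\<lambda>z. z)" by (intro Bochner_Integration.integral_nonneg) (simp add: sp)
    ultimately have "H_int \<Theta> (\<lambda>z. z) = 0" by simp
    moreover have "AE z in \<Theta>. 0 \<le> z" by (rule AE_I2) (simp add: sp)
    ultimately have "AE z in \<Theta>. z = 0" using integral_nonneg_eq_0_iff_AE[OF int] by simp
    then obtain N where N: "N \<in> null_sets \<Theta>" "{z \<in> space \<Theta>. z \<noteq> 0} \<subseteq> N" by (auto simp: eventually_ae_filter)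
    obtain z where z: "z \<in> measure_support \<Theta>" "1 < norm z"
      using assms(13) unfolding bounded_iff by (meson not_le)
    then have "ball z 1 \<inter> space \<Theta> \<subseteq> N" using N(2) by (auto simp: measure_support_def sp dist_real_def)
    then have "emeasure \<Theta> (ball z 1 \<inter> space \<Theta>) = 0"
      using N(1) emeasure_mono[of "ball z 1 \<inter> space \<Theta>" N \<Theta>] by (auto simp: null_sets_def)
    moreover have "0 < emeasure \<Theta> (ball z 1 \<inter> space \<Theta>)" using z by (simp add: measure_support_def)
    ultimately show False by simp
  qed
  interpret marked_hawkes_model Q F \<Theta> \<tau> Z lam \<Lambda> \<beta> lbar lam0
    using assms mark_pos by (auto simp: marked_hawkes_model_def marked_hawkes_model_axioms_def)
  define M A B where "M = cum_mean Q lam T" and "A = A_coeff Q \<Theta> f \<beta> lbar lam T" and "B = B_coeff Q \<Theta> f \<beta> lam T"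
  have M: "0 < M" and B: "0 < B" and \<gamma>: "0 < \<gamma>"
    using cum_mean_pos B_coeff_pos assms by (auto simp: M_def B_def)
  note T = \<open>T > 0\<close> and safety = \<open>c * T - cum_mean Q lam T > 0\<close>
  obtain \<eta> where fo: "first_order c \<gamma> T \<eta>" by (rule first_order_solvable[OF T \<gamma> safety])
  define p q where "p = H_int \<Theta> \<eta>" and "q = H_int \<Theta> (\<lambda>z. z * \<eta> z)"
  define l where "l = target_line c \<gamma> T (claim_moments \<eta>)"
  have \<eta>: "\<eta> \<in> claim_functions" and \<eta>_l: "\<And>z. \<eta> z = min z (max 0 (l z))"
    using fo by (simp_all add: first_order_def l_def)
  define a where "a = l 0"
  define b where "b = \<Lambda> * (B / (2 * M)) * p"
  have p: "0 < p" and a: "0 < a"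
    using first_order_positive[OF T \<gamma> safety fo] by (auto simp: p_def a_def l_def)
  have b: "0 < b" using Lambda_pos B M p by (simp add: b_def)
  have a_eq: "a = (c * T - M - 2 * \<gamma> * A * p - \<gamma> * B * \<Lambda> * q) / (2 * \<gamma> * M)"
    by (simp add: a_def l_def target_line_def claim_moments_def p_def q_def M_def A_def B_def f coeff_A_def coeff_B_def)
  have l_eq: "l z = a - b * z" for z
    using \<gamma> M unfolding a_def l_def target_line_def
    by (simp add: b_def claim_moments_def p_def M_def B_def f coeff_B_def diff_divide_distrib)
  define \<phi> where "\<phi> z = z - \<eta> z" for z
  have contr: "\<phi> \<in> contracts \<Theta>"
    using claim_measurable[OF \<eta>] claim_nonneg[OF \<eta>] claim_le[OF \<eta>]
    unfolding contracts_def \<phi>_def by (auto intro!: AE_I2 simp: measurable_cong_sets[OF sets_Theta refl])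
  have crit: "criterion Q \<Theta> \<tau> Z R0 \<rho> c \<gamma> T h
      = R0 + \<rho> * H_int \<Theta> (\<lambda>z. z) * T - c * T * H_int \<Theta> (\<lambda>z. z) + retention_value c \<gamma> T \<xi>"
    if "h \<in> contracts \<Theta>" "\<xi> \<in> claim_functions" "AE z in \<Theta>. h z = z - \<xi> z" for h \<xi>
    by (rule criterion_eq[OF _ that(2,3) T]) (use that(1) in \<open>simp add: contracts_def\<close>)
  have crit_\<phi>: "criterion Q \<Theta> \<tau> Z R0 \<rho> c \<gamma> T \<phi>
      = R0 + \<rho> * H_int \<Theta> (\<lambda>z. z) * T - c * T * H_int \<Theta> (\<lambda>z. z) + retention_value c \<gamma> T \<eta>"
    by (rule crit[OF contr \<eta>]) (simp add: \<phi>_def)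
  have opt: "optimal_contract Q \<Theta> \<tau> Z R0 \<rho> c \<gamma> T \<phi>"
    unfolding optimal_contract_def
  proof (intro conjI ballI contr)
    fix h assume h: "h \<in> contracts \<Theta>"
    then obtain \<xi> where \<xi>: "\<xi> \<in> claim_functions" "AE z in \<Theta>. h z = z - \<xi> z" by (rule contract_imp_claim_function)
    show "criterion Q \<Theta> \<tau> Z R0 \<rho> c \<gamma> T h \<le> criterion Q \<Theta> \<tau> Z R0 \<rho> c \<gamma> T \<phi>"
      unfolding crit[OF h \<xi>] crit_\<phi> using retention_value_le(1)[OF T \<gamma> safety fo \<xi>(1)] by simp
  qed
  have uniq: "AE z in \<Theta>. h z = \<phi> z" if "optimal_contract Q \<Theta> \<tau> Z R0 \<rho> c \<gamma> T h" for h
  proof -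
    have h: "h \<in> contracts \<Theta>" and le: "criterion Q \<Theta> \<tau> Z R0 \<rho> c \<gamma> T \<phi> \<le> criterion Q \<Theta> \<tau> Z R0 \<rho> c \<gamma> T h"
      using that contr by (auto simp: optimal_contract_def)
    obtain \<xi> where \<xi>: "\<xi> \<in> claim_functions" "AE z in \<Theta>. h z = z - \<xi> z" using h by (rule contract_imp_claim_function)
    have "retention_value c \<gamma> T \<xi> = retention_value c \<gamma> T \<eta>"
      using le retention_value_le(1)[OF T \<gamma> safety fo \<xi>(1)] unfolding crit[OF h \<xi>] crit_\<phi> by simp
    from retention_value_le(2)[OF T \<gamma> safety fo \<xi>(1) this] \<xi>(2)
    show ?thesis by eventually_elim (simp add: \<phi>_def)
  qed
  have H1: "H_int \<Theta> (\<lambda>x. \<phi> x - x) = - p" by (simp add: \<phi>_def p_def)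
  have H2: "H_int \<Theta> (\<lambda>x. \<Lambda> * x * (\<phi> x - x)) = - (\<Lambda> * q)" by (simp add: \<phi>_def q_def mult.assoc)
  have G: "G_fun Q \<Theta> f \<beta> lbar lam c \<gamma> T \<phi> z = 2 * \<gamma> * M * (\<eta> z - l z)" for z
  proof -
    have "2 * \<gamma> * M * l z = c * T - M - 2 * \<gamma> * A * p - \<gamma> * B * \<Lambda> * q - \<gamma> * B * \<Lambda> * p * z"
      using \<gamma> M by (simp add: l_eq a_eq b_def field_simps)
    then have "2 * \<gamma> * M * (\<eta> z - l z) = 2 * \<gamma> * M * \<eta> z
        - (c * T - M - 2 * \<gamma> * A * p - \<gamma> * B * \<Lambda> * q - \<gamma> * B * \<Lambda> * p * z)" by (simp add: right_diff_distrib)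
    then show ?thesis
      unfolding G_fun_def H1 using H2 by (simp add: f M_def A_def B_def \<phi>_def algebra_simps)
  qed
  have sgn: "G_fun Q \<Theta> f \<beta> lbar lam c \<gamma> T \<phi> z < 0 \<longleftrightarrow> \<eta> z < l z"
    "G_fun Q \<Theta> f \<beta> lbar lam c \<gamma> T \<phi> z = 0 \<longleftrightarrow> \<eta> z = l z"
    "G_fun Q \<Theta> f \<beta> lbar lam c \<gamma> T \<phi> z > 0 \<longleftrightarrow> l z < \<eta> z" for z
    unfolding G using \<gamma> M by (auto simp: mult_less_0_iff zero_less_mult_iff)
  have A0: "\<eta> 0 < l 0" using a unfolding \<eta>_l l_eq by simp
  \<comment> \<open>The line meets the diagonal at \<open>a / (1 + b)\<close>.\<close>
  have A1: "\<eta> (a / (1 + b)) = l (a / (1 + b))"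
  proof -
    have "l (a / (1 + b)) = a / (1 + b)" using b unfolding l_eq by (simp add: field_simps)
    moreover have "0 \<le> a / (1 + b)" using a b by simp
    ultimately show ?thesis unfolding \<eta>_l by simp
  qed
  \<comment> \<open>The line takes the value \<open>- 1\<close> at \<open>(a + 1) / b\<close>.\<close>
  have A2: "l ((a + 1) / b) < \<eta> ((a + 1) / b)"
  proof -
    have "l ((a + 1) / b) = - 1" using b unfolding l_eq by simp
    moreover have "0 \<le> (a + 1) / b" using a b by simp
    ultimately show ?thesis unfolding \<eta>_l by simp
  qed
  show ?thesis
  proof (intro exI[of _ \<phi>] conjI opt)
    show "\<forall>h. optimal_contract Q \<Theta> \<tau> Z R0 \<rho> c \<gamma> T h \<longrightarrow> (AE z in \<Theta>. h z = \<phi> z)" using uniq by blast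
    show "\<forall>z\<ge>0. 0 \<le> \<phi> z \<and> \<phi> z \<le> z" using claim_nonneg[OF \<eta>] claim_le[OF \<eta>] by (simp add: \<phi>_def)
    show "let g = G_fun Q \<Theta> f \<beta> lbar lam c \<gamma> T \<phi>;
         A0 = {z \<in> {0..}. g z < 0};
         A1 = {z \<in> {0..}. g z = 0};
         A2 = {z \<in> {0..}. g z > 0};
         slope = 1 - \<Lambda> * (B_coeff Q \<Theta> f \<beta> lam T / (2 * cum_mean Q lam T)) * H_int \<Theta> (\<lambda>x. \<phi> x - x);
         C = (c * T - cum_mean Q lam T + 2 * \<gamma> * A_coeff Q \<Theta> f \<beta> lbar lam T * H_int \<Theta> (\<lambda>x. \<phi> x - x)
                + \<gamma> * B_coeff Q \<Theta> f \<beta> lam T * H_int \<Theta> (\<lambda>x. \<Lambda> * x * (\<phi> x - x)))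
             / (2 * \<gamma> * cum_mean Q lam T)
     in (A0 \<noteq> {} \<and> (\<forall>z\<in>A0. \<phi> z = 0)) \<and>
        (A1 \<noteq> {} \<and> slope > 1 \<and> (\<forall>z\<in>A1. \<phi> z = slope * z - C)) \<and>
        (A2 \<noteq> {} \<and> (\<forall>z\<in>A2. \<phi> z = z))"
      unfolding Let_def sgn H1 H2 M_def[symmetric] A_def[symmetric] B_def[symmetric]
    proof (intro conjI ballI)
      show "{z \<in> {0..}. \<eta> z < l z} \<noteq> {}" using A0 by auto
      show "{z \<in> {0..}. \<eta> z = l z} \<noteq> {}" using A1 a b by (auto intro!: exI[of _ "a / (1 + b)"])
      show "{z \<in> {0..}. l z < \<eta> z} \<noteq> {}" using A2 a b by (auto intro!: exI[of _ "(a + 1) / b"])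
      show "1 < 1 - \<Lambda> * (B / (2 * M)) * - p" using b by (simp add: b_def)
      show "\<phi> z = 0" if "z \<in> {z \<in> {0..}. \<eta> z < l z}" for z
        using that \<eta>_l[of z] by (auto simp: \<phi>_def)
      show "\<phi> z = z" if "z \<in> {z \<in> {0..}. l z < \<eta> z}" for z
        using that \<eta>_l[of z] by (auto simp: \<phi>_def)
      show "\<phi> z = (1 - \<Lambda> * (B / (2 * M)) * - p) * z - (c * T - M + 2 * \<gamma> * A * - p + \<gamma> * B * - (\<Lambda> * q)) / (2 * \<gamma> * M)"
        if "z \<in> {z \<in> {0..}. \<eta> z = l z}" for z
      proof -
        have "(c * T - M + 2 * \<gamma> * A * - p + \<gamma> * B * - (\<Lambda> * q)) / (2 * \<gamma> * M) = a"
          unfolding a_eq by (simp add: mult.assoc)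
        moreover have "\<phi> z = z - (a - b * z)" using that l_eq[of z] by (simp add: \<phi>_def)
        ultimately show ?thesis by (simp only: b_def) (simp add: algebra_simps)
      qed
    qed
  qed
qed

end
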